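(* Let $M$ be a smooth Riemannian manifold of dimension $m$. Let $Y$ be a random field which is a random element of $C^q(M,\mathbb{R}^k)$ with $q\ge1+\max\{m-k,0\}$, such that $\mathbb{E}\{J_pY\}$ is finite and continuous with respect to $p\in M$. Let $\lambda$ be a random vector in $\mathbb{R}^k$, independent of $Y$, with a continuous, nowhere vanishing, bounded density $\rho_\lambda$. Then $X:=Y-\lambda$ is z-KROK.
   Context: $M$ is a smooth manifold, possibly non-compact, with Riemannian metric $g$. $C^q(M,\mathbb{R}^k)$ carries the weak Whitney topology; a random field $X$ is a measurable map from a probability space into it; $[Y]$ denotes the law of a random element $Y$. For $f\in C^1(M,\mathbb{R}^k)$ let $J_pf:=\|d_pf^1\wedge\cdots\wedge d_pf^k\|$, with the norm on $\Lambda^kT^*_pM$ induced by $g$ through $\langle v_1\wedge\dots\wedge v_k,w_1\wedge\dots\wedge w_k\rangle=\det(\langle v_i,w_j\rangle)_{i,j}$. A regular conditional probability of $X$ given $X(p)$ is a map $(x,B)\mapsto\mu(p,x)(B)$ ($x\in\mathbb{R}^k$, $B\subset C^1(M,\mathbb{R}^k)$ Borel) such that each $\mu(p,x)$ is a Borel probability measure, $x\mapsto\mu(p,x)(B)$ is Borel, and $\mathbb{P}\{X\in B,\,X(p)\in V\}=\int_V\mu(p,x)(B)\,d[X(p)](x)$ for all Borel $B$ and $V\subset\mathbb{R}^k$. $X$ is z-KROK if: (i) $X$ is a random element of $C^1(M,\mathbb{R}^k)$; (ii) almost surely $0$ is a regular value of $X$; (iii) for every $p\in M$ the law of $X(p)$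 is absolutely continuous with density $\rho_{X(p)}:\mathbb{R}^k\to[0,+\infty)$; (iv) $(p,x)\mapsto\rho_{X(p)}(x)$ on $M\times\mathbb{R}^k$ is continuous at $(p,0)$ for all $p\in M$; (v) there are regular conditional probabilities $\mu(p,\cdot)$ of $X$ given $X(p)$, $p\in M$, such that the measures $J_p\cdot\mu(p,x)$, $B\mapsto\int_BJ_pf\,d\mu(p,x)(f)$, are finite and $(p,x)\mapsto J_p\cdot\mu(p,x)$, with values in the finite positive Borel measures on $C^1(M,\mathbb{R}^k)$ with the weak topology (tested on bounded continuous functions), is continuous at $(p,0)$ for all $p\in M$. *)

theory Defs
  imports "HOL-Probability.Probability" "HOL-Library.Extended_Nat"
begin

section \<open>Functions of class $C^r$ on open subsets of a Euclidean space\<close>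

text \<open>Iterated derivatives: \<open>iter_deriv [v\<^sub>1, \<dots>, v\<^sub>j] f x\<close> is
  \<open>\<partial>\<^sub>v\<^sub>1 \<dots> \<partial>\<^sub>v\<^sub>j f (x)\<close>. It is used only where the derivatives involved exist.\<close>

fun iter_deriv ::
  "'b::real_normed_vector list \<Rightarrow> ('b \<Rightarrow> 'c::real_normed_vector) \<Rightarrow> 'b \<Rightarrow> 'c" where
  "iter_deriv [] f = f"
| "iter_deriv (v # vs) f = (\<lambda>x. frechet_derivative (iter_deriv vs f) (at x) v)"

text \<open>The order \<open>r\<close> may be infinite.\<close>

definition C_on ::
  "enat \<Rightarrow> ('b::euclidean_space \<Rightarrow> 'c::real_normed_vector) \<Rightarrow> 'b set \<Rightarrow> bool" where
  "C_on r f S \<longleftrightarrow> (\<forall>vs. set vs \<subseteq> Basis \<longrightarrow>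
     (enat (length vs) \<le> r \<longrightarrow> continuous_on S (iter_deriv vs f)) \<and>
     (enat (length vs) < r \<longrightarrow> (\<forall>x\<in>S. iter_deriv vs f differentiable (at x))))"


section \<open>Riemannian manifolds\<close>

text \<open>The manifold is the whole type \<open>'a\<close>, a Hausdorff second countable space, with a smooth
  structure given by an atlas (not necessarily maximal) of charts \<open>(U, \<phi>)\<close> into \<open>real^'m\<close>; its
  dimension is \<open>CARD('m)\<close>. Only the values of \<open>\<phi>\<close> on \<open>U\<close> matter.\<close>

type_synonym ('a, 'm) chart = "'a set \<times> ('a \<Rightarrow> real^'m)"

definition chart_inv :: "('a, 'm::finite) chart \<Rightarrow> real^'m \<Rightarrow> 'a" where
  "chart_inv c = inv_into (fst c) (snd c)"

definition is_chart :: "('a::topological_space, 'm::finite) chart \<Rightarrow> bool" where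
  "is_chart c \<longleftrightarrow> open (fst c) \<and> open (snd c ` fst c) \<and>
     homeomorphism (fst c) (snd c ` fst c) (snd c) (chart_inv c)"

definition smooth_atlas ::
  "('a::{t2_space, second_countable_topology}, 'm::finite) chart set \<Rightarrow> bool" where
  "smooth_atlas A \<longleftrightarrow> (\<forall>c\<in>A. is_chart c) \<and> (\<Union>c\<in>A. fst c) = UNIV \<and>
     (\<forall>c\<in>A. \<forall>d\<in>A. C_on \<infinity> (snd d \<circ> chart_inv c) (snd c ` (fst c \<inter> fst d)))"

text \<open>A Riemannian metric as a covariant 2-tensor field: \<open>g c p\<close> is the matrix
  \<open>(g\<^sub>i\<^sub>j(p))\<close> of the inner product on the tangent space at \<open>p\<close>, in the coordinates of
  the chart \<open>c\<close> around \<open>p\<close>. The last clause is the change of coordinates formula, with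
  the Jacobian matrix of the transition map.\<close>

definition riemannian_metric ::
  "('a::{t2_space, second_countable_topology}, 'm::finite) chart set
    \<Rightarrow> (('a, 'm) chart \<Rightarrow> 'a \<Rightarrow> real^'m^'m) \<Rightarrow> bool" where
  "riemannian_metric A g \<longleftrightarrow>
     (\<forall>c\<in>A. C_on \<infinity> (g c \<circ> chart_inv c) (snd c ` fst c) \<and>
       (\<forall>p\<in>fst c. transpose (g c p) = g c p \<and> (\<forall>v. v \<noteq> 0 \<longrightarrow> v \<bullet> (g c p *v v) > 0))) \<and>
     (\<forall>c\<in>A. \<forall>d\<in>A. \<forall>p\<in>fst c \<inter> fst d.
       let T = matrix (frechet_derivative (snd d \<circ> chart_inv c) (at (snd c p)))
       in g c p = transpose T ** g d p ** T)"

definition chart_deriv ::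
  "('a, 'm::finite) chart \<Rightarrow> ('a \<Rightarrow> 'b::real_normed_vector) \<Rightarrow> 'a \<Rightarrow> real^'m \<Rightarrow> 'b" where
  "chart_deriv c f p = frechet_derivative (f \<circ> chart_inv c) (at (snd c p))"

definition differential_coords ::
  "('a, 'm::finite) chart \<Rightarrow> ('a \<Rightarrow> real) \<Rightarrow> 'a \<Rightarrow> real^'m" where
  "differential_coords c f p = (\<chi> i. chart_deriv c f p (axis i 1))"

text \<open>The inner product induced by the metric on the cotangent space: its matrix is the inverse
  \<open>(g\<^sup>i\<^sup>j(p))\<close>.\<close>

definition cotangent_inner ::
  "(('a, 'm::finite) chart \<Rightarrow> 'a \<Rightarrow> real^'m^'m) \<Rightarrow> ('a, 'm) chart \<Rightarrow> 'a
    \<Rightarrow> real^'m \<Rightarrow> real^'m \<Rightarrow> real" where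
  "cotangent_inner g c p \<alpha> \<beta> = \<alpha> \<bullet> (matrix_inv (g c p) *v \<beta>)"

text \<open>\<open>J\<^sub>p f = \<parallel>d\<^sub>p f\<^sup>1 \<and> \<dots> \<and> d\<^sub>p f\<^sup>k\<parallel>\<close> for the norm of the inner product
  \<open>\<langle>v\<^sub>1 \<and> \<dots> \<and> v\<^sub>k, w\<^sub>1 \<and> \<dots> \<and> w\<^sub>k\<rangle> = det \<langle>v\<^sub>i, w\<^sub>j\<rangle>\<close>. The value does not depend on the
  chart around \<open>p\<close> that is chosen.\<close>

definition jac ::
  "('a, 'm::finite) chart set \<Rightarrow> (('a, 'm) chart \<Rightarrow> 'a \<Rightarrow> real^'m^'m) \<Rightarrow> 'a
    \<Rightarrow> ('a \<Rightarrow> real^'k::finite) \<Rightarrow> real" where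
  "jac A g p f = (let c = (SOME c. c \<in> A \<and> p \<in> fst c) in
     sqrt (det (\<chi> i j. cotangent_inner g c p
       (differential_coords c (\<lambda>x. f x $ i) p)
       (differential_coords c (\<lambda>x. f x $ j) p))))"

definition regular_value ::
  "('a, 'm::finite) chart set \<Rightarrow> ('a \<Rightarrow> real^'k::finite) \<Rightarrow> real^'k \<Rightarrow> bool" where
  "regular_value A f y \<longleftrightarrow>
     (\<forall>p. f p = y \<longrightarrow> (\<forall>c\<in>A. p \<in> fst c \<longrightarrow> surj (chart_deriv c f p)))"


section \<open>The spaces $C^r(M, R^k)$ with the weak Whitney topology\<close>

definition C_space ::
  "('a, 'm::finite) chart set \<Rightarrow> enat \<Rightarrow> ('a \<Rightarrow> real^'k::finite) set" where
  "C_space A r = {f. \<forall>c\<in>A. C_on r (f \<circ> chart_inv c) (snd c ` fst c)}"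

text \<open>Functions close to \<open>f\<close> on the compact subset \<open>K\<close> of the domain of the chart \<open>c\<close>, together
  with their derivatives up to the order \<open>n\<close>.\<close>

definition whitney_nbhd ::
  "('a, 'm::finite) chart set \<Rightarrow> enat \<Rightarrow> ('a \<Rightarrow> real^'k::finite) \<Rightarrow> ('a, 'm) chart
    \<Rightarrow> 'a set \<Rightarrow> nat \<Rightarrow> real \<Rightarrow> ('a \<Rightarrow> real^'k) set" where
  "whitney_nbhd A r f c K n e = {h \<in> C_space A r.
     \<forall>vs. set vs \<subseteq> Basis \<and> length vs \<le> n \<longrightarrow>
       (\<forall>x\<in>snd c ` K. norm (iter_deriv vs (h \<circ> chart_inv c) x
                             - iter_deriv vs (f \<circ> chart_inv c) x) < e)}"

definition weak_whitney ::
  "('a::topological_space, 'm::finite) chart set \<Rightarrow> enat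
    \<Rightarrow> ('a \<Rightarrow> real^'k::finite) topology" where
  "weak_whitney A r = topology_generated_by
     {whitney_nbhd A r f c K n e | f c K n e.
        f \<in> C_space A r \<and> c \<in> A \<and> compact K \<and> K \<subseteq> fst c \<and> enat n \<le> r \<and> 0 < e}"

definition borel_of :: "'b topology \<Rightarrow> 'b measure" where
  "borel_of T = sigma (topspace T) {U. openin T U}"

text \<open>The weak topology on the finite Borel measures on \<open>T\<close>, i.e. the coarsest one for which
  integration of each bounded continuous function is continuous.\<close>

definition weak_measure_topology :: "'b topology \<Rightarrow> 'b measure topology" where
  "weak_measure_topology T = topology_generated_by
     {{\<nu>. sets \<nu> = sets (borel_of T) \<and> finite_measure \<nu> \<and> (\<integral>x. h x \<partial>\<nu>) \<in> V} | h V.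
        continuous_map T euclideanreal h \<and> bounded (h ` topspace T) \<and> open V}"


section \<open>z-KROK random fields\<close>

text \<open>Independence of two random elements; \<open>indep_var\<close> would force them to take values in the
  same type.\<close>

definition indep_elements ::
  "'w measure \<Rightarrow> 'b measure \<Rightarrow> ('w \<Rightarrow> 'b) \<Rightarrow> 'c measure \<Rightarrow> ('w \<Rightarrow> 'c) \<Rightarrow> bool" where
  "indep_elements P S X T Y \<longleftrightarrow> X \<in> measurable P S \<and> Y \<in> measurable P T \<and>
     prob_space.indep_set P {X -` B \<inter> space P | B. B \<in> sets S}
                            {Y -` B \<inter> space P | B. B \<in> sets T}"

definition regular_cond_prob ::
  "('a::topological_space, 'm::finite) chart set \<Rightarrow> 'w measure
    \<Rightarrow> ('w \<Rightarrow> 'a \<Rightarrow> real^'k::finite) \<Rightarrow> 'a \<Rightarrow> (real^'k \<Rightarrow> ('a \<Rightarrow> real^'k) measure) \<Rightarrow> bool" where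
  "regular_cond_prob A P X p \<mu> \<longleftrightarrow>
     (\<forall>x. sets (\<mu> x) = sets (borel_of (weak_whitney A 1)) \<and> prob_space (\<mu> x)) \<and>
     (\<forall>B\<in>sets (borel_of (weak_whitney A 1)).
       (\<lambda>x. emeasure (\<mu> x) B) \<in> borel_measurable borel \<and>
       (\<forall>V\<in>sets borel. emeasure P {\<omega> \<in> space P. X \<omega> \<in> B \<and> X \<omega> p \<in> V} =
          (\<integral>\<^sup>+x\<in>V. emeasure (\<mu> x) B \<partial>(distr P borel (\<lambda>\<omega>. X \<omega> p)))))"

text \<open>The densities \<open>\<rho> p\<close>, like the conditional probabilities \<open>\<mu> p\<close>, are determined by \<open>X\<close> only
  almost everywhere; the conditions ask for versions of them. As \<open>limitin\<close> along the punctured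
  filter \<open>at z\<close> to the value at \<open>z\<close>, the last clause is continuity at \<open>z = (p, 0)\<close>.\<close>

definition z_KROK ::
  "('a::{t2_space, second_countable_topology}, 'm::finite) chart set
    \<Rightarrow> (('a, 'm) chart \<Rightarrow> 'a \<Rightarrow> real^'m^'m) \<Rightarrow> 'w measure
    \<Rightarrow> ('w \<Rightarrow> 'a \<Rightarrow> real^'k::finite) \<Rightarrow> bool" where
  "z_KROK A g P X \<longleftrightarrow>
     prob_space P \<and>
     X \<in> measurable P (borel_of (weak_whitney A 1)) \<and>
     (AE \<omega> in P. regular_value A (X \<omega>) 0) \<and>
     (\<exists>\<rho> :: 'a \<Rightarrow> real^'k \<Rightarrow> real.
       (\<forall>p. (\<forall>x. 0 \<le> \<rho> p x) \<and> distributed P lborel (\<lambda>\<omega>. X \<omega> p) (\<lambda>x. ennreal (\<rho> p x))) \<and>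
       (\<forall>p. isCont (\<lambda>(p, x). \<rho> p x) (p, 0))) \<and>
     (\<exists>\<mu> :: 'a \<Rightarrow> real^'k \<Rightarrow> ('a \<Rightarrow> real^'k) measure.
       (\<forall>p. regular_cond_prob A P X p (\<mu> p)) \<and>
       (\<forall>p x. finite_measure (density (\<mu> p x) (\<lambda>f. ennreal (jac A g p f)))) \<and>
       (\<forall>p. limitin (weak_measure_topology (weak_whitney A 1))
              (\<lambda>(p, x). density (\<mu> p x) (\<lambda>f. ennreal (jac A g p f)))
              (density (\<mu> p 0) (\<lambda>f. ennreal (jac A g p f))) (at (p, 0))))"

end

theory Submission
  imports Defs
begin

text \<open>Independence and the density of \<open>\<lambda>\<close> give the joint law of \<open>X\<close> and \<open>X(p)\<close>: substituting
  \<open>\<lambda> = Y(p) - x\<close>, the density of \<open>X(p)\<close> is \<open>\<rho>\<^sub>p(x) = E \<rho>\<^sub>\<lambda>(Y(p) - x) > 0\<close>, and a regular conditional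
  probability given \<open>X(p) = x\<close> is the law of \<open>Y - Y(p) + x\<close> under the probability with density
  \<open>\<rho>\<^sub>\<lambda>(Y(p) - x) / \<rho>\<^sub>p(x)\<close>. Translations do not change \<open>J\<^sub>p\<close>, so testing \<open>J\<^sub>p \<mu>(p, x)\<close> on \<open>h\<close>
  gives \<open>E (h(Y - Y(p) + x) \<rho>\<^sub>\<lambda>(Y(p) - x) J\<^sub>p Y) / \<rho>\<^sub>p(x)\<close>. Its continuity follows from the
  convergence \<open>J\<^sub>p Y \<rightarrow> J\<^sub>p\<^sub>0 Y\<close> in \<open>L\<^sup>1\<close>, which is Scheffe's lemma since \<open>E J\<^sub>p Y\<close> is continuous.

  \<open>0\<close> is a critical value of \<open>X\<close> exactly if \<open>\<lambda>\<close> is one of \<open>Y\<close>; by Fubini this has probability \<open>0\<close>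
  as soon as the critical values of each \<open>C\<^sup>q\<close> function have measure \<open>0\<close>. This is the Morse-Sard
  theorem for the sharp order \<open>q = 1 + max (m - k) 0\<close>. Where a partial derivative of a component
  does not vanish, that component is straightened to a coordinate, and slicing removes one dimension
  on both sides. There remain the points where the whole derivative vanishes, where Morse's
  decomposition applies: a set \<open>A\<close> is a countable union of parametrized pieces on which every \<open>C\<^sup>r\<close>
  function that vanishes on \<open>A\<close> is \<open>o(|x - y|\<^sup>r)\<close>.\<close>

section \<open>Functions of class $C^n$\<close>

text \<open>The usual proof of Sard's theorem straightens along derivatives of the map and loses an
  order of differentiability each time, too much for the sharp order. Here the map is only
  straightened along one of its own components, which is as smooth as the map. Morse's decomposition
  is applied once, to the first partial derivatives: with s = max (m - k) 0 they are of class C^s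
  and vanish at the bad points, hence are o(|x - y|^s), and one integration makes the map o(|x -
  y|^(s+1)). About N^m cubes of side 1/N then have images of total volume o(N^(m - (s+1)k)), and
  (s+1)k \<ge> s + k \<ge> m.

  On the probabilistic side nothing dominates J_p Y locally in p, so the continuity of its mean is
  the only handle. The points where the field might be critical form an uncountable family, so null
  events are collected over countably many compact pieces of charts. Borel sets of the function
  space meet a random vector through translations, for which a countable base of the vector factor
  suffices.\<close>

fun Ck :: "nat \<Rightarrow> ('b::euclidean_space \<Rightarrow> 'c::real_normed_vector) \<Rightarrow> 'b set \<Rightarrow> bool" where
  "Ck 0 f U \<longleftrightarrow> continuous_on U f"
| "Ck (Suc n) f U \<longleftrightarrow> (\<forall>x\<in>U. f differentiable at x) \<and>
     (\<forall>b\<in>Basis. Ck n (\<lambda>x. frechet_derivative f (at x) b) U)"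

lemma frechet_derivative_cong_open:
  assumes "open U" "x \<in> U" "\<And>y. y \<in> U \<Longrightarrow> f y = g y"
  shows "frechet_derivative f (at x) = frechet_derivative g (at x)"
proof -
  have "(f has_derivative f') (at x) \<longleftrightarrow> (g has_derivative f') (at x)" for f'
    using assms has_derivative_transform_within_open[of f f' x UNIV U g]
      has_derivative_transform_within_open[of g f' x UNIV U f] by auto
  then show ?thesis
    by (simp add: frechet_derivative_def)
qed

lemma Ck_cong:
  assumes "open U" "\<And>y. y \<in> U \<Longrightarrow> f y = g y"
  shows "Ck n f U \<longleftrightarrow> Ck n g U"
  using assms(2)
proof (induction n arbitrary: f g)
  case 0
  then show ?case using continuous_on_cong[of U U f g] by simp
next
  case (Suc n)
  have 1: "frechet_derivative f (at x) = frechet_derivative g (at x)" if "x \<in> U" for x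
    using frechet_derivative_cong_open[OF assms(1) that] Suc.prems by blast
  have "f differentiable at x \<longleftrightarrow> g differentiable at x" if "x \<in> U" for x
    using has_derivative_transform_within_open[of f _ x UNIV U g]
      has_derivative_transform_within_open[of g _ x UNIV U f] that Suc.prems assms(1)
    unfolding differentiable_def by metis
  moreover have "Ck n (\<lambda>x. frechet_derivative f (at x) b) U \<longleftrightarrow>
      Ck n (\<lambda>x. frechet_derivative g (at x) b) U" for b
    by (rule Suc.IH) (simp add: 1)
  ultimately show ?case by simp
qed

text \<open>Frees later proofs from the choice operator in \<open>frechet_derivative\<close>: any
  formula for the derivative may be used.\<close>

lemma Ck_SucI:
  assumes "open U" and "\<And>x. x \<in> U \<Longrightarrow> (f has_derivative f' x) (at x)"
    and "\<And>b. b \<in> Basis \<Longrightarrow> Ck n (\<lambda>x. f' x b) U"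
  shows "Ck (Suc n) f U"
proof -
  have *: "frechet_derivative f (at x) = f' x" if "x \<in> U" for x
    using frechet_derivative_at[OF assms(2)[OF that]] by simp
  have "Ck n (\<lambda>x. frechet_derivative f (at x) b) U" if "b \<in> Basis" for b
    by (subst Ck_cong[OF assms(1), where g = "\<lambda>x. f' x b"]) (simp_all add: * assms(3) that)
  moreover have "f differentiable at x" if "x \<in> U" for x
    using assms(2)[OF that] unfolding differentiable_def by blast
  ultimately show ?thesis by simp
qed

lemma Ck_Suc_has_derivative:
  "Ck (Suc n) f U \<Longrightarrow> x \<in> U \<Longrightarrow> (f has_derivative frechet_derivative f (at x)) (at x)"
  by (simp add: frechet_derivative_works[symmetric])

lemma Ck_subset: "Ck n f U \<Longrightarrow> V \<subseteq> U \<Longrightarrow> Ck n f V"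
  by (induction n arbitrary: f) (auto intro: continuous_on_subset)

lemma Ck_continuous_on: "Ck n f U \<Longrightarrow> continuous_on U f"
  by (cases n) (auto intro!: continuous_at_imp_continuous_on differentiable_imp_continuous_within)

lemma Ck_Suc_imp_Ck: "Ck (Suc n) f U \<Longrightarrow> Ck n f U"
  by (induction n arbitrary: f) (auto intro: Ck_continuous_on[of "Suc 0"])

lemma Ck_mono: "Ck n f U \<Longrightarrow> m \<le> n \<Longrightarrow> Ck m f U"
  by (induction n) (use Ck_Suc_imp_Ck le_Suc_eq in blast)+

lemma Ck_const: "open U \<Longrightarrow> Ck n (\<lambda>x. c) U"
  by (induction n arbitrary: c) (auto intro!: Ck_SucI[where f' = "\<lambda>x h. 0"] simp del: Ck.simps(2))

lemma Ck_linear: "open U \<Longrightarrow> bounded_linear f \<Longrightarrow> Ck n f U"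
  by (cases n) (auto intro!: Ck_SucI[where f' = "\<lambda>x. f"] Ck_const bounded_linear_imp_has_derivative
      linear_continuous_on simp del: Ck.simps(2))

lemma Ck_linear_comp:
  assumes "open U" "bounded_linear l" "Ck n f U"
  shows "Ck n (\<lambda>x. l (f x)) U"
  using assms(3)
proof (induction n arbitrary: f)
  case 0
  then show ?case using assms(2) by (simp add: bounded_linear.continuous_on)
next
  case (Suc n)
  have "((\<lambda>x. l (f x)) has_derivative (\<lambda>h. l (frechet_derivative f (at x) h))) (at x)"
    if "x \<in> U" for x
    using bounded_linear.has_derivative[OF assms(2) Ck_Suc_has_derivative[OF Suc.prems that]] .
  moreover have "Ck n (\<lambda>x. l (frechet_derivative f (at x) b)) U" if "b \<in> Basis" for b
    using Suc that by simp
  ultimately show ?case by (rule Ck_SucI[OF assms(1)])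
qed

lemma Ck_add: "open U \<Longrightarrow> Ck n f U \<Longrightarrow> Ck n g U \<Longrightarrow> Ck n (\<lambda>x. f x + g x) U"
proof (induction n arbitrary: f g)
  case 0
  then show ?case by (simp add: continuous_on_add)
next
  case (Suc n)
  show ?case
    by (rule Ck_SucI[where
          f' = "\<lambda>x h. frechet_derivative f (at x) h + frechet_derivative g (at x) h"])
      (use Suc in \<open>auto intro!: has_derivative_add simp: frechet_derivative_works[symmetric]\<close>)
qed

lemma Ck_sum: "open U \<Longrightarrow> (\<And>i. i \<in> I \<Longrightarrow> Ck n (f i) U) \<Longrightarrow> Ck n (\<lambda>x. \<Sum>i\<in>I. f i x) U"
  by (induction I rule: infinite_finite_induct) (auto intro: Ck_const Ck_add)

lemma Ck_mult:
  fixes f g :: "'b::euclidean_space \<Rightarrow> real"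
  shows "open U \<Longrightarrow> Ck n f U \<Longrightarrow> Ck n g U \<Longrightarrow> Ck n (\<lambda>x. f x * g x) U"
proof (induction n arbitrary: f g)
  case 0
  then show ?case by (simp add: continuous_on_mult)
next
  case (Suc n)
  have *: "Ck n f U" "Ck n g U" using Suc.prems Ck_Suc_imp_Ck by blast+
  show ?case
    by (rule Ck_SucI[where
          f' = "\<lambda>x h. f x * frechet_derivative g (at x) h + frechet_derivative f (at x) h * g x"])
      (use Suc * in \<open>auto intro!: has_derivative_mult Ck_add simp: frechet_derivative_works[symmetric]\<close>)
qed

lemma Ck_inverse:
  fixes f :: "'b::euclidean_space \<Rightarrow> real"
  shows "open U \<Longrightarrow> Ck n f U \<Longrightarrow> (\<And>x. x \<in> U \<Longrightarrow> f x \<noteq> 0) \<Longrightarrow> Ck n (\<lambda>x. inverse (f x)) U"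
proof (induction n)
  case 0
  then show ?case by (simp add: continuous_on_inverse)
next
  case (Suc n)
  have *: "Ck n f U" using Suc.prems Ck_Suc_imp_Ck by blast
  have "Ck n (\<lambda>x. -1 * (inverse (f x) * frechet_derivative f (at x) b * inverse (f x))) U"
    if "b \<in> Basis" for b
    using Suc * that by (intro Ck_mult Ck_const) auto
  then show ?case
    by (intro Ck_SucI[where
          f' = "\<lambda>x h. - (inverse (f x) * frechet_derivative f (at x) h * inverse (f x))"])
      (use Suc in \<open>auto intro!: has_derivative_inverse simp: frechet_derivative_works[symmetric]\<close>)
qed

text \<open>The chain rule writes each partial derivative of the composite as a sum of products of
  partial derivatives of \<open>g\<close> after \<open>\<theta>\<close> with components of the
  derivative of \<open>\<theta>\<close>. Products are available for real values;
  \<open>Ck_componentwise\<close> lifts the result to vectors.\<close>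

lemma Ck_compose:
  fixes g :: "'d::euclidean_space \<Rightarrow> real" and \<theta> :: "'b::euclidean_space \<Rightarrow> 'd"
  assumes "open W" "open U" "\<theta> ` W \<subseteq> U"
    and "Ck n g U" and "Ck n \<theta> W"
  shows "Ck n (\<lambda>x. g (\<theta> x)) W"
  using assms(4,5)
proof (induction n arbitrary: g)
  case 0
  then show ?case using assms(3) by (auto intro: continuous_on_compose2)
next
  case (Suc n)
  let ?D = "\<lambda>x. frechet_derivative g (at x)" and ?T = "\<lambda>x. frechet_derivative \<theta> (at x)"
  have \<theta>: "Ck n \<theta> W" using Suc.prems Ck_Suc_imp_Ck by blast
  have lin: "linear (?D (\<theta> x))" if "x \<in> W" for x
    using Ck_Suc_has_derivative[OF Suc.prems(1)] that assms(3)
    by (auto intro: has_derivative_linear)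
  have "Ck n (\<lambda>x. \<Sum>b\<in>Basis. (?T x h \<bullet> b) * ?D (\<theta> x) b) W" if "h \<in> Basis" for h
  proof (intro Ck_sum Ck_mult assms(1))
    fix b :: 'd assume "b \<in> Basis"
    then show "Ck n (\<lambda>x. ?D (\<theta> x) b) W"
      using Suc.IH[of "\<lambda>x. ?D x b"] \<theta> Suc.prems by auto
    show "Ck n (\<lambda>x. ?T x h \<bullet> b) W"
      using Ck_linear_comp[OF assms(1) bounded_linear_inner_left, of n "\<lambda>x. ?T x h" b]
        Suc.prems that by auto
  qed
  moreover have "((\<lambda>x. g (\<theta> x)) has_derivative (\<lambda>h. \<Sum>b\<in>Basis. (?T x h \<bullet> b) * ?D (\<theta> x) b)) (at x)"
    if "x \<in> W" for x
  proof -
    have "((\<lambda>x. g (\<theta> x)) has_derivative (\<lambda>h. ?D (\<theta> x) (?T x h))) (at x)"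
      using Ck_Suc_has_derivative[OF Suc.prems(1)] Ck_Suc_has_derivative[OF Suc.prems(2)] that assms(3)
      by (intro has_derivative_compose[of \<theta> _ x UNIV g, simplified]) auto
    moreover have "?D (\<theta> x) (?T x h) = (\<Sum>b\<in>Basis. (?T x h \<bullet> b) * ?D (\<theta> x) b)" for h
    proof -
      have "?D (\<theta> x) (\<Sum>b\<in>Basis. (?T x h \<bullet> b) *\<^sub>R b) = (\<Sum>b\<in>Basis. (?T x h \<bullet> b) * ?D (\<theta> x) b)"
        using lin[OF that] by (simp only: linear_sum linear_scale real_scaleR_def)
      then show ?thesis by (simp add: euclidean_representation)
    qed
    ultimately show ?thesis by simp
  qed
  ultimately show ?case by (intro Ck_SucI assms(1))
qed

lemma Ck_componentwise:
  fixes f :: "'b::euclidean_space \<Rightarrow> real^'k"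
  assumes "open U" "\<And>i. Ck n (\<lambda>x. f x $ i) U"
  shows "Ck n f U"
proof -
  have "Ck n (\<lambda>x. \<Sum>i\<in>UNIV. f x $ i *\<^sub>R axis i (1::real)) U"
    using assms by (intro Ck_sum Ck_linear_comp[where l = "\<lambda>t. t *\<^sub>R _"] bounded_linear_scaleR_left) auto
  then show ?thesis
    by (simp add: basis_expansion scalar_mult_eq_scaleR[symmetric])
qed

text \<open>\<open>iter_deriv\<close> adds derivatives at the outside, \<open>Ck\<close> removes the
  one taken first; this identity reconciles them. The recursion of \<open>Ck\<close> is preferred
  because closure under products and composition becomes an induction on the order.\<close>

lemma iter_deriv_snoc:
  "iter_deriv (vs @ [v]) f = iter_deriv vs (\<lambda>x. frechet_derivative f (at x) v)"
  by (induction vs) auto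

lemma C_on_imp_Ck:
  assumes "C_on r f U" "enat n \<le> r"
  shows "Ck n f U"
  using assms
proof (induction n arbitrary: f r)
  case 0
  then show ?case using iter_deriv.simps(1)[of f]
    by (force simp: C_on_def zero_enat_def[symmetric] dest: spec[of _ "[]"])
next
  case (Suc n)
  have "enat (length []) < r"
    using Suc.prems(2) by (cases r) auto
  then have "f differentiable at x" if "x \<in> U" for x
    using Suc.prems(1) that unfolding C_on_def by (auto dest: spec[of _ "[]"])
  moreover have "C_on (enat n) (\<lambda>x. frechet_derivative f (at x) b) U" if "b \<in> Basis" for b
    unfolding C_on_def
  proof (intro allI impI conjI)
    fix vs :: "'a list" assume vs: "set vs \<subseteq> Basis"
    then have *: "set (vs @ [b]) \<subseteq> Basis" using that by simp
    { assume "enat (length vs) \<le> enat n"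
      then have "enat (length (vs @ [b])) \<le> r"
        using Suc.prems(2) by (simp add: order_trans[of _ "enat (Suc n)"])
      then show "continuous_on U (iter_deriv vs (\<lambda>x. frechet_derivative f (at x) b))"
        using Suc.prems(1) * unfolding C_on_def iter_deriv_snoc[symmetric] by blast }
    { assume "enat (length vs) < enat n"
      then have "enat (length (vs @ [b])) < r"
        using Suc.prems(2) by (simp add: less_le_trans[of _ "enat (Suc n)"])
      then show "\<forall>x\<in>U. iter_deriv vs (\<lambda>x. frechet_derivative f (at x) b) differentiable at x"
        using Suc.prems(1) * unfolding C_on_def iter_deriv_snoc[symmetric] by blast }
  qed
  ultimately show ?case using Suc.IH by auto
qed

section \<open>Straightening a hypersurface\<close>

text \<open>Coordinate subspaces and cylinders over them (\<open>cyl\<close> below) stand for spaces of lower dimension: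
  dimensions are types, so an induction on the dimension has to take place inside a fixed \<open>real^'m\<close>.\<close>

definition coord_space :: "'m::finite set \<Rightarrow> (real^'m) set" where
  "coord_space J = {x. \<forall>i. i \<notin> J \<longrightarrow> x $ i = 0}"

definition upd :: "real^'m \<Rightarrow> 'm::finite \<Rightarrow> real \<Rightarrow> real^'m" where
  "upd x j t = (\<chi> i. if i = j then t else x $ i)"

lemma upd_nth [simp]: "upd x j t $ i = (if i = j then t else x $ i)"
  by (simp add: upd_def)

lemma upd_eq_add: "upd x j t = x + (t - x $ j) *\<^sub>R axis j 1"
  by (simp add: vec_eq_iff axis_def)

lemma Basis_axis: "(b :: real^'m::finite) \<in> Basis \<longleftrightarrow> (\<exists>i. b = axis i 1)"
  by (auto simp: Basis_vec_def)

lemma linear_axis_sum: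
  fixes l :: "real^'m::finite \<Rightarrow> real"
  assumes "linear l"
  shows "l h = (\<Sum>i\<in>UNIV. h $ i * l (axis i 1))"
proof -
  have "l (\<Sum>i\<in>UNIV. h $ i *\<^sub>R axis i 1) = (\<Sum>i\<in>UNIV. h $ i * l (axis i 1))"
    using assms by (simp only: linear_sum linear_scale real_scaleR_def)
  then show ?thesis
    by (simp add: basis_expansion scalar_mult_eq_scaleR[symmetric])
qed

text \<open>Source of the uniform constant \<open>C\<close> in \<open>straighten\<close>.\<close>

lemma Ck_derivative_bounded:
  fixes f :: "'b::euclidean_space \<Rightarrow> 'c::real_normed_vector"
  assumes "Ck (Suc n) f U" "compact K" "K \<subseteq> U"
  obtains C where "\<And>x h. x \<in> K \<Longrightarrow> norm (frechet_derivative f (at x) h) \<le> C * norm h"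
proof -
  have "\<exists>c. \<forall>x\<in>K. norm (frechet_derivative f (at x) b) \<le> c" if "b \<in> Basis" for b
  proof -
    have "continuous_on K (\<lambda>x. frechet_derivative f (at x) b)"
      using assms that by (intro continuous_on_subset[OF Ck_continuous_on[of n]]) auto
    then have "bounded ((\<lambda>x. frechet_derivative f (at x) b) ` K)"
      using assms(2) compact_continuous_image compact_imp_bounded by blast
    then show ?thesis by (auto simp: bounded_iff)
  qed
  then obtain c where c: "\<And>b x. b \<in> Basis \<Longrightarrow> x \<in> K \<Longrightarrow> norm (frechet_derivative f (at x) b) \<le> c b"
    by metis
  have "norm (frechet_derivative f (at x) h) \<le> (\<Sum>b\<in>Basis. c b) * norm h" if "x \<in> K" for x h
  proof -
    have lin: "linear (frechet_derivative f (at x))"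
      using Ck_Suc_has_derivative[OF assms(1)] assms(3) that by (auto intro: has_derivative_linear)
    have "frechet_derivative f (at x) h = frechet_derivative f (at x) (\<Sum>b\<in>Basis. (h \<bullet> b) *\<^sub>R b)"
      by (simp add: euclidean_representation)
    also have "\<dots> = (\<Sum>b\<in>Basis. (h \<bullet> b) *\<^sub>R frechet_derivative f (at x) b)"
      using lin by (simp only: linear_sum linear_scale)
    finally have "norm (frechet_derivative f (at x) h) \<le> (\<Sum>b\<in>Basis. norm ((h \<bullet> b) *\<^sub>R frechet_derivative f (at x) b))"
      by (simp only: norm_sum)
    also have "\<dots> \<le> (\<Sum>b\<in>Basis. norm h * c b)"
      by (intro sum_mono) (auto intro!: mult_mono Basis_le_norm c that)
    finally show ?thesis by (simp add: sum_distrib_left[symmetric] mult.commute)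
  qed
  then show ?thesis using that by blast
qed

text \<open>Replacing the \<open>j\<close>-th coordinate by \<open>g\<close> is a map with
  invertible derivative wherever the \<open>j\<close>-th partial derivative of \<open>g\<close> is
  nonzero, and \<open>\<Theta>\<close> is its local inverse. The other coordinates are kept, so
  coordinate subspaces containing the \<open>j\<close>-th axis are respected.
  \<open>\<Theta>\<close> is as smooth as \<open>g\<close>, which prevents a loss of order.\<close>

lemma straighten:
  fixes g :: "real^'m::finite \<Rightarrow> real"
  assumes "open U" "Ck (Suc r) g U" "x0 \<in> U" "frechet_derivative g (at x0) (axis j 1) \<noteq> 0"
  obtains N W \<Theta> C where "open N" "x0 \<in> N" "N \<subseteq> U" "open W" "\<Theta> ` W \<subseteq> U" "Ck (Suc r) \<Theta> W"
    "\<And>z i. z \<in> W \<Longrightarrow> i \<noteq> j \<Longrightarrow> \<Theta> z $ i = z $ i" "\<And>z. z \<in> W \<Longrightarrow> g (\<Theta> z) = z $ j"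
    "\<And>x. x \<in> N \<Longrightarrow> upd x j (g x) \<in> W" "\<And>x. x \<in> N \<Longrightarrow> \<Theta> (upd x j (g x)) = x"
    "\<And>z h. z \<in> W \<Longrightarrow> norm (frechet_derivative \<Theta> (at z) h) \<le> C * norm h"
proof -
  let ?e = "axis j 1 :: real^'m"
  let ?D = "\<lambda>x. frechet_derivative g (at x)"
  let ?F = "\<lambda>x h. h + (?D x h - h $ j) *\<^sub>R ?e"
  let ?f = "\<lambda>x. upd x j (g x)"
  \<comment> \<open>The inverse of \<open>?F x\<close>: the \<open>j\<close>-th component of
    \<open>?F x h\<close> is \<open>?D x h\<close>, so comparing it with
    \<open>?D x (?F x h)\<close> gives back the multiple of \<open>?e\<close> that was
    added.\<close>
  let ?L = "\<lambda>x h. h - ((?D x h - h $ j) / ?D x ?e) *\<^sub>R ?e"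
  have D: "(g has_derivative ?D x) (at x)" if "x \<in> U" for x
    using Ck_Suc_has_derivative[OF assms(2) that] .
  have Dl: "bounded_linear (?D x)" if "x \<in> U" for x
    using D[OF that] by (rule has_derivative_bounded_linear)
  have bl: "bounded_linear (?F x)" if "x \<in> U" for x
    by (intro bounded_linear_add bounded_linear_ident bounded_linear_sub Dl[OF that]
        bounded_linear_vec_nth bounded_linear_compose[OF bounded_linear_scaleR_left])
  have bL: "bounded_linear (?L x)" if "x \<in> U" for x
    unfolding divide_inverse
    by (intro bounded_linear_sub bounded_linear_ident Dl[OF that] bounded_linear_vec_nth
        bounded_linear_compose[OF bounded_linear_scaleR_left]
        bounded_linear_compose[OF bounded_linear_mult_left])
  have LF: "?L x (?F x h) = h" if "x \<in> U" "?D x ?e \<noteq> 0" for x h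
  proof -
    have "?D x (?F x h) = ?D x h + (?D x h - h $ j) * ?D x ?e"
      using bounded_linear.linear[OF Dl[OF that(1)]]
      by (simp only: linear_add linear_scale real_scaleR_def)
    then show ?thesis using that(2) by (simp add: axis_def)
  qed
  have "(?f has_derivative ?F x) (at x)" if "x \<in> U" for x
    unfolding upd_eq_add
    by (intro has_derivative_add has_derivative_ident has_derivative_scaleR_left has_derivative_diff
        D[OF that] bounded_linear_imp_has_derivative bounded_linear_vec_nth)
  then have der: "(?f has_derivative blinfun_apply (Blinfun (?F x))) (at x)" if "x \<in> U" for x
    using that bl by (simp add: bounded_linear_Blinfun_apply)
  have "continuous_on U (\<lambda>x. ?D x b)" if "b \<in> Basis" for b
    using assms(2) that by (auto intro: Ck_continuous_on)
  then have "continuous_on U (\<lambda>x. blinfun_apply (Blinfun (?F x)) b)" if "b \<in> Basis" for b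
    using that bl by (subst continuous_on_cong[OF refl bounded_linear_Blinfun_apply[THEN fun_cong]])
      (auto intro!: continuous_intros)
  then have cont: "continuous_on U (\<lambda>x. Blinfun (?F x))"
    by (intro continuous_on_blinfun_componentwise)
  have inv: "Blinfun (?L x0) o\<^sub>L Blinfun (?F x0) = id_blinfun"
    by (rule blinfun_eqI)
      (use LF[OF assms(3,4)] bl[OF assms(3)] bL[OF assms(3)] in
        \<open>simp add: bounded_linear_Blinfun_apply\<close>)
  obtain U' V \<Theta> \<Theta>' where *: "open U'" "U' \<subseteq> U" "x0 \<in> U'" "open V" "?f x0 \<in> V" "homeomorphism U' V ?f \<Theta>"
    "\<And>y. y \<in> V \<Longrightarrow> (\<Theta> has_derivative (\<Theta>' y)) (at y)"
    "\<And>y. y \<in> V \<Longrightarrow> \<Theta>' y = Hilbert_Choice.inv (blinfun_apply (Blinfun (?F (\<Theta> y))))"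
    "\<And>y. y \<in> V \<Longrightarrow> bij (blinfun_apply (Blinfun (?F (\<Theta> y))))"
    using inverse_function_theorem[OF assms(1) der cont assms(3) inv] by blast
  have \<Theta>V: "\<Theta> z \<in> U'" "\<Theta> z \<in> U" "?f (\<Theta> z) = z" if "z \<in> V" for z
    using *(2,6) that by (auto simp: homeomorphism_def)
  \<comment> \<open>If this derivative vanished, \<open>?F (\<Theta> z)\<close> would send
    \<open>?e\<close> to \<open>0\<close>, against its bijectivity.\<close>
  have ne: "?D (\<Theta> z) ?e \<noteq> 0" if "z \<in> V" for z
  proof
    assume "?D (\<Theta> z) ?e = 0"
    then have "?F (\<Theta> z) ?e = ?F (\<Theta> z) 0"
      using linear_0[OF bounded_linear.linear[OF Dl[OF \<Theta>V(2)[OF that]]]] by (simp add: axis_def)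
    moreover have "inj (?F (\<Theta> z))"
      using *(9)[OF that] bl[OF \<Theta>V(2)[OF that]] by (simp add: bij_def bounded_linear_Blinfun_apply)
    ultimately have "?e = 0" by (rule injD[rotated])
    then show False by (simp add: axis_eq_0_iff)
  qed
  have \<Theta>': "\<Theta>' z = ?L (\<Theta> z)" if "z \<in> V" for z
  proof -
    have b: "bij (?F (\<Theta> z))" and i: "\<Theta>' z = Hilbert_Choice.inv (?F (\<Theta> z))"
      using *(8,9)[OF that] bl[OF \<Theta>V(2)[OF that]] by (simp_all add: bounded_linear_Blinfun_apply)
    have "\<Theta>' z h = ?L (\<Theta> z) h" for h
      using LF[OF \<Theta>V(2)[OF that] ne[OF that], of "\<Theta>' z h"]
        surj_f_inv_f[OF bij_is_surj[OF b], of h] unfolding i by (simp only:)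
    then show ?thesis by blast
  qed
  \<comment> \<open>Bootstrapping: the derivative of \<open>\<Theta>\<close> is an expression in the
    first partial derivatives of \<open>g\<close> at \<open>\<Theta> z\<close>, so order
    \<open>n\<close> of \<open>\<Theta>\<close> gives order \<open>Suc n\<close> until the order of
    \<open>g\<close> is used up.\<close>
  have Ck\<Theta>: "Ck n \<Theta> V" if "n \<le> Suc r" for n
    using that
  proof (induction n)
    case 0
    then show ?case using *(6) by (simp add: homeomorphism_def)
  next
    case (Suc n)
    have a: "Ck n (\<lambda>z. ?D (\<Theta> z) b) V" if "b \<in> Basis" for b
      using Suc assms(2) that \<Theta>V
      by (intro Ck_compose[OF *(4) assms(1), of \<Theta> n "\<lambda>x. ?D x b"]) (auto intro: Ck_mono)
    have "Ck n (\<lambda>z. b + (-1) *\<^sub>R (((?D (\<Theta> z) b + (- b $ j)) * inverse (?D (\<Theta> z) ?e)) *\<^sub>R ?e)) V"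
      if "b \<in> Basis" for b
      using a that ne
      by (intro Ck_add Ck_const *(4) Ck_linear_comp[OF *(4) bounded_linear_scaleR_right]
        Ck_linear_comp[OF *(4) bounded_linear_scaleR_left] Ck_mult Ck_inverse)
        (auto simp: Basis_axis)
    then show ?case
      by (intro Ck_SucI[OF *(4,7)]) (auto simp: \<Theta>' divide_inverse cong: Ck_cong[OF *(4)])
  qed
  \<comment> \<open>Shrinking to a ball whose closure stays in \<open>V\<close> makes the derivative
    of \<open>\<Theta>\<close> bounded.\<close>
  obtain e where e: "e > 0" "cball (?f x0) e \<subseteq> V"
    using *(4,5) open_contains_cball by blast
  obtain C where C: "\<And>z h. z \<in> cball (?f x0) e \<Longrightarrow> norm (frechet_derivative \<Theta> (at z) h) \<le> C * norm h"
    using Ck_derivative_bounded[OF Ck\<Theta>[OF order_refl] compact_cball e(2)] by blast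
  let ?W = "ball (?f x0) e"
  have W: "?W \<subseteq> V" "?W \<subseteq> cball (?f x0) e" using e by auto
  have "continuous_on U' ?f" using *(6) by (simp add: homeomorphism_def)
  then have oN: "open (U' \<inter> ?f -` ?W)"
    using *(1) by (simp add: continuous_on_open_vimage Int_commute)
  show thesis
  proof (rule that[of "U' \<inter> ?f -` ?W" ?W \<Theta> C])
    show "\<Theta> z $ i = z $ i" if "z \<in> ?W" "i \<noteq> j" for z i
      using arg_cong[OF \<Theta>V(3)[of z], of "\<lambda>v. v $ i"] that W by auto
    show "g (\<Theta> z) = z $ j" if "z \<in> ?W" for z
      using arg_cong[OF \<Theta>V(3)[of z], of "\<lambda>v. v $ j"] that W by auto
    show "Ck (Suc r) \<Theta> ?W" using Ck_subset[OF Ck\<Theta>[OF order_refl] W(1)] .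
    show "\<Theta> (?f x) = x" if "x \<in> U' \<inter> ?f -` ?W" for x
      using that *(6) by (auto simp: homeomorphism_def)
  qed (use * e W \<Theta>V C oN in auto)
qed

section \<open>Morse's decomposition\<close>

text \<open>A uniform little o. The second point ranges over a set \<open>B\<close> larger than
  \<open>E\<close>, because integration along a segment that starts in \<open>E\<close> passes
  through points outside \<open>E\<close>.\<close>

definition flat_on :: "nat \<Rightarrow> 'a::metric_space set \<Rightarrow> 'a set \<Rightarrow> ('a \<Rightarrow> 'a \<Rightarrow> real) \<Rightarrow> bool" where
  "flat_on r E B h \<longleftrightarrow>
     (\<forall>e>0. \<exists>d>0. \<forall>x\<in>E. \<forall>y\<in>B. dist x y < d \<longrightarrow> \<bar>h x y\<bar> \<le> e * dist x y ^ r)"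

text \<open>\<open>B\<close> is open in the whole of \<open>real^'m\<close> even when
  \<open>J\<close> is small, so that Frechet derivatives at its points make sense; the image carries
  the smaller dimension. Convexity and the bounded derivative feed the mean value
  inequality.\<close>

definition parametrization ::
  "'m::finite set \<Rightarrow> (real^'m) set \<Rightarrow> (real^'m) set \<Rightarrow> (real^'m \<Rightarrow> real^'m) \<Rightarrow> bool" where
  "parametrization J U B \<psi> \<longleftrightarrow> open B \<and> convex B \<and> bounded B \<and> \<psi> ` B \<subseteq> U \<inter> coord_space J \<and>
     (\<forall>y\<in>B. \<psi> differentiable at y) \<and>
     (\<exists>C. \<forall>y\<in>B. \<forall>v. norm (frechet_derivative \<psi> (at y) v) \<le> C * norm v)"

lemma derivative_coord_space:
  assumes "open B" "\<psi> ` B \<subseteq> coord_space J" "(\<psi> has_derivative \<psi>') (at y)" "y \<in> B"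
  shows "\<psi>' v \<in> coord_space J"
proof -
  have "\<psi>' v $ i = 0" if "i \<notin> J" for i
  proof -
    have "((\<lambda>y. \<psi> y $ i) has_derivative (\<lambda>v. \<psi>' v $ i)) (at y)"
      by (intro bounded_linear.has_derivative[OF bounded_linear_vec_nth] assms)
    moreover have "((\<lambda>y. \<psi> y $ i) has_derivative (\<lambda>v. 0)) (at y)"
      using assms(2) that
      by (intro has_derivative_transform_within_open[OF has_derivative_const assms(1,4)])
        (auto simp: coord_space_def image_subset_iff)
    ultimately show ?thesis
      using has_derivative_unique by metis
  qed
  then show ?thesis by (simp add: coord_space_def)
qed

text \<open>Mean value inequality for \<open>g\<close> after \<open>\<psi>\<close>. The derivative
  of \<open>\<psi>\<close> takes values in \<open>coord_space J\<close>, so only the partial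
  derivatives of \<open>g\<close> in the directions of \<open>J\<close> have to be small.\<close>

lemma flat_on_integrate:
  fixes g :: "real^'m::finite \<Rightarrow> real"
  assumes \<psi>: "parametrization J U B \<psi>" and "E \<subseteq> B"
    and g: "\<And>x. x \<in> U \<Longrightarrow> g differentiable at x"
    and flat: "\<And>j. j \<in> J \<Longrightarrow>
      flat_on s E B (\<lambda>x y. frechet_derivative g (at (\<psi> y)) (axis j 1))"
  shows "flat_on (Suc s) E B (\<lambda>x y. g (\<psi> y) - g (\<psi> x))"
  unfolding flat_on_def
proof (intro allI impI)
  fix e :: real assume "e > 0"
  obtain C where C: "\<And>y v. y \<in> B \<Longrightarrow> norm (frechet_derivative \<psi> (at y) v) \<le> C * norm v"
    using \<psi> unfolding parametrization_def by blast
  let ?D = "\<lambda>x. frechet_derivative g (at x)" and ?T = "\<lambda>y. frechet_derivative \<psi> (at y)"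
  define C' where "C' = \<bar>C\<bar> + 1"
  have C': "C' > 0" "\<And>y v. y \<in> B \<Longrightarrow> norm (?T y v) \<le> C' * norm v"
    using order_trans[OF C mult_right_mono[of C C']] unfolding C'_def by auto
  \<comment> \<open>Chosen so that \<open>card J\<close> terms, each of size \<open>C' * e'\<close>,
    add up to at most \<open>e\<close>; the \<open>+ 1\<close> keeps the denominator positive when
    \<open>J\<close> is empty.\<close>
  define e' where "e' = e / ((real (card J) + 1) * C')"
  have e': "e' > 0" using \<open>e > 0\<close> C' by (simp add: e'_def)
  have "\<exists>d>0. \<forall>x\<in>E. \<forall>y\<in>B. dist x y < d \<longrightarrow> \<bar>?D (\<psi> y) (axis j 1)\<bar> \<le> e' * dist x y ^ s"
    if "j \<in> J" for j
    using flat[OF that] e' unfolding flat_on_def by blast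
  then obtain d where d: "\<And>j. j \<in> J \<Longrightarrow> d j > 0"
    "\<And>j x y. j \<in> J \<Longrightarrow> x \<in> E \<Longrightarrow> y \<in> B \<Longrightarrow> dist x y < d j \<Longrightarrow>
      \<bar>?D (\<psi> y) (axis j 1)\<bar> \<le> e' * dist x y ^ s"
    by metis
  define \<delta> where "\<delta> = Min (insert 1 (d ` J))"
  have \<delta>: "\<delta> > 0" "\<And>j. j \<in> J \<Longrightarrow> \<delta> \<le> d j" using d(1) by (auto simp: \<delta>_def)
  show "\<exists>d>0. \<forall>x\<in>E. \<forall>y\<in>B. dist x y < d \<longrightarrow> \<bar>g (\<psi> y) - g (\<psi> x)\<bar> \<le> e * dist x y ^ Suc s"
  proof (intro exI[of _ \<delta>] conjI ballI impI \<delta>(1))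
    fix x y assume xy: "x \<in> E" "y \<in> B" "dist x y < \<delta>"
    \<comment> \<open>Contains the segment from \<open>x\<close> to \<open>y\<close>, and its points
      are within \<open>dist x y\<close> of \<open>x\<close>, so the flatness estimate gives the
      single bound \<open>dist x y ^ s\<close> on all of it.\<close>
    let ?S = "B \<inter> cball x (dist x y)"
    have "convex ?S" using \<psi> by (auto simp: parametrization_def intro: convex_Int)
    moreover have "((\<lambda>w. g (\<psi> w)) has_derivative (\<lambda>v. ?D (\<psi> w) (?T w v))) (at w within ?S)"
      and "onorm (\<lambda>v. ?D (\<psi> w) (?T w v)) \<le> e * dist x y ^ s" if "w \<in> ?S" for w
    proof -
      have w: "w \<in> B" "dist x w \<le> dist x y" "\<psi> w \<in> U" using that \<psi> by (auto simp: parametrization_def)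
      have T: "(\<psi> has_derivative ?T w) (at w)"
        using \<psi> w by (auto simp: parametrization_def frechet_derivative_works[symmetric])
      have D: "(g has_derivative ?D (\<psi> w)) (at (\<psi> w))"
        using g[OF w(3)] by (simp add: frechet_derivative_works[symmetric])
      show "((\<lambda>w. g (\<psi> w)) has_derivative (\<lambda>v. ?D (\<psi> w) (?T w v))) (at w within ?S)"
        using has_derivative_compose[OF T D] by (rule has_derivative_at_withinI)
      have V: "?T w v \<in> coord_space J" for v
        using \<psi> w by (intro derivative_coord_space[OF _ _ T]) (auto simp: parametrization_def)
      have "norm (?D (\<psi> w) (?T w v)) \<le> e * dist x y ^ s * norm v" for v
      proof -
        have "?D (\<psi> w) (?T w v) = (\<Sum>i\<in>UNIV. ?T w v $ i * ?D (\<psi> w) (axis i 1))"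
          using D by (intro linear_axis_sum) (rule has_derivative_linear)
        also have "\<dots> = (\<Sum>i\<in>J. ?T w v $ i * ?D (\<psi> w) (axis i 1))"
          using V by (intro sum.mono_neutral_right) (auto simp: coord_space_def)
        finally have "norm (?D (\<psi> w) (?T w v)) \<le> (\<Sum>i\<in>J. \<bar>?T w v $ i\<bar> * \<bar>?D (\<psi> w) (axis i 1)\<bar>)"
          by (simp only: real_norm_def abs_mult[symmetric] sum_abs)
        also have "\<dots> \<le> (\<Sum>i\<in>J. (C' * norm v) * (e' * dist x y ^ s))"
        proof (intro sum_mono mult_mono)
          fix i assume i: "i \<in> J"
          show "\<bar>?T w v $ i\<bar> \<le> C' * norm v"
            using C'(2)[OF w(1), of v] component_le_norm_cart[of "?T w v" i] by linarith
          have "\<bar>?D (\<psi> w) (axis i 1)\<bar> \<le> e' * dist x w ^ s"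
            using d(2)[OF i xy(1) w(1)] w(2) xy(3) \<delta>(2)[OF i] by linarith
          also have "\<dots> \<le> e' * dist x y ^ s"
            using e' w(2) by (intro mult_left_mono power_mono) auto
          finally show "\<bar>?D (\<psi> w) (axis i 1)\<bar> \<le> e' * dist x y ^ s" .
        qed (use C' e' in auto)
        also have "\<dots> = (real (card J) * C' * e') * (dist x y ^ s * norm v)" by simp
        also have "\<dots> \<le> e * (dist x y ^ s * norm v)"
        proof (intro mult_right_mono)
          have "real (card J) * C' * e' \<le> (real (card J) + 1) * C' * e'"
            using C' e' by (intro mult_right_mono) auto
          also have "\<dots> = e"
          proof -
            have "(real (card J) + 1) * C' \<noteq> 0" using C'(1) by simp
            then show ?thesis unfolding e'_def by simp
          qed
          finally show "real (card J) * C' * e' \<le> e" .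
        qed auto
        finally show ?thesis by (simp add: mult.assoc)
      qed
      then show "onorm (\<lambda>v. ?D (\<psi> w) (?T w v)) \<le> e * dist x y ^ s"
        by (intro onorm_le)
    qed
    ultimately have "norm (g (\<psi> y) - g (\<psi> x)) \<le> e * dist x y ^ s * norm (y - x)"
      using xy \<open>E \<subseteq> B\<close> by (intro differentiable_bound[of ?S]) auto
    then show "\<bar>g (\<psi> y) - g (\<psi> x)\<bar> \<le> e * dist x y ^ Suc s"
      by (simp add: dist_norm norm_minus_commute mult.commute mult.left_commute)
  qed
qed

text \<open>\<open>B\<close> and \<open>\<psi>\<close> are fixed before \<open>g\<close>: one
  decomposition serves all functions vanishing on \<open>A\<close>. The parameter set
  \<open>E\<close> itself lies in \<open>coord_space J\<close>, which later bounds the number of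
  cubes needed to cover it.\<close>

definition morse_piece ::
  "'m::finite set \<Rightarrow> (real^'m) set \<Rightarrow> nat \<Rightarrow> (real^'m) set \<Rightarrow> (real^'m) set \<Rightarrow> (real^'m \<Rightarrow> real^'m) \<Rightarrow> bool"
  where
  "morse_piece J U r A E \<psi> \<longleftrightarrow> E \<subseteq> coord_space J \<and> \<psi> ` E \<subseteq> A \<and>
     (\<exists>B. E \<subseteq> B \<and> parametrization J U B \<psi> \<and>
       (\<forall>g. Ck r g U \<and> (\<forall>x\<in>A. g x = 0) \<longrightarrow> flat_on r E B (\<lambda>x y. g (\<psi> y))))"

definition morse_decomposable ::
  "'m::finite set \<Rightarrow> (real^'m) set \<Rightarrow> nat \<Rightarrow> (real^'m) set \<Rightarrow> (real^'m) set \<Rightarrow> bool" where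
  "morse_decomposable J U r A S \<longleftrightarrow> (\<exists>\<P>. countable \<P> \<and>
     (\<forall>(E, \<psi>)\<in>\<P>. morse_piece J U r A E \<psi>) \<and> S \<subseteq> (\<Union>(E, \<psi>)\<in>\<P>. \<psi> ` E))"

lemma morse_decomposable_Union:
  assumes "countable \<S>" "\<And>S. S \<in> \<S> \<Longrightarrow> morse_decomposable J U r A S"
  shows "morse_decomposable J U r A (\<Union>\<S>)"
proof -
  obtain \<P> where \<P>: "\<And>S. S \<in> \<S> \<Longrightarrow> countable (\<P> S) \<and>
     (\<forall>(E, \<psi>)\<in>\<P> S. morse_piece J U r A E \<psi>) \<and> S \<subseteq> (\<Union>(E, \<psi>)\<in>\<P> S. \<psi> ` E)"
    using assms(2) unfolding morse_decomposable_def by metis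
  have "\<Union>\<S> \<subseteq> (\<Union>(E, \<psi>)\<in>(\<Union>S\<in>\<S>. \<P> S). \<psi> ` E)"
  proof
    fix x assume "x \<in> \<Union>\<S>"
    then obtain S where S: "S \<in> \<S>" "x \<in> S" by blast
    with \<P>[OF S(1)] obtain p where "p \<in> \<P> S" "x \<in> (case p of (E, \<psi>) \<Rightarrow> \<psi> ` E)" by blast
    with S show "x \<in> (\<Union>(E, \<psi>)\<in>(\<Union>S\<in>\<S>. \<P> S). \<psi> ` E)" by blast
  qed
  moreover have "countable (\<Union>S\<in>\<S>. \<P> S)" using \<P> assms(1) by auto
  moreover have "\<forall>p\<in>(\<Union>S\<in>\<S>. \<P> S). case p of (E, \<psi>) \<Rightarrow> morse_piece J U r A E \<psi>"
    using \<P> by fast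
  ultimately show ?thesis unfolding morse_decomposable_def by blast
qed

text \<open>Lindelof's property makes the decompositions and the null sets below a local
  matter.\<close>

lemma countable_local_cover:
  fixes S :: "'a::second_countable_topology set"
  assumes "\<And>x. x \<in> S \<Longrightarrow> \<exists>N. open N \<and> x \<in> N \<and> P (S \<inter> N)"
  obtains \<S> where "countable \<S>" "\<And>T. T \<in> \<S> \<Longrightarrow> P T" "S = \<Union>\<S>"
proof -
  let ?F = "{N. open N \<and> P (S \<inter> N)}"
  obtain F' where F': "F' \<subseteq> ?F" "countable F'" "\<Union>F' = \<Union>?F"
    using Lindelof[of ?F] by auto
  show ?thesis
  proof (rule that[of "(\<inter>) S ` F'"])
    show "S = \<Union>((\<inter>) S ` F')"
    proof -
      have "S \<subseteq> \<Union>?F" using assms by fast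
      then show ?thesis using F'(3) by auto
    qed
  qed (use F' in auto)
qed

lemma morse_decomposable_local:
  assumes "\<And>x. x \<in> S \<Longrightarrow> \<exists>N. open N \<and> x \<in> N \<and> morse_decomposable J U r A (S \<inter> N)"
  shows "morse_decomposable J U r A S"
proof -
  obtain \<S> where "countable \<S>" "\<And>T. T \<in> \<S> \<Longrightarrow> morse_decomposable J U r A T" "S = \<Union>\<S>"
    using countable_local_cover[of S "morse_decomposable J U r A"] assms by metis
  then show ?thesis using morse_decomposable_Union by metis
qed

lemma morse_decomposable_subset:
  "morse_decomposable J U r A T \<Longrightarrow> S \<subseteq> T \<Longrightarrow> morse_decomposable J U r A S"
  unfolding morse_decomposable_def by (meson subset_trans)

text \<open>Flatness of order \<open>0\<close> only says that \<open>g\<close> is uniformly small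
  near its zeros in \<open>A\<close>, so uniform continuity on a compact ball suffices.\<close>

lemma morse_decomposable_0:
  fixes A :: "(real^'m::finite) set"
  assumes "open U" "A \<subseteq> U \<inter> coord_space J"
  shows "morse_decomposable J U 0 A A"
proof (rule morse_decomposable_local)
  fix a assume "a \<in> A"
  \<comment> \<open>An open set of the full space has to be mapped into
    \<open>coord_space J\<close>. The orthogonal projection does this, fixes \<open>A\<close> and
    does not increase distances to points of \<open>A\<close>.\<close>
  define \<pi> :: "real^'m \<Rightarrow> real^'m" where "\<pi> = (\<lambda>x. \<chi> i. if i \<in> J then x $ i else 0)"
  have lin: "linear \<pi>" by (rule linearI) (auto simp: \<pi>_def vec_eq_iff)
  then have bl: "bounded_linear \<pi>" by (simp add: linear_conv_bounded_linear)
  have n: "norm (\<pi> x) \<le> norm x" for x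
    by (rule norm_le_componentwise_cart) (auto simp: \<pi>_def)
  have \<pi>A: "\<pi> x = x" if "x \<in> A" for x
    using that assms(2) by (auto simp: \<pi>_def vec_eq_iff coord_space_def)
  have d: "dist x (\<pi> y) \<le> dist x y" if "x \<in> A" for x y
    using n[of "x - y"] \<pi>A[OF that] by (simp add: dist_norm linear_diff[OF lin])
  obtain e where e: "e > 0" "cball a e \<subseteq> U"
    using \<open>a \<in> A\<close> assms open_contains_cball by blast
  let ?E = "A \<inter> ball a e"
  have "flat_on 0 ?E (ball a e) (\<lambda>x y. g (\<pi> y))" if g: "Ck 0 g U" "\<forall>x\<in>A. g x = 0" for g
    unfolding flat_on_def
  proof (intro allI impI)
    fix \<epsilon> :: real assume "\<epsilon> > 0"
    have "uniformly_continuous_on (cball a e) g"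
      using g(1) e(2) by (auto intro: compact_uniformly_continuous continuous_on_subset)
    then obtain \<delta> where \<delta>: "\<delta> > 0"
      "\<And>x y. x \<in> cball a e \<Longrightarrow> y \<in> cball a e \<Longrightarrow> dist y x < \<delta> \<Longrightarrow> dist (g y) (g x) < \<epsilon>"
      using \<open>\<epsilon> > 0\<close> unfolding uniformly_continuous_on_def by meson
    show "\<exists>\<delta>>0. \<forall>x\<in>?E. \<forall>y\<in>ball a e. dist x y < \<delta> \<longrightarrow> \<bar>g (\<pi> y)\<bar> \<le> \<epsilon> * dist x y ^ 0"
    proof (intro exI[of _ \<delta>] conjI ballI impI \<delta>(1))
      fix x y assume xy: "x \<in> ?E" "y \<in> ball a e" "dist x y < \<delta>"
      then have "dist (g (\<pi> y)) (g x) < \<epsilon>"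
        using d[of x y] d[OF \<open>a \<in> A\<close>, of y] by (intro \<delta>(2)) (auto simp: dist_commute)
      then show "\<bar>g (\<pi> y)\<bar> \<le> \<epsilon> * dist x y ^ 0" using xy g(2) by (simp add: dist_real_def)
    qed
  qed
  moreover have "parametrization J U (ball a e) \<pi>"
    unfolding parametrization_def
  proof (intro conjI ballI)
    show "\<pi> ` ball a e \<subseteq> U \<inter> coord_space J"
    proof (intro image_subsetI IntI)
      fix x assume "x \<in> ball a e"
      then have "\<pi> x \<in> cball a e" using d[OF \<open>a \<in> A\<close>, of x] by simp
      then show "\<pi> x \<in> U" using e by blast
      show "\<pi> x \<in> coord_space J" by (simp add: coord_space_def \<pi>_def)
    qed
    have D: "(\<pi> has_derivative \<pi>) (at y)" for y
      using bl by (rule bounded_linear_imp_has_derivative)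
    then show "\<pi> differentiable at y" for y unfolding differentiable_def by blast
    have "frechet_derivative \<pi> (at y) = \<pi>" for y
      using frechet_derivative_at[OF D] by simp
    then show "\<exists>C. \<forall>y\<in>ball a e. \<forall>v. norm (frechet_derivative \<pi> (at y) v) \<le> C * norm v"
      using n by (intro exI[of _ 1]) simp
  qed auto
  ultimately have "morse_piece J U 0 A ?E \<pi>"
    using assms(2) \<pi>A unfolding morse_piece_def
    by (intro conjI exI[of _ "ball a e"]) auto
  then have "morse_decomposable J U 0 A ?E"
    unfolding morse_decomposable_def using \<pi>A by (intro exI[of _ "{(?E, \<pi>)}"]) force
  then show "\<exists>N. open N \<and> a \<in> N \<and> morse_decomposable J U 0 A (A \<inter> N)"
    using e(1) by (intro exI[of _ "ball a e"]) simp
qed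

text \<open>Where the derivatives of all functions vanishing on \<open>A\<close> vanish too, the derivatives are flat of
  order \<open>r\<close> and can be integrated along segments.\<close>

lemma morse_piece_Suc:
  assumes "morse_piece J U r A' E \<psi>" "A' \<subseteq> A"
    and A': "\<And>(g :: real^'m::finite \<Rightarrow> real) j x. Ck (Suc r) g U \<Longrightarrow> (\<forall>x\<in>A. g x = 0) \<Longrightarrow> j \<in> J \<Longrightarrow> x \<in> A' \<Longrightarrow>
      frechet_derivative g (at x) (axis j 1) = 0"
  shows "morse_piece J U (Suc r) A E \<psi>"
proof -
  obtain B where B: "E \<subseteq> B" "parametrization J U B \<psi>" and E: "E \<subseteq> coord_space J" "\<psi> ` E \<subseteq> A'"
    and flat: "\<And>g. Ck r g U \<Longrightarrow> (\<forall>x\<in>A'. g x = 0) \<Longrightarrow> flat_on r E B (\<lambda>x y. g (\<psi> y))"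
    using assms(1) unfolding morse_piece_def by blast
  have "flat_on (Suc r) E B (\<lambda>x y. g (\<psi> y))" if g: "Ck (Suc r) g U" "\<forall>x\<in>A. g x = 0" for g
  proof -
    have "flat_on r E B (\<lambda>x y. frechet_derivative g (at (\<psi> y)) (axis j 1))" if "j \<in> J" for j
      using g(1) A'[OF g that] by (intro flat) (auto simp: axis_in_Basis_iff)
    then have "flat_on (Suc r) E B (\<lambda>x y. g (\<psi> y) - g (\<psi> x))"
      using g(1) by (intro flat_on_integrate[OF B(2,1)]) auto
    moreover have "g (\<psi> x) = 0" if "x \<in> E" for x
      using that E assms(2) g(2) by blast
    ultimately show ?thesis unfolding flat_on_def by simp
  qed
  then show ?thesis
    unfolding morse_piece_def using B E assms(2) by (intro conjI exI[of _ B]) auto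
qed

text \<open>Elsewhere \<open>A\<close> lies locally in a hypersurface \<open>g = 0\<close>, so that the dimension drops.\<close>

lemma morse_decomposable_hypersurface:
  fixes A :: "(real^'m::finite) set" and g :: "real^'m \<Rightarrow> real"
  assumes "open U" "A \<subseteq> U \<inter> coord_space J" "x0 \<in> A" "j \<in> J"
    and g: "Ck (Suc r) g U" "\<forall>x\<in>A. g x = 0" "frechet_derivative g (at x0) (axis j 1) \<noteq> 0"
    and IH: "\<And>W A. open W \<Longrightarrow> A \<subseteq> W \<inter> coord_space (J - {j}) \<Longrightarrow>
      morse_decomposable (J - {j}) W (Suc r) A A"
  shows "\<exists>N. open N \<and> x0 \<in> N \<and> morse_decomposable J U (Suc r) A (A \<inter> N)"
proof -
  obtain N W \<Theta> C where N: "open N" "x0 \<in> N" "N \<subseteq> U" and W: "open W"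
    and \<Theta>: "\<Theta> ` W \<subseteq> U" "Ck (Suc r) \<Theta> W"
      "\<And>z i. z \<in> W \<Longrightarrow> i \<noteq> j \<Longrightarrow> \<Theta> z $ i = z $ i" "\<And>z. z \<in> W \<Longrightarrow> g (\<Theta> z) = z $ j"
      "\<And>x. x \<in> N \<Longrightarrow> upd x j (g x) \<in> W" "\<And>x. x \<in> N \<Longrightarrow> \<Theta> (upd x j (g x)) = x"
    and C: "\<And>z h. z \<in> W \<Longrightarrow> norm (frechet_derivative \<Theta> (at z) h) \<le> C * norm h"
  proof -
    have "x0 \<in> U" using assms(2,3) by blast
    from straighten[OF assms(1) g(1) this g(3)] that show thesis by blast
  qed
  \<comment> \<open>Since \<open>g\<close> vanishes on \<open>A\<close>, the straightened set has
    \<open>j\<close>-th coordinate \<open>0\<close>: this is the drop in dimension.\<close>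
  define A1 where "A1 = (\<lambda>x. upd x j (g x)) ` (A \<inter> N)"
  have A1: "A1 \<subseteq> W \<inter> coord_space (J - {j})"
    using assms(2) \<Theta>(5) g(2) by (force simp: A1_def coord_space_def)
  have \<Theta>A1: "\<Theta> ` A1 = A \<inter> N" using \<Theta>(6) by (force simp: A1_def image_image)
  have \<Theta>V: "\<Theta> z \<in> coord_space J" if "z \<in> W" "z \<in> coord_space (J - {j})" for z
    using that \<Theta>(3) assms(4) by (auto simp: coord_space_def) metis
  obtain \<P> where \<P>: "countable \<P>" "\<And>E \<psi>. (E, \<psi>) \<in> \<P> \<Longrightarrow> morse_piece (J - {j}) W (Suc r) A1 E \<psi>"
    "A1 \<subseteq> (\<Union>(E, \<psi>)\<in>\<P>. \<psi> ` E)"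
    using IH[OF W A1] unfolding morse_decomposable_def by blast
  have "morse_piece J U (Suc r) A E (\<Theta> \<circ> \<psi>)" if piece: "(E, \<psi>) \<in> \<P>" for E \<psi>
  proof -
    obtain B where B: "E \<subseteq> B" "parametrization (J - {j}) W B \<psi>"
      and E: "E \<subseteq> coord_space (J - {j})" "\<psi> ` E \<subseteq> A1"
      and flat: "\<And>g. Ck (Suc r) g W \<Longrightarrow> (\<forall>x\<in>A1. g x = 0) \<Longrightarrow> flat_on (Suc r) E B (\<lambda>x y. g (\<psi> y))"
      using \<P>(2)[OF piece] unfolding morse_piece_def by blast
    obtain C' where C': "\<And>y v. y \<in> B \<Longrightarrow> norm (frechet_derivative \<psi> (at y) v) \<le> C' * norm v"
      using B(2) unfolding parametrization_def by blast
    have \<psi>: "\<psi> y \<in> W" "\<psi> y \<in> coord_space (J - {j})" "\<psi> differentiable at y" if "y \<in> B" for y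
      using B(2) that by (auto simp: parametrization_def)
    have D: "(\<Theta> \<circ> \<psi> has_derivative (\<lambda>v. frechet_derivative \<Theta> (at (\<psi> y)) (frechet_derivative \<psi> (at y) v))) (at y)"
      if "y \<in> B" for y
      using has_derivative_compose[OF \<psi>(3)[OF that, unfolded frechet_derivative_works]
          Ck_Suc_has_derivative[OF \<Theta>(2) \<psi>(1)[OF that]]] by (simp add: o_def)
    have "parametrization J U B (\<Theta> \<circ> \<psi>)"
      unfolding parametrization_def
    proof (intro conjI ballI)
      show "(\<Theta> \<circ> \<psi>) ` B \<subseteq> U \<inter> coord_space J"
        using \<psi> \<Theta>(1) \<Theta>V by auto
      show "\<Theta> \<circ> \<psi> differentiable at y" if "y \<in> B" for y
        using D[OF that] unfolding differentiable_def by blast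
      have "norm (frechet_derivative (\<Theta> \<circ> \<psi>) (at y) v) \<le> \<bar>C\<bar> * C' * norm v" if "y \<in> B" for y v
      proof -
        have "norm (frechet_derivative (\<Theta> \<circ> \<psi>) (at y) v) \<le> C * norm (frechet_derivative \<psi> (at y) v)"
          unfolding frechet_derivative_at[OF D[OF that], symmetric]
          using C[OF \<psi>(1)[OF that]] .
        also have "\<dots> \<le> \<bar>C\<bar> * (C' * norm v)"
          using C'[OF that, of v] by (intro mult_mono) auto
        finally show ?thesis by (simp add: mult.assoc)
      qed
      then show "\<exists>C. \<forall>y\<in>B. \<forall>v. norm (frechet_derivative (\<Theta> \<circ> \<psi>) (at y) v) \<le> C * norm v" by blast
    qed (use B(2) in \<open>auto simp: parametrization_def\<close>)
    \<comment> \<open>\<open>h\<close> after \<open>\<Theta>\<close> is again of class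
      \<open>Suc r\<close> and vanishes on \<open>A1\<close>, so flatness is inherited from the
      piece of lower dimension.\<close>
    moreover have "flat_on (Suc r) E B (\<lambda>x y. h ((\<Theta> \<circ> \<psi>) y))"
      if h: "Ck (Suc r) h U" "\<forall>x\<in>A. h x = 0" for h
    proof -
      have "\<forall>x\<in>A1. h (\<Theta> x) = 0" using \<Theta>A1 h(2) by blast
      then show ?thesis
        using flat[OF Ck_compose[OF W assms(1) \<Theta>(1) h(1) \<Theta>(2)]] by simp
    qed
    moreover have "E \<subseteq> coord_space J" using E(1) by (auto simp: coord_space_def)
    moreover have "(\<Theta> \<circ> \<psi>) ` E \<subseteq> A" using E(2) \<Theta>A1 by (auto simp: image_subset_iff)
    ultimately show ?thesis unfolding morse_piece_def using B(1) by blast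
  qed
  moreover have "A \<inter> N \<subseteq> (\<Union>(E, \<psi>)\<in>(\<lambda>(E, \<psi>). (E, \<Theta> \<circ> \<psi>)) ` \<P>. \<psi> ` E)"
  proof
    fix x assume "x \<in> A \<inter> N"
    then obtain z where z: "z \<in> A1" "x = \<Theta> z" using \<Theta>A1 by blast
    then obtain E \<psi> where "(E, \<psi>) \<in> \<P>" "z \<in> \<psi> ` E" using \<P>(3) by blast
    then show "x \<in> (\<Union>(E, \<psi>)\<in>(\<lambda>(E, \<psi>). (E, \<Theta> \<circ> \<psi>)) ` \<P>. \<psi> ` E)"
      using z(2) by (intro UN_I[of "(E, \<Theta> \<circ> \<psi>)"]) force+
  qed
  ultimately have "morse_decomposable J U (Suc r) A (A \<inter> N)"
    unfolding morse_decomposable_def using \<P>(1)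
    by (intro exI[of _ "(\<lambda>(E, \<psi>). (E, \<Theta> \<circ> \<psi>)) ` \<P>"]) auto
  then show ?thesis using N by blast
qed

text \<open>Two nested inductions. Near a point where some function vanishing on \<open>A\<close>
  has a nonzero derivative along \<open>J\<close>, the dimension drops and the order is kept. At the
  remaining points these derivatives vanish too, so the order drops with the dimension kept, and
  integration regains it.\<close>

theorem morse_decomposition:
  fixes A :: "(real^'m::finite) set"
  assumes "open U" "A \<subseteq> U \<inter> coord_space J"
  shows "morse_decomposable J U r A A"
  using assms
proof (induction "card J" arbitrary: J U A r rule: less_induct)
  case less
  note outer = less.hyps
  show ?case
    using less.prems
  proof (induction r arbitrary: A)
    case 0
    then show ?case by (rule morse_decomposable_0)
  next
    case (Suc r)
    define A' where "A' = {x \<in> A. \<forall>(g :: real^'m \<Rightarrow> real) j. Ck (Suc r) g U \<and> (\<forall>x\<in>A. g x = 0) \<and> j \<in> J \<longrightarrow>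
      frechet_derivative g (at x) (axis j 1) = 0}"
    have "morse_decomposable J U r A' A'"
      using Suc.prems by (intro Suc.IH) (auto simp: A'_def)
    then have 1: "morse_decomposable J U (Suc r) A A'"
      unfolding morse_decomposable_def
      by (elim ex_forward conj_forward) (auto intro!: morse_piece_Suc[of J U r A' _ _ A] simp: A'_def simp del: Ck.simps)
    have 2: "morse_decomposable J U (Suc r) A (A - A')"
    proof (rule morse_decomposable_local)
      fix x assume "x \<in> A - A'"
      then obtain g :: "real^'m \<Rightarrow> real" and j where g: "Ck (Suc r) g U" "\<forall>x\<in>A. g x = 0" "j \<in> J" "x \<in> A"
        "frechet_derivative g (at x) (axis j 1) \<noteq> 0"
        unfolding A'_def by blast
      have "card (J - {j}) < card J" using g(3) by (meson card_Diff1_less finite)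
      then obtain N where N: "open N" "x \<in> N" "morse_decomposable J U (Suc r) A (A \<inter> N)"
        using morse_decomposable_hypersurface[OF Suc.prems g(4,3,1,2,5)] outer by blast
      then show "\<exists>N. open N \<and> x \<in> N \<and> morse_decomposable J U (Suc r) A ((A - A') \<inter> N)"
        by (metis Diff_subset Int_mono morse_decomposable_subset order_refl)
    qed
    have "A = \<Union>{A', A - A'}" by (auto simp: A'_def)
    then show ?case
      using morse_decomposable_Union[of "{A', A - A'}" J U "Suc r" A] 1 2 by auto
  qed
qed

section \<open>The Morse-Sard theorem\<close>

lemma grid_index:
  fixes t R :: real
  assumes "- R \<le> t" "t < R" "N > 0"
  obtains c :: nat where "c < N" "- R + 2 * R * c / N \<le> t" "t \<le> - R + 2 * R * (real c + 1) / N"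
proof -
  have R: "R > 0" using assms by linarith
  define s where "s = (t + R) * N / (2 * R)"
  have s: "0 \<le> s" "s < N" "t = - R + 2 * R * s / N"
  proof -
    show "0 \<le> s" using assms R by (simp add: s_def)
  qed (use assms R in \<open>auto simp: s_def field_simps\<close>)
  define c where "c = nat \<lfloor>s\<rfloor>"
  have c: "real c \<le> s" "s \<le> real c + 1" "c < N"
    using s(1,2) by (auto simp: c_def) linarith+
  have "2 * R * c / N \<le> 2 * R * s / N" "2 * R * s / N \<le> 2 * R * (real c + 1) / N"
    using c R by (intro divide_right_mono mult_left_mono; simp)+
  then show thesis using that[of c] c(3) s(3) by simp
qed

lemma negligible_Union_countable:
  assumes "countable \<S>" "\<And>S. S \<in> \<S> \<Longrightarrow> negligible S"
  shows "negligible (\<Union>\<S>)"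
  using null_sets_UN'[of \<S> "\<lambda>S. S" lebesgue] assms by (simp add: negligible_iff_null_sets)

lemma axis_1_nth: "axis i (1::real) $ j = (if j = i then 1 else 0)"
  by (simp add: axis_def)

definition cyl :: "'k::finite set \<Rightarrow> (real^'k) set \<Rightarrow> (real^'k) set" where
  "cyl K S = {y. \<exists>s\<in>S. \<forall>l\<in>K. y $ l = s $ l}"

lemma cyl_mono: "S \<subseteq> T \<Longrightarrow> cyl K S \<subseteq> cyl K T"
  by (auto simp: cyl_def)

text \<open>A grid of mesh \<open>2 * R / N\<close> cuts \<open>E\<close> into at most
  \<open>N ^ card J\<close> cells, and within a cell the coordinates of \<open>F\<close> in
  \<open>K\<close> stay within \<open>e * (D / N) ^ r\<close> of those at a reference point. The
  powers of \<open>N\<close> cancel or help because \<open>card J \<le> r * card K\<close>; in the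
  borderline case it is the factor \<open>e\<close> from the little o that makes the volume
  small.\<close>

lemma flat_image_negligible:
  fixes F :: "real^'m::finite \<Rightarrow> real^'k::finite"
  assumes "E \<subseteq> B" "bounded B" "E \<subseteq> coord_space J" "K \<noteq> {}" "card J \<le> r * card K"
    and flat: "\<And>l. l \<in> K \<Longrightarrow> flat_on r E B (\<lambda>x y. F y $ l - F x $ l)"
  shows "negligible (cyl K (F ` E))"
proof -
  \<comment> \<open>The cylinder is unbounded in the coordinates outside \<open>K\<close>, so it is
    measured inside cubes of side \<open>2 * M\<close>.\<close>
  have "negligible (cyl K (F ` E) \<inter> cbox (- (\<chi> l. real M)) (\<chi> l. real M))" for M :: nat
    unfolding negligible_outer_le
  proof (intro allI impI)
    fix \<epsilon> :: real assume "\<epsilon> > 0"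
    obtain R where R: "R > 0" "\<And>x. x \<in> B \<Longrightarrow> norm x < R"
      using assms(2) by (metis bounded_pos_less)
    \<comment> \<open>\<open>D / N\<close> bounds the diameter of a grid cell, by comparison with
      the sum norm.\<close>
    define D where "D = 2 * R * CARD('m)"
    have D: "D > 0" using R by (simp add: D_def)
    define c0 where "c0 = D ^ (r * card K) * (2 * real M) ^ (CARD('k) - card K)"
    have c0: "c0 \<ge> 0" using D by (simp add: c0_def)
    \<comment> \<open>The cap \<open>1/2\<close> gives \<open>(2 * e) ^ card K \<le> 2 * e\<close>
      for nonempty \<open>K\<close>. The other term gives
      \<open>2 * e * c0 \<le> \<epsilon>\<close>, where \<open>c0\<close> collects the factors of
      the total volume that depend on neither \<open>e\<close> nor \<open>N\<close>.\<close>
    define e where "e = min (1/2) (\<epsilon> / (2 * (c0 + 1)))"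
    have e: "e > 0" "2 * e \<le> 1" using \<open>\<epsilon> > 0\<close> c0 by (auto simp: e_def)
    have ec: "2 * e * c0 \<le> \<epsilon>"
    proof -
      have "2 * e * c0 \<le> 2 * (\<epsilon> / (2 * (c0 + 1))) * (c0 + 1)"
        using c0 e \<open>\<epsilon> > 0\<close> by (intro mult_mono) (auto simp: e_def)
      also have "\<dots> = \<epsilon>" using c0 by (simp add: divide_simps)
      finally show ?thesis .
    qed
    have "\<exists>d>0. \<forall>x\<in>E. \<forall>y\<in>B. dist x y < d \<longrightarrow> \<bar>F y $ l - F x $ l\<bar> \<le> e * dist x y ^ r" if "l \<in> K" for l
      using flat[OF that] e unfolding flat_on_def by blast
    then obtain d where d: "\<And>l. l \<in> K \<Longrightarrow> d l > 0" "\<And>l x y. l \<in> K \<Longrightarrow> x \<in> E \<Longrightarrow> y \<in> B \<Longrightarrow>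
      dist x y < d l \<Longrightarrow> \<bar>F y $ l - F x $ l\<bar> \<le> e * dist x y ^ r" by metis
    define \<delta> where "\<delta> = Min (insert 1 (d ` K))"
    have \<delta>: "\<delta> > 0" "\<And>l. l \<in> K \<Longrightarrow> \<delta> \<le> d l" using d(1) by (auto simp: \<delta>_def)
    obtain N :: nat where N: "D / \<delta> < N" using reals_Archimedean2 by blast
    have "D / \<delta> > 0" using D \<delta> by simp
    then have Npos: "N > 0" using N by (metis gr0I of_nat_0 order_less_asym)
    have DN: "D / N < \<delta>" using N Npos \<delta> by (simp add: field_simps)
    define Q where "Q c = {x \<in> E. \<forall>i\<in>J. - R + 2 * R * c i / N \<le> x $ i \<and>
      x $ i \<le> - R + 2 * R * (real (c i) + 1) / N}" for c :: "'m \<Rightarrow> nat"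
    define I where "I = J \<rightarrow>\<^sub>E {..<N}"
    have EQ: "\<exists>c\<in>I. x \<in> Q c" if "x \<in> E" for x
    proof -
      have "\<exists>c<N. - R + 2 * R * c / N \<le> x $ i \<and> x $ i \<le> - R + 2 * R * (real c + 1) / N" for i
      proof -
        have "norm x < R" using R(2) assms(1) that by blast
        then have "- R \<le> x $ i" "x $ i < R"
          using component_le_norm_cart[of x i] by linarith+
        then show ?thesis using grid_index Npos by metis
      qed
      then obtain c where "\<And>i. c i < N \<and> - R + 2 * R * real (c i) / N \<le> x $ i \<and>
          x $ i \<le> - R + 2 * R * (real (c i) + 1) / N" by metis
      then show ?thesis
        using that by (intro bexI[of _ "restrict c J"]) (auto simp: Q_def I_def)
    qed
    have distQ: "dist x y \<le> D / N" if "x \<in> Q c" "y \<in> Q c" for x y c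
    proof -
      have "\<bar>(x - y) $ i\<bar> \<le> 2 * R / N" for i
      proof (cases "i \<in> J")
        case True
        have "- R + 2 * R * (real (c i) + 1) / N = - R + 2 * R * c i / N + 2 * R / N"
          by (simp add: field_simps add_divide_distrib)
        moreover have "- R + 2 * R * c i / N \<le> x $ i" "x $ i \<le> - R + 2 * R * (real (c i) + 1) / N"
          "- R + 2 * R * c i / N \<le> y $ i" "y $ i \<le> - R + 2 * R * (real (c i) + 1) / N"
          using that True by (auto simp: Q_def)
        ultimately show ?thesis unfolding vector_minus_component by linarith
      next
        case False
        then have "x $ i = 0" "y $ i = 0"
          using that assms(3) by (auto simp: Q_def coord_space_def)
        then show ?thesis using R by simp
      qed
      then have "(\<Sum>i\<in>UNIV. \<bar>(x - y) $ i\<bar>) \<le> CARD('m) * (2 * R / N)"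
        by (intro sum_bounded_above) auto
      then show ?thesis
        using norm_le_l1_cart[of "x - y"] by (simp add: dist_norm D_def field_simps)
    qed
    \<comment> \<open>A reference point in each nonempty cell; for an empty cell the choice is
      arbitrary and only adds a harmless box.\<close>
    define X where "X c = (SOME x. x \<in> Q c)" for c
    define \<tau> where "\<tau> = e * (D / N) ^ r"
    have \<tau>: "\<tau> > 0" using e D Npos by (simp add: \<tau>_def)
    define a where "a c = (\<chi> l. if l \<in> K then F (X c) $ l - \<tau> else - real M)" for c
    define b where "b c = (\<chi> l. if l \<in> K then F (X c) $ l + \<tau> else real M)" for c
    let ?T = "\<Union>c\<in>I. cbox (a c) (b c)"
    have finI: "finite I" by (simp add: I_def finite_PiE)
    have sub: "cyl K (F ` E) \<inter> cbox (- (\<chi> l. real M)) (\<chi> l. real M) \<subseteq> ?T"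
    proof
      fix y assume y: "y \<in> cyl K (F ` E) \<inter> cbox (- (\<chi> l. real M)) (\<chi> l. real M)"
      then obtain x where x: "x \<in> E" "\<And>l. l \<in> K \<Longrightarrow> y $ l = F x $ l" by (auto simp: cyl_def)
      obtain c where c: "c \<in> I" "x \<in> Q c" using EQ[OF x(1)] by blast
      then have Xc: "X c \<in> Q c" unfolding X_def by (metis someI)
      have "\<bar>F x $ l - F (X c) $ l\<bar> \<le> \<tau>" if "l \<in> K" for l
      proof -
        have "dist (X c) x \<le> D / N" using distQ[OF Xc c(2)] .
        then have "\<bar>F x $ l - F (X c) $ l\<bar> \<le> e * dist (X c) x ^ r"
          using DN \<delta>(2)[OF that] x(1) assms(1) Xc by (intro d(2)[OF that]) (auto simp: Q_def)
        also have "\<dots> \<le> \<tau>"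
          unfolding \<tau>_def using distQ[OF Xc c(2)] e by (intro mult_left_mono power_mono) auto
        finally show ?thesis .
      qed
      then have "y \<in> cbox (a c) (b c)"
        using x(2) y by (fastforce simp: mem_box_cart a_def b_def abs_le_iff)
      then show "y \<in> ?T" using c(1) by blast
    qed
    have "measure lebesgue (cbox (a c) (b c)) = (2 * \<tau>) ^ card K * (2 * real M) ^ (CARD('k) - card K)" for c
    proof -
      have "cbox (a c) (b c) \<noteq> {}"
        using \<tau> by (auto simp: interval_ne_empty_cart a_def b_def)
      then have "measure lebesgue (cbox (a c) (b c)) = (\<Prod>l\<in>UNIV. b c $ l - a c $ l)"
        by (simp add: content_cbox_cart)
      also have "\<dots> = (\<Prod>l\<in>UNIV. if l \<in> K then 2 * \<tau> else 2 * real M)"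
        by (intro prod.cong) (auto simp: a_def b_def)
      also have "\<dots> = (2 * \<tau>) ^ card K * (2 * real M) ^ card (- K)"
        by (simp add: prod.If_cases)
      finally show ?thesis by (simp add: Compl_eq_Diff_UNIV card_Diff_subset)
    qed
    then have "measure lebesgue ?T \<le> (\<Sum>c\<in>I. (2 * \<tau>) ^ card K * (2 * real M) ^ (CARD('k) - card K))"
      using measure_UNION_le[OF finI, of "\<lambda>c. cbox (a c) (b c)" lebesgue] by simp
    also have "\<dots> = N ^ card J * ((2 * \<tau>) ^ card K * (2 * real M) ^ (CARD('k) - card K))"
      by (simp add: I_def card_PiE)
    also have "\<dots> = (2 * e) ^ card K * c0 * (real N ^ card J / N ^ (r * card K))"
      by (simp add: \<tau>_def c0_def power_mult_distrib power_divide power_mult[symmetric] mult.assoc)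
    also have "\<dots> \<le> (2 * e) ^ card K * c0 * 1"
    proof (intro mult_left_mono)
      have "real N ^ card J \<le> real N ^ (r * card K)"
        using Npos assms(5) by (intro power_increasing) auto
      then show "real N ^ card J / N ^ (r * card K) \<le> 1" using Npos by (simp add: divide_le_eq)
    qed (use e c0 in auto)
    also have "\<dots> \<le> (2 * e) * c0"
    proof -
      have "(2 * e) ^ card K \<le> (2 * e) ^ 1"
        using e assms(4) by (intro power_decreasing) (auto simp: Suc_le_eq card_gt_0_iff)
      then show ?thesis using c0 by (simp add: mult_right_mono)
    qed
    also note ec
    finally have "measure lebesgue ?T \<le> \<epsilon>" .
    moreover have "?T \<in> lmeasurable" using finI by (intro fmeasurable.finite_UN) auto
    ultimately show "\<exists>T. cyl K (F ` E) \<inter> cbox (- (\<chi> l. real M)) (\<chi> l. real M) \<subseteq> T \<and>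
        T \<in> lmeasurable \<and> measure lebesgue T \<le> \<epsilon>"
      using sub by blast
  qed
  then have "negligible (\<Union>M. cyl K (F ` E) \<inter> cbox (- (\<chi> l. real M)) (\<chi> l. real M))"
    by (intro negligible_countable_Union) auto
  moreover have "\<exists>M. y \<in> cbox (- (\<chi> l. real M)) (\<chi> l. real M)" for y :: "real^'k"
  proof -
    obtain M :: nat where "norm y \<le> M" using real_arch_simple by blast
    then have "\<bar>y $ l\<bar> \<le> M" for l using component_le_norm_cart[of y l] by linarith
    then show ?thesis by (intro exI[of _ M]) (auto simp: mem_box_cart abs_le_iff minus_le_iff)
  qed
  ultimately show ?thesis
    by (elim negligible_subset) blast
qed

text \<open>Fubini without a Lebesgue measure on the coordinate hyperplanes: in \<open>real^'k \<times> real^'k\<close> the set \<open>?T\<close>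
  has null sections, and exchanging the \<open>l\<close>-th coordinates of the two factors maps it onto
  \<open>S \<times> UNIV\<close>.\<close>

lemma negligible_slices:
  fixes S :: "(real^'k::finite) set"
  assumes "closed S" and slices: "\<And>c. negligible {y. upd y l c \<in> S}"
  shows "negligible S"
proof -
  let ?T = "{p. upd (fst p) l (snd p $ l) \<in> S} :: ((real^'k) \<times> (real^'k)) set"
  let ?\<sigma> = "\<lambda>p :: (real^'k) \<times> (real^'k). (upd (fst p) l (snd p $ l), upd (snd p) l (fst p $ l))"
  have lin: "linear ?\<sigma>"
    by (rule linearI) (auto simp: vec_eq_iff)
  have "closed ?T"
    unfolding upd_eq_add using assms(1)
    by (intro closed_vimage[OF assms(1), unfolded vimage_def] continuous_intros)
  then have T: "?T \<in> sets (lborel \<Otimes>\<^sub>M lborel)"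
    unfolding lborel_prod by simp
  have "emeasure (lborel \<Otimes>\<^sub>M lborel) ?T = (\<integral>\<^sup>+w. emeasure lborel ((\<lambda>z. (z, w)) -` ?T) \<partial>lborel)"
    by (rule lborel_pair.emeasure_pair_measure_alt2[OF T])
  also have "\<dots> = (\<integral>\<^sup>+w. 0 \<partial>(lborel :: (real^'k) measure))"
  proof (intro nn_integral_cong)
    fix w :: "real^'k"
    have "(\<lambda>z. (z, w)) -` ?T = {y. upd y l (w $ l) \<in> S}" by auto
    moreover have "closed {y. upd y l (w $ l) \<in> S}"
      unfolding upd_eq_add
      by (intro closed_vimage[OF assms(1), unfolded vimage_def] continuous_intros)
    ultimately show "emeasure lborel ((\<lambda>z. (z, w)) -` ?T) = 0"
      using slices[of "w $ l"] by (simp add: negligible_iff_emeasure0 emeasure_completion)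
  qed
  finally have "emeasure lborel ?T = 0" by (simp add: lborel_prod)
  then have "negligible ?T"
    using \<open>closed ?T\<close> by (simp add: negligible_iff_emeasure0 emeasure_completion)
  then have "negligible (?\<sigma> ` ?T)"
    using lin by (intro negligible_differentiable_image_negligible)
      (auto intro: linear_imp_differentiable_on)
  moreover have "S \<times> UNIV \<subseteq> ?\<sigma> ` ?T"
  proof
    fix p assume "p \<in> S \<times> (UNIV :: (real^'k) set)"
    moreover have "?\<sigma> (?\<sigma> p) = p" by (auto simp: prod_eq_iff vec_eq_iff)
    moreover have "upd (fst (?\<sigma> p)) l (snd (?\<sigma> p) $ l) = fst p" by (simp add: vec_eq_iff)
    ultimately show "p \<in> ?\<sigma> ` ?T"
      by (intro image_eqI[of _ _ "?\<sigma> p"]) (auto simp del: fst_conv snd_conv)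
  qed
  ultimately have "negligible (S \<times> (UNIV :: (real^'k) set))" by (rule negligible_subset)
  then have "emeasure (lborel \<Otimes>\<^sub>M lborel) (S \<times> (UNIV :: (real^'k) set)) = 0"
    using assms(1) by (simp add: negligible_iff_emeasure0 emeasure_completion lborel_prod closed_Times)
  then have "emeasure lborel S = 0"
    using assms(1) by (subst (asm) lborel.emeasure_pair_measure_Times) auto
  then show ?thesis
    using assms(1) by (simp add: negligible_iff_emeasure0 emeasure_completion)
qed

text \<open>Points where the block of the Jacobian matrix with rows \<open>K\<close> and columns
  \<open>J\<close> has rank below \<open>card K\<close>: \<open>u\<close> is a nontrivial
  combination of the rows that vanishes. Asking for \<open>u\<close> instead of a rank makes
  compactness visible, since \<open>u\<close> can be normalized.\<close>

definition crit ::
  "'m::finite set \<Rightarrow> 'k::finite set \<Rightarrow> (real^'m \<Rightarrow> real^'k) \<Rightarrow> (real^'m) set \<Rightarrow> (real^'m) set" where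
  "crit J K f U = {x \<in> U \<inter> coord_space J. \<exists>u. u \<noteq> 0 \<and> u \<in> coord_space K \<and>
     (\<forall>j\<in>J. u \<bullet> frechet_derivative f (at x) (axis j 1) = 0)}"

lemma frechet_derivative_component:
  assumes "f differentiable at x"
  shows "frechet_derivative (\<lambda>x. f x $ l) (at x) = (\<lambda>h. frechet_derivative f (at x) h $ l)"
proof -
  have "((\<lambda>x. f x $ l) has_derivative (\<lambda>h. frechet_derivative f (at x) h $ l)) (at x)"
    using assms by (intro bounded_linear.has_derivative[OF bounded_linear_vec_nth])
      (simp add: frechet_derivative_works[symmetric])
  then show ?thesis using frechet_derivative_at by metis
qed

lemma Ck_component: "open U \<Longrightarrow> Ck n f U \<Longrightarrow> Ck n (\<lambda>x. f x $ l) U"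
  by (rule Ck_linear_comp[OF _ bounded_linear_vec_nth])

lemma closed_coord_space: "closed (coord_space J)"
  unfolding coord_space_def
  by (intro closed_Collect_all closed_Collect_imp closed_Collect_eq open_Collect_const continuous_intros)

lemma closed_cyl:
  assumes "compact S"
  shows "closed (cyl K S)"
proof -
  have "cyl K S = (\<Union>x\<in>S. \<Union>y\<in>coord_space (- K). {x + y})"
  proof (intro set_eqI iffI)
    fix y assume "y \<in> cyl K S"
    then obtain s where s: "s \<in> S" "\<forall>l\<in>K. y $ l = s $ l" by (auto simp: cyl_def)
    then have "y - s \<in> coord_space (- K)" by (simp add: coord_space_def)
    moreover have "y = s + (y - s)" by simp
    ultimately show "y \<in> (\<Union>x\<in>S. \<Union>y\<in>coord_space (- K). {x + y})" using s(1) by blast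
  qed (force simp: cyl_def coord_space_def)
  then show ?thesis using compact_closed_sums[OF assms closed_coord_space] by (simp only:)
qed

text \<open>The set is the projection of a compact set of pairs of a point and a unit vector.
  Compactness makes the cylinder over its image closed, as \<open>negligible_slices\<close>
  requires.\<close>

lemma compact_crit:
  assumes "open U" "Ck (Suc n) f U" "compact D" "D \<subseteq> U"
  shows "compact (crit J K f U \<inter> D)"
proof -
  let ?X = "(D \<inter> coord_space J) \<times> (sphere 0 1 \<inter> coord_space K)"
  let ?h = "\<lambda>p. \<Sum>j\<in>J. \<bar>snd p \<bullet> frechet_derivative f (at (fst p)) (axis j 1)\<bar>"
  have X: "compact ?X"
    using assms(3) by (intro compact_Times compact_Int_closed closed_coord_space) auto
  have "continuous_on D (\<lambda>x. frechet_derivative f (at x) (axis j 1))" for j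
    using assms(2,4) by (intro continuous_on_subset[OF Ck_continuous_on[of n _ U]]) (auto simp: axis_in_Basis_iff)
  then have "continuous_on ?X (\<lambda>p. frechet_derivative f (at (fst p)) (axis j 1))" for j
    by (rule continuous_on_compose2) (auto intro!: continuous_intros)
  then have "continuous_on ?X ?h"
    by (intro continuous_intros)
  then have "closed {p \<in> ?X. ?h p = 0}"
    by (rule continuous_closed_preimage_constant) (use X compact_imp_closed in blast)
  then have "compact {p \<in> ?X. ?h p = 0}"
    using X compact_Int_closed[of ?X "{p \<in> ?X. ?h p = 0}"] by (simp add: Int_def cong: conj_cong)
  then have "compact (fst ` {p \<in> ?X. ?h p = 0})"
    by (intro compact_continuous_image continuous_intros)
  moreover have "fst ` {p \<in> ?X. ?h p = 0} = crit J K f U \<inter> D"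
  proof (intro set_eqI iffI)
    fix x assume "x \<in> fst ` {p \<in> ?X. ?h p = 0}"
    then obtain u where u: "x \<in> D \<inter> coord_space J" "u \<in> sphere 0 1 \<inter> coord_space K" "?h (x, u) = 0"
      by auto
    then have "\<forall>j\<in>J. u \<bullet> frechet_derivative f (at x) (axis j 1) = 0"
      by (simp add: sum_nonneg_eq_0_iff)
    then show "x \<in> crit J K f U \<inter> D"
      using u assms(4) unfolding crit_def by (intro IntI CollectI conjI exI[of _ u]) auto
  next
    fix x assume x: "x \<in> crit J K f U \<inter> D"
    then obtain u where u: "u \<noteq> 0" "u \<in> coord_space K"
      "\<forall>j\<in>J. u \<bullet> frechet_derivative f (at x) (axis j 1) = 0" unfolding crit_def by blast
    let ?u = "inverse (norm u) *\<^sub>R u"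
    have "(x, ?u) \<in> {p \<in> ?X. ?h p = 0}"
      using x u by (auto simp: crit_def coord_space_def)
    then show "x \<in> fst ` {p \<in> ?X. ?h p = 0}" by force
  qed
  ultimately show ?thesis by simp
qed

lemma negligible_cyl_local:
  fixes S :: "'a::second_countable_topology set"
  assumes "\<And>x. x \<in> S \<Longrightarrow> \<exists>N. open N \<and> x \<in> N \<and> negligible (cyl K (f ` (S \<inter> N)))"
  shows "negligible (cyl K (f ` S))"
proof -
  obtain \<S> where \<S>: "countable \<S>" "\<And>T. T \<in> \<S> \<Longrightarrow> negligible (cyl K (f ` T))" "S = \<Union>\<S>"
    using countable_local_cover[of S "\<lambda>T. negligible (cyl K (f ` T))"] assms by metis
  have "cyl K (f ` S) = \<Union>((\<lambda>T. cyl K (f ` T)) ` \<S>)"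
    unfolding \<S>(3) by (auto simp: cyl_def)
  then show ?thesis using \<S> by (auto intro: negligible_Union_countable)
qed

text \<open>The partial derivatives are of class \<open>s\<close> and vanish on this set, so they
  are flat of order \<open>s\<close> on Morse's pieces, and integration makes the components of
  \<open>f\<close> flat of order \<open>Suc s\<close> there.\<close>

lemma sard_flat_points:
  fixes f :: "real^'m::finite \<Rightarrow> real^'k::finite"
  assumes "open U" "Ck (Suc s) f U" "card J \<le> s + card K" "K \<noteq> {}"
  shows "negligible (cyl K (f ` {x \<in> U \<inter> coord_space J.
    \<forall>j\<in>J. \<forall>l\<in>K. frechet_derivative f (at x) (axis j 1) $ l = 0}))" 
proof -
  define A where "A = {x \<in> U \<inter> coord_space J.
    \<forall>j\<in>J. \<forall>l\<in>K. frechet_derivative f (at x) (axis j 1) $ l = 0}"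
  \<comment> \<open>Here the order of differentiability meets the count of cubes:
    \<open>Suc s * card K \<ge> s + card K\<close>, with equality for
    \<open>card K = 1\<close>.\<close>
  have dim: "card J \<le> Suc s * card K"
  proof -
    have "1 \<le> card K" using assms(4) by (simp add: Suc_le_eq card_gt_0_iff)
    then have "s * 1 \<le> s * card K" by (intro mult_left_mono) auto
    then show ?thesis using assms(3) unfolding mult_Suc mult_1_right by linarith
  qed
  have "morse_decomposable J U s A A" by (rule morse_decomposition[OF assms(1)]) (auto simp: A_def)
  then obtain \<P> where \<P>: "countable \<P>" "\<And>E \<psi>. (E, \<psi>) \<in> \<P> \<Longrightarrow> morse_piece J U s A E \<psi>"
    "A \<subseteq> (\<Union>(E, \<psi>)\<in>\<P>. \<psi> ` E)" unfolding morse_decomposable_def by blast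
  have neg: "negligible (cyl K ((f \<circ> \<psi>) ` E))" if piece: "(E, \<psi>) \<in> \<P>" for E \<psi>
  proof -
    obtain B where B: "E \<subseteq> B" "parametrization J U B \<psi>"
      and E: "E \<subseteq> coord_space J" "\<psi> ` E \<subseteq> A"
      and flat: "\<And>g. Ck s g U \<Longrightarrow> (\<forall>x\<in>A. g x = 0) \<Longrightarrow> flat_on s E B (\<lambda>x y. g (\<psi> y))"
      using \<P>(2)[OF piece] unfolding morse_piece_def by blast
    have "flat_on (Suc s) E B (\<lambda>x y. (f \<circ> \<psi>) y $ l - (f \<circ> \<psi>) x $ l)" if "l \<in> K" for l
    proof -
      have c: "Ck (Suc s) (\<lambda>x. f x $ l) U" using Ck_component[OF assms(1,2)] .
      have "flat_on s E B (\<lambda>x y. frechet_derivative (\<lambda>x. f x $ l) (at (\<psi> y)) (axis j 1))" if "j \<in> J" for j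
        using c assms(2) that \<open>l \<in> K\<close>
        by (intro flat) (auto simp: axis_in_Basis_iff frechet_derivative_component A_def)
      then show ?thesis
        using flat_on_integrate[OF B(2,1), of "\<lambda>x. f x $ l" s] c by (simp add: o_def)
    qed
    moreover have "bounded B" using B(2) by (simp add: parametrization_def)
    ultimately show ?thesis
      using B(1) E(1) dim assms(4) by (intro flat_image_negligible) auto
  qed
  have "cyl K (f ` A) \<subseteq> \<Union>((\<lambda>(E, \<psi>). cyl K ((f \<circ> \<psi>) ` E)) ` \<P>)"
  proof
    fix y assume "y \<in> cyl K (f ` A)"
    then obtain x where x: "x \<in> A" "\<forall>l\<in>K. y $ l = f x $ l" unfolding cyl_def by blast
    then obtain E \<psi> e where e: "(E, \<psi>) \<in> \<P>" "e \<in> E" "x = \<psi> e" using \<P>(3) by blast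
    then have "y \<in> cyl K ((f \<circ> \<psi>) ` E)" using x(2) unfolding cyl_def by auto
    then show "y \<in> \<Union>((\<lambda>(E, \<psi>). cyl K ((f \<circ> \<psi>) ` E)) ` \<P>)" using e(1) by blast
  qed
  moreover have "negligible (\<Union>((\<lambda>(E, \<psi>). cyl K ((f \<circ> \<psi>) ` E)) ` \<P>))"
    using \<P>(1) neg by (intro negligible_Union_countable) auto
  ultimately show ?thesis unfolding A_def by (rule negligible_subset[rotated])
qed

text \<open>As the \<open>l\<close>-th component equals the \<open>j\<close>-th coordinate, the
  slice of the image at height \<open>c\<close> comes from the hyperplane \<open>z $ j = c\<close>,
  where the other components pose the same problem with one variable and one component
  fewer.\<close>

lemma sard_straightened:
  fixes F :: "real^'m::finite \<Rightarrow> real^'k::finite"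
  assumes "open W" "Ck (Suc s) F W" "j \<in> J" "l \<in> K" and Fl: "\<And>z. z \<in> W \<Longrightarrow> F z $ l = z $ j"
    and "compact D" "D \<subseteq> W"
    and IH: "\<And>G V. open V \<Longrightarrow> Ck (Suc s) G V \<Longrightarrow> negligible (cyl (K - {l}) (G ` crit (J - {j}) (K - {l}) G V))"
  shows "negligible (cyl K (F ` (crit J K F W \<inter> D)))"
proof (rule negligible_slices[where l = l])
  have "continuous_on (crit J K F W \<inter> D) F"
    using assms(7) by (intro continuous_on_subset[OF Ck_continuous_on[OF assms(2)]]) auto
  then show "closed (cyl K (F ` (crit J K F W \<inter> D)))"
    by (intro closed_cyl compact_continuous_image compact_crit[OF assms(1,2,6,7)])
next
  fix c :: real
  \<comment> \<open>Moves the hyperplane to the coordinate subspace through \<open>0\<close>, the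
    only kind that \<open>crit\<close> refers to.\<close>
  let ?t = "\<lambda>z. z + c *\<^sub>R axis j 1"
  let ?G = "\<lambda>z. F (?t z)" and ?V = "?t -` W"
  have V: "open ?V" by (intro open_vimage assms(1) continuous_intros)
  have "bounded_linear (\<lambda>z :: real^'m. z)" by (rule bounded_linear_ident)
  then have t: "Ck n ?t ?V" for n by (intro Ck_add Ck_const Ck_linear V)
  have G: "Ck (Suc s) ?G ?V"
    by (rule Ck_componentwise[OF V])
      (rule Ck_compose[OF V assms(1) _ Ck_component[OF assms(1,2)] t], auto)
  have Dl: "frechet_derivative F (at z) h $ l = h $ j" if "z \<in> W" for z h
  proof -
    have "frechet_derivative (\<lambda>z. F z $ l) (at z) = frechet_derivative (\<lambda>z. z $ j) (at z)"
      using Fl by (intro frechet_derivative_cong_open[OF assms(1) that]) auto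
    moreover have "frechet_derivative (\<lambda>z. z $ j) (at z) = (\<lambda>z. z $ j)"
      by (rule frechet_derivative_at[symmetric]) (intro bounded_linear_imp_has_derivative bounded_linear_vec_nth)
    moreover have "frechet_derivative F (at z) h $ l = frechet_derivative (\<lambda>z. F z $ l) (at z) h"
      using assms(2) that by (simp add: frechet_derivative_component)
    ultimately show ?thesis by simp
  qed
  have DG: "frechet_derivative ?G (at z) = frechet_derivative F (at (?t z))" if "z \<in> ?V" for z
  proof -
    have "(?t has_derivative (\<lambda>h. h)) (at z)" by (auto intro!: derivative_eq_intros)
    from has_derivative_compose[OF this Ck_Suc_has_derivative[OF assms(2)]] that
    show ?thesis by (intro frechet_derivative_at[symmetric]) auto
  qed
  have "{y. upd y l c \<in> cyl K (F ` (crit J K F W \<inter> D))} \<subseteq>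
      cyl (K - {l}) (?G ` crit (J - {j}) (K - {l}) ?G ?V)"
  proof
    fix y assume "y \<in> {y. upd y l c \<in> cyl K (F ` (crit J K F W \<inter> D))}"
    then obtain z where z: "z \<in> crit J K F W" "\<And>l'. l' \<in> K \<Longrightarrow> upd y l c $ l' = F z $ l'"
      unfolding cyl_def by blast
    then obtain u where u: "u \<noteq> 0" "u \<in> coord_space K"
      "\<And>j. j \<in> J \<Longrightarrow> u \<bullet> frechet_derivative F (at z) (axis j 1) = 0" and zW: "z \<in> W" "z \<in> coord_space J"
      unfolding crit_def by blast
    have zj: "z $ j = c" using z(2)[OF assms(4)] Fl[OF zW(1)] by simp
    define z' where "z' = z - c *\<^sub>R axis j 1"
    have z': "?t z' = z" "z' \<in> ?V" using zW by (auto simp: z'_def)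
    have z'J: "z' \<in> coord_space (J - {j})"
      using zW(2) zj by (auto simp: z'_def coord_space_def axis_def)
    have split: "u \<bullet> w = upd u l 0 \<bullet> w + u $ l * w $ l" for w
    proof -
      have "u = upd u l 0 + u $ l *\<^sub>R axis l 1" by (simp add: vec_eq_iff axis_def)
      then have "u \<bullet> w = (upd u l 0 + u $ l *\<^sub>R axis l 1) \<bullet> w" by simp
      then show ?thesis by (simp add: inner_add_left inner_axis' mult.commute)
    qed
    \<comment> \<open>Row \<open>l\<close> of the Jacobian matrix is the \<open>j\<close>-th unit
      covector, so dropping \<open>u $ l\<close> changes nothing in the directions other than
      \<open>j\<close>. Were nothing left of \<open>u\<close>, direction \<open>j\<close> would
      force \<open>u $ l = 0\<close>.\<close>
    have "upd u l 0 \<noteq> 0"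
    proof
      assume "upd u l 0 = 0"
      then have u': "u \<bullet> w = u $ l * w $ l" for w using split[of w] by simp
      then have "u $ l = 0"
        using u(3)[OF assms(3)] Dl[OF zW(1)] by (simp add: axis_1_nth)
      then show False using u(1) u'[of u] by simp
    qed
    moreover have "upd u l 0 \<in> coord_space (K - {l})"
      using u(2) by (auto simp: coord_space_def)
    moreover have "upd u l 0 \<bullet> frechet_derivative ?G (at z') (axis i 1) = 0" if "i \<in> J - {j}" for i
      using u(3)[of i] split[of "frechet_derivative F (at z) (axis i 1)"] Dl[OF zW(1), of "axis i 1"] that
      unfolding DG[OF z'(2)] z'(1) by (auto simp: axis_1_nth)
    ultimately have "z' \<in> crit (J - {j}) (K - {l}) ?G ?V"
      unfolding crit_def using z'(2) z'J by blast
    moreover have "\<forall>l'\<in>K - {l}. y $ l' = ?G z' $ l'"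
      unfolding z'(1) using z(2) by (auto split: if_splits) (metis)
    ultimately show "y \<in> cyl (K - {l}) (?G ` crit (J - {j}) (K - {l}) ?G ?V)"
      unfolding cyl_def by blast
  qed
  then show "negligible {y. upd y l c \<in> cyl K (F ` (crit J K F W \<inter> D))}"
    using IH[OF V G] negligible_subset by blast
qed

text \<open>Induction on the number of variables with \<open>s\<close> fixed: straightening takes
  one index from \<open>J\<close> and one from \<open>K\<close>, which preserves
  \<open>card J \<le> s + card K\<close>. If \<open>K\<close> is exhausted, no nonzero
  \<open>u\<close> is left and there are no critical points.\<close>

lemma sard_coord:
  fixes f :: "real^'m::finite \<Rightarrow> real^'k::finite"
  assumes "open U" "Ck (Suc s) f U" "card J \<le> s + card K"
  shows "negligible (cyl K (f ` crit J K f U))"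
  using assms
proof (induction "card J" arbitrary: J K U f rule: less_induct)
  case less
  note U = less.prems(1) and f = less.prems(2)
  let ?D = "\<lambda>x. frechet_derivative f (at x)"
  define A where "A = {x \<in> U \<inter> coord_space J. \<forall>j\<in>J. \<forall>l\<in>K. ?D x (axis j 1) $ l = 0}"
  have A: "negligible (cyl K (f ` (crit J K f U \<inter> A)))"
  proof (cases "K = {}")
    case True
    then have "crit J K f U = {}" by (auto simp: crit_def coord_space_def vec_eq_iff)
    then show ?thesis by (simp add: cyl_def)
  next
    case False
    have "negligible (cyl K (f ` A))"
      unfolding A_def using sard_flat_points[OF less.prems False] .
    then show ?thesis by (rule negligible_subset) (auto simp: cyl_def)
  qed
  have "negligible (cyl K (f ` (crit J K f U - A)))"
  proof (rule negligible_cyl_local)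
    fix x0 assume x0: "x0 \<in> crit J K f U - A"
    then obtain j l where jl: "j \<in> J" "l \<in> K" "?D x0 (axis j 1) $ l \<noteq> 0" and x0U: "x0 \<in> U" "x0 \<in> coord_space J"
      by (auto simp: A_def crit_def)
    let ?g = "\<lambda>x. f x $ l"
    have D0: "frechet_derivative ?g (at x0) (axis j 1) \<noteq> 0"
      using jl(3) f x0U by (simp add: frechet_derivative_component)
    obtain N W \<Theta> where N: "open N" "x0 \<in> N" "N \<subseteq> U" and W: "open W"
      and \<Theta>: "\<Theta> ` W \<subseteq> U" "Ck (Suc s) \<Theta> W"
        "\<And>z i. z \<in> W \<Longrightarrow> i \<noteq> j \<Longrightarrow> \<Theta> z $ i = z $ i" "\<And>z. z \<in> W \<Longrightarrow> ?g (\<Theta> z) = z $ j"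
        "\<And>x. x \<in> N \<Longrightarrow> upd x j (?g x) \<in> W" "\<And>x. x \<in> N \<Longrightarrow> \<Theta> (upd x j (?g x)) = x"
      by (rule straighten[OF U Ck_component[OF U f] x0U(1) D0], rule that, assumption+)
    let ?F = "\<lambda>z. f (\<Theta> z)" and ?\<Phi> = "\<lambda>x. upd x j (?g x)"
    have F: "Ck (Suc s) ?F W"
      by (rule Ck_componentwise[OF W])
        (rule Ck_compose[OF W U \<Theta>(1) Ck_component[OF U f] \<Theta>(2)])
    have DF: "frechet_derivative ?F (at z) = (\<lambda>h. ?D (\<Theta> z) (frechet_derivative \<Theta> (at z) h))" if "z \<in> W" for z
      using has_derivative_compose[OF Ck_Suc_has_derivative[OF \<Theta>(2) that] Ck_Suc_has_derivative[OF f]]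
        \<Theta>(1) that by (intro frechet_derivative_at[symmetric]) blast
    \<comment> \<open>\<open>\<Theta>\<close> changes only the \<open>j\<close>-th coordinate, so
      its derivative maps the directions of \<open>J\<close> into \<open>coord_space J\<close>; this
      carries criticality from \<open>f\<close> to \<open>?F\<close>.\<close>
    have D\<Theta>: "frechet_derivative \<Theta> (at z) (axis i 1) \<in> coord_space J" if "z \<in> W" "i \<in> J" for z i
    proof -
      have "frechet_derivative \<Theta> (at z) (axis i 1) $ i' = 0" if "i' \<notin> J" for i'
      proof -
        have "i' \<noteq> j" using that jl(1) by blast
        then have "frechet_derivative (\<lambda>z. \<Theta> z $ i') (at z) = frechet_derivative (\<lambda>z. z $ i') (at z)"
          using \<Theta>(3) by (intro frechet_derivative_cong_open[OF W \<open>z \<in> W\<close>]) auto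
        also have "\<dots> = (\<lambda>z. z $ i')"
          by (rule frechet_derivative_at[symmetric]) (intro bounded_linear_imp_has_derivative bounded_linear_vec_nth)
        finally have "frechet_derivative (\<lambda>z. \<Theta> z $ i') (at z) (axis i 1) = 0"
          using \<open>i \<in> J\<close> that by (auto simp: axis_1_nth)
        then show ?thesis
          using \<Theta>(2) \<open>z \<in> W\<close> by (simp add: frechet_derivative_component)
      qed
      then show ?thesis by (simp add: coord_space_def)
    qed
    obtain e where e: "e > 0" "cball (?\<Phi> x0) e \<subseteq> W"
      using W \<Theta>(5)[OF N(2)] open_contains_cball by blast
    \<comment> \<open>Keeps the straightened points in a closed ball, because
      \<open>sard_straightened\<close> works on a compact set.\<close>
    let ?N = "N \<inter> ?\<Phi> -` ball (?\<Phi> x0) e"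
    have "continuous_on N f"
      using N(3) by (intro continuous_on_subset[OF Ck_continuous_on[OF f]])
    then have "continuous_on N ?\<Phi>"
      unfolding upd_eq_add by (intro continuous_intros)
    then have oN: "open ?N"
      using N(1) by (simp add: continuous_on_open_vimage Int_commute)
    have "f ` (crit J K f U \<inter> ?N) \<subseteq> ?F ` (crit J K ?F W \<inter> cball (?\<Phi> x0) e)"
    proof (rule image_subsetI)
      fix x assume x: "x \<in> crit J K f U \<inter> ?N"
      then obtain u where u: "u \<noteq> 0" "u \<in> coord_space K" "\<And>j. j \<in> J \<Longrightarrow> u \<bullet> ?D x (axis j 1) = 0"
        and xU: "x \<in> U" "x \<in> coord_space J" unfolding crit_def by blast
      have z: "?\<Phi> x \<in> W" "\<Theta> (?\<Phi> x) = x" using \<Theta>(5,6) x by auto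
      have "u \<bullet> ?D x h = 0" if "h \<in> coord_space J" for h
      proof -
        have "linear (\<lambda>h. u \<bullet> ?D x h)"
          using has_derivative_linear[OF Ck_Suc_has_derivative[OF f xU(1)]]
          by (auto intro!: linearI simp: linear_add linear_scale inner_add_right)
        then have "u \<bullet> ?D x h = (\<Sum>i\<in>UNIV. h $ i * (u \<bullet> ?D x (axis i 1)))"
          by (rule linear_axis_sum)
        also have "\<dots> = 0"
          using u(3) that by (intro sum.neutral) (auto simp: coord_space_def)
        finally show ?thesis .
      qed
      then have "\<forall>i\<in>J. u \<bullet> frechet_derivative ?F (at (?\<Phi> x)) (axis i 1) = 0"
        using D\<Theta>[OF z(1)] unfolding DF[OF z(1)] z(2) by blast
      moreover have "?\<Phi> x \<in> coord_space J" using xU(2) jl(1) by (auto simp: coord_space_def)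
      ultimately have "?\<Phi> x \<in> crit J K ?F W \<inter> cball (?\<Phi> x0) e"
        using z(1) u(1,2) x unfolding crit_def by auto
      then show "f x \<in> ?F ` (crit J K ?F W \<inter> cball (?\<Phi> x0) e)" using z(2) by force
    qed
    moreover have "negligible (cyl K (?F ` (crit J K ?F W \<inter> cball (?\<Phi> x0) e)))"
    proof (rule sard_straightened[OF W F jl(1,2) \<Theta>(4) compact_cball e(2)])
      fix G :: "real^'m \<Rightarrow> real^'k" and V assume "open V" "Ck (Suc s) G V"
      moreover have "card (J - {j}) < card J" using jl(1) by (meson card_Diff1_less finite)
      moreover have "card (J - {j}) \<le> s + card (K - {l})"
        using jl(1,2) less.prems(3) by (simp add: card_Diff_singleton)
      ultimately show "negligible (cyl (K - {l}) (G ` crit (J - {j}) (K - {l}) G V))"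
        using less.hyps by blast
    qed
    moreover have "f ` ((crit J K f U - A) \<inter> ?N) \<subseteq> f ` (crit J K f U \<inter> ?N)" by blast
    ultimately have "negligible (cyl K (f ` ((crit J K f U - A) \<inter> ?N)))"
      by (meson cyl_mono negligible_subset subset_trans)
    then show "\<exists>N. open N \<and> x0 \<in> N \<and> negligible (cyl K (f ` ((crit J K f U - A) \<inter> N)))"
      using oN N(2) e(1) by (intro exI[of _ ?N]) auto
  qed
  then have "negligible (cyl K (f ` (crit J K f U \<inter> A)) \<union> cyl K (f ` (crit J K f U - A)))"
    using A by (rule negligible_Un[rotated])
  then show ?case
    by (rule negligible_subset) (auto simp: cyl_def)
qed

lemma not_surj_orthogonal:
  fixes D :: "'a::real_vector \<Rightarrow> 'b::euclidean_space"
  assumes "linear D" "\<not> surj D"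
  obtains u where "u \<noteq> 0" "\<And>h. u \<bullet> D h = 0"
proof -
  have "subspace (range D)" using assms(1) by (intro linear_subspace_image subspace_UNIV)
  then have "span (range D) = range D" by (simp only: span_eq_iff)
  then have "span (range D) \<noteq> UNIV" using assms(2) by argo
  then have "dim (range D) < DIM('b)"
    using dim_eq_full[of "range D"] dim_subset_UNIV[of "range D"] by linarith
  then obtain u where "u \<noteq> 0" "\<And>y. y \<in> span (range D) \<Longrightarrow> orthogonal u y"
    using orthogonal_to_subspace_exists by blast
  then show thesis by (intro that[of u]) (auto simp: orthogonal_def span_base)
qed

text \<open>All coordinates at once, where cylinders are the sets themselves. A vector orthogonal to
  the range of the derivative is the witness for \<open>crit\<close>.\<close>

theorem morse_sard:
  fixes f :: "real^'m::finite \<Rightarrow> real^'k::finite"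
  assumes "open U" "Ck (Suc s) f U" "CARD('m) \<le> s + CARD('k)"
  shows "negligible (f ` {x \<in> U. \<not> surj (frechet_derivative f (at x))})"
proof -
  have *: "x \<in> crit UNIV UNIV f U" if "x \<in> U" "\<not> surj (frechet_derivative f (at x))" for x
  proof -
    let ?D = "frechet_derivative f (at x)"
    have "linear ?D" using has_derivative_linear[OF Ck_Suc_has_derivative[OF assms(2) that(1)]] .
    from not_surj_orthogonal[OF this that(2)] obtain u where "u \<noteq> 0" "\<And>h. u \<bullet> ?D h = 0" by blast
    then show ?thesis
      using that(1) unfolding crit_def coord_space_def
      by (intro CollectI conjI IntI exI[of _ u]) auto
  qed
  have "cyl UNIV S = S" for S :: "(real^'k) set" by (auto simp: cyl_def vec_eq_iff[symmetric])
  moreover have "negligible (cyl UNIV (f ` crit UNIV UNIV f U))"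
    using assms(3) by (intro sard_coord[OF assms(1,2)]) simp
  ultimately have "negligible (f ` crit UNIV UNIV f U)" by (simp only:)
  then show ?thesis
    by (rule negligible_subset) (use * in blast)
qed

section \<open>The weak Whitney topology\<close>

text \<open>Both sides choose from the same set of derivatives, even where that set is empty. Hence
  \<open>jac_add_const\<close> holds for every function.\<close>

lemma frechet_derivative_add_const:
  "frechet_derivative (\<lambda>x. f x + c) = frechet_derivative f"
proof -
  have "((\<lambda>x. f x + c) has_derivative f') F \<longleftrightarrow> (f has_derivative f') F" for f' F
    using has_derivative_add[of "\<lambda>x. f x + c" f' F "\<lambda>x. - c" "\<lambda>x. 0"]
      has_derivative_add[of f f' F "\<lambda>x. c" "\<lambda>x. 0"] by auto
  then show ?thesis by (simp add: frechet_derivative_def fun_eq_iff)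
qed

lemma iter_deriv_add_const:
  "iter_deriv vs (\<lambda>x. f x + c) = (if vs = [] then (\<lambda>x. f x + c) else iter_deriv vs f)"
  by (induction vs rule: rev_induct) (simp_all add: iter_deriv_snoc frechet_derivative_add_const)

lemma C_on_add_const:
  assumes "C_on r f S"
  shows "C_on r (\<lambda>x. f x + c) S"
  unfolding C_on_def
proof (intro allI impI)
  fix vs :: "'a list" assume vs: "set vs \<subseteq> Basis"
  show "(enat (length vs) \<le> r \<longrightarrow> continuous_on S (iter_deriv vs (\<lambda>x. f x + c))) \<and>
    (enat (length vs) < r \<longrightarrow> (\<forall>x\<in>S. iter_deriv vs (\<lambda>x. f x + c) differentiable at x))"
  proof (cases vs)
    case Nil
    then show ?thesis
      using assms unfolding C_on_def
      by (auto dest!: spec[of _ "[]"] intro!: continuous_intros differentiable_add)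
  next
    case (Cons v ws)
    then have "iter_deriv vs (\<lambda>x. f x + c) = iter_deriv vs f"
      unfolding iter_deriv_add_const by simp
    then show ?thesis using assms vs unfolding C_on_def by metis
  qed
qed

section \<open>Borel sets of a topology and joint measurability\<close>

lemma space_borel_of [simp]: "space (borel_of T) = topspace T"
  and sets_borel_of: "sets (borel_of T) = sigma_sets (topspace T) {U. openin T U}"
  unfolding borel_of_def by (auto simp: space_measure_of_conv intro!: sets_measure_of openin_subset)

lemma openin_borel_of: "openin T U \<Longrightarrow> U \<in> sets (borel_of T)"
  by (simp add: sets_borel_of)

lemma measurable_borel_ofI:
  assumes "\<And>x. x \<in> space M \<Longrightarrow> f x \<in> topspace T"
    and "\<And>U. openin T U \<Longrightarrow> f -` U \<inter> space M \<in> sets M"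
  shows "f \<in> measurable M (borel_of T)"
  unfolding borel_of_def using assms by (intro measurable_measure_of) (auto dest: openin_subset)

lemma continuous_map_measurable:
  assumes "continuous_map T euclidean f"
  shows "f \<in> borel_measurable (borel_of T)"
proof (rule borel_measurableI)
  fix S :: "'b set" assume "open S"
  then have "openin T {x \<in> topspace T. f x \<in> S}"
    using assms by (intro openin_continuous_map_preimage) auto
  moreover have "{x \<in> topspace T. f x \<in> S} = f -` S \<inter> space (borel_of T)" by auto
  ultimately show "f -` S \<inter> space (borel_of T) \<in> sets (borel_of T)"
    using openin_borel_of by metis
qed

text \<open>On a compact set a strict bound leaves a positive margin, which
  \<open>continuous_map_add_const\<close> divides between its two arguments.\<close>

lemma compact_strict_upper_bound:
  fixes f :: "'a::topological_space \<Rightarrow> real"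
  assumes "compact S" "continuous_on S f" "\<And>x. x \<in> S \<Longrightarrow> f x < e"
  obtains s where "s < e" "\<And>x. x \<in> S \<Longrightarrow> f x \<le> s"
proof (cases "S = {}")
  case True
  then show thesis using that[of "e - 1"] by auto
next
  case False
  then show thesis using continuous_attains_sup[OF assms(1) False assms(2)] that assms(3) by blast
qed

text \<open>Only one factor has to be second countable for the open sets of a product to be measurable
  for the product of the Borel \<open>\<sigma>\<close>-algebras.\<close>

lemma measurable_continuous_pair:
  fixes y :: "'w \<Rightarrow> 'c::second_countable_topology"
  assumes F: "continuous_map (prod_topology S euclidean) T (\<lambda>(z, y). F z y)"
    and Z: "Z \<in> measurable M (borel_of S)" and y: "y \<in> borel_measurable M"
  shows "(\<lambda>w. F (Z w) (y w)) \<in> measurable M (borel_of T)"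
proof (rule measurable_borel_ofI)
  have ZS: "Z w \<in> topspace S" if "w \<in> space M" for w
    using measurable_space[OF Z that] by simp
  then show "F (Z w) (y w) \<in> topspace T" if "w \<in> space M" for w
    using continuous_map_image_subset_topspace[OF F] that by auto
  fix U assume U: "openin T U"
  obtain \<B> :: "'c set set" where \<B>: "countable \<B>" "topological_basis \<B>"
    using ex_countable_basis by blast
  \<comment> \<open>The preimage of \<open>U\<close> is the union of the rectangles
    \<open>V b \<times> b\<close>, countably many because \<open>b\<close> runs through a countable
    base.\<close>
  define V where "V b = \<Union>{V. openin S V \<and> (\<forall>z\<in>V. \<forall>x\<in>b. F z x \<in> U)}" for b
  have V: "openin S (V b)" for b unfolding V_def by (intro openin_Union) auto
  have "(\<lambda>w. F (Z w) (y w)) -` U \<inter> space M =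
      (\<Union>b\<in>\<B>. (Z -` V b \<inter> space M) \<inter> (y -` b \<inter> space M))" (is "?L = ?R")
  proof (intro set_eqI iffI)
    fix w assume w: "w \<in> ?L"
    define G where "G = {p \<in> topspace (prod_topology S euclidean). (case p of (z, y) \<Rightarrow> F z y) \<in> U}"
    have "openin (prod_topology S euclidean) G"
      unfolding G_def by (rule openin_continuous_map_preimage[OF F U])
    moreover have "(Z w, y w) \<in> G" using w ZS by (auto simp: G_def)
    ultimately have "\<exists>V1 V2. openin S V1 \<and> openin euclidean V2 \<and> Z w \<in> V1 \<and> y w \<in> V2 \<and> V1 \<times> V2 \<subseteq> G"
      by (simp only: openin_prod_topology_alt)
    then obtain V1 V2 where V12: "openin S V1" "openin euclidean V2" "Z w \<in> V1" "y w \<in> V2"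
      "V1 \<times> V2 \<subseteq> G"
      by blast
    obtain b where b: "b \<in> \<B>" "y w \<in> b" "b \<subseteq> V2"
      using topological_basisE[OF \<B>(2), of V2 "y w"] V12(2,4) by auto
    have "F z x \<in> U" if "z \<in> V1" "x \<in> b" for z x
    proof -
      have "(z, x) \<in> G" using V12(5) b(3) that by blast
      then show ?thesis by (simp add: G_def)
    qed
    then have "V1 \<in> {V. openin S V \<and> (\<forall>z\<in>V. \<forall>x\<in>b. F z x \<in> U)}" using V12(1) by simp
    then have "Z w \<in> V b" using V12(3) unfolding V_def by (rule UnionI)
    then show "w \<in> ?R" using b w by blast
  qed (auto simp: V_def)
  moreover have "Z -` V b \<inter> space M \<in> sets M" for b
    using Z openin_borel_of[OF V] by (rule measurable_sets)
  moreover have "y -` b \<inter> space M \<in> sets M" if "b \<in> \<B>" for b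
    using y topological_basis_open[OF \<B>(2) that] by (intro measurable_sets) auto
  ultimately show "(\<lambda>w. F (Z w) (y w)) -` U \<inter> space M \<in> sets M"
    using \<B>(1) by auto
qed

section \<open>Charts, evaluations and translations in the weak Whitney topology\<close>

locale smooth_manifold =
  fixes A :: "('a::{t2_space, second_countable_topology}, 'm::finite) chart set"
  assumes atlas: "smooth_atlas A"
begin

lemma chart:
  assumes "c \<in> A"
  shows chart_open: "open (fst c)" and chart_image_open: "open (snd c ` fst c)"
    and chart_inv_chart: "\<And>p. p \<in> fst c \<Longrightarrow> chart_inv c (snd c p) = p"
    and chart_chart_inv: "\<And>x. x \<in> snd c ` fst c \<Longrightarrow> snd c (chart_inv c x) = x"
    and chart_inv_in: "\<And>x. x \<in> snd c ` fst c \<Longrightarrow> chart_inv c x \<in> fst c"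
    and chart_continuous: "continuous_on (fst c) (snd c)"
    and chart_inv_continuous: "continuous_on (snd c ` fst c) (chart_inv c)"
  using atlas assms by (auto simp: smooth_atlas_def is_chart_def homeomorphism_def)

lemma chart_around: obtains c where "c \<in> A" "p \<in> fst c"
proof -
  have "p \<in> (\<Union>c\<in>A. fst c)" using atlas unfolding smooth_atlas_def by blast
  then show thesis using that by blast
qed

lemma C_space_mono: "r \<le> q \<Longrightarrow> C_space A q \<subseteq> C_space A r"
  unfolding C_space_def C_on_def by (auto intro: order_trans less_le_trans)

lemma openin_whitney_nbhd:
  "f \<in> C_space A r \<Longrightarrow> c \<in> A \<Longrightarrow> compact K \<Longrightarrow> K \<subseteq> fst c \<Longrightarrow> enat n \<le> r \<Longrightarrow> 0 < e \<Longrightarrow>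
    openin (weak_whitney A r) (whitney_nbhd A r f c K n e)"
  unfolding weak_whitney_def by (rule topology_generated_by_Basis) blast

lemma self_in_whitney_nbhd: "f \<in> C_space A r \<Longrightarrow> 0 < e \<Longrightarrow> f \<in> whitney_nbhd A r f c K n e"
  by (simp add: whitney_nbhd_def)

lemma topspace_weak_whitney: "topspace (weak_whitney A r) = C_space A r"
proof
  show "C_space A r \<subseteq> topspace (weak_whitney A r :: ('a \<Rightarrow> real^'k::finite) topology)"
  proof
    fix f :: "'a \<Rightarrow> real^'k" assume f: "f \<in> C_space A r"
    obtain c where c: "c \<in> A" using chart_around by metis
    \<comment> \<open>The empty compact set imposes no condition on the derivatives.\<close>
    have "openin (weak_whitney A r) (whitney_nbhd A r f c {} 0 1)"
      using f c by (intro openin_whitney_nbhd) (auto simp: zero_enat_def[symmetric])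
    then have "whitney_nbhd A r f c {} 0 1 \<subseteq> topspace (weak_whitney A r)" by (rule openin_subset)
    then show "f \<in> topspace (weak_whitney A r)"
      using self_in_whitney_nbhd[OF f zero_less_one] by (rule subsetD)
  qed
  have "whitney_nbhd A r f d K n e \<subseteq> C_space A r" for f :: "'a \<Rightarrow> real^'k::finite" and d K n e
    by (auto simp: whitney_nbhd_def)
  then show "topspace (weak_whitney A r :: ('a \<Rightarrow> real^'k::finite) topology) \<subseteq> C_space A r"
    unfolding weak_whitney_def topology_generated_by_topspace
    by (intro Union_least) (elim CollectE exE conjE, simp only:)
qed

lemma C_space_iter_deriv_continuous:
  assumes "f \<in> C_space A r" "c \<in> A" "set vs \<subseteq> Basis" "enat (length vs) \<le> r"
  shows "continuous_on (snd c ` fst c) (iter_deriv vs (f \<circ> chart_inv c))"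
  using assms by (auto simp: C_space_def C_on_def)

lemma C_space_add_const:
  assumes "f \<in> C_space A r"
  shows "(\<lambda>p. f p + y) \<in> C_space A r"
proof -
  have *: "(\<lambda>p. f p + y) \<circ> chart_inv c = (\<lambda>x. (f \<circ> chart_inv c) x + y)" for c :: "('a, 'm) chart" by auto
  have "C_on r ((\<lambda>p. f p + y) \<circ> chart_inv c) (snd c ` fst c)" if "c \<in> A" for c
  proof -
    have "C_on r (f \<circ> chart_inv c) (snd c ` fst c)" using assms that by (simp only: C_space_def mem_Collect_eq)
    then show ?thesis using C_on_add_const by (simp only: *)
  qed
  then show ?thesis unfolding C_space_def by blast
qed

text \<open>A constant affects only the derivative of order \<open>0\<close>, so translation is
  jointly continuous. Source and target have different orders in order to cover the inclusion of
  \<open>C^r\<close> in \<open>C^1\<close> as well.\<close>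

lemma continuous_map_add_const:
  assumes "1 \<le> r"
  shows "continuous_map (prod_topology (weak_whitney A r) euclidean) (weak_whitney A 1)
    (\<lambda>(f, y :: real^'k::finite). \<lambda>p. f p + y)" (is "continuous_map ?P _ ?\<Phi>")
  unfolding weak_whitney_def[of A 1]
proof (rule continuous_on_generated_topo)
  fix U :: "('a \<Rightarrow> real^'k) set"
  assume "U \<in> {whitney_nbhd A 1 f c K n e | f c K n e.
    f \<in> C_space A 1 \<and> c \<in> A \<and> compact K \<and> K \<subseteq> fst c \<and> enat n \<le> 1 \<and> 0 < e}"
  then obtain f c K n e where U: "U = whitney_nbhd A 1 f c K n e"
    and f: "f \<in> C_space A 1" and c: "c \<in> A" and K: "compact K" "K \<subseteq> fst c" and n: "enat n \<le> 1" and "0 < e"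
    by blast
  define D where "D vs f = iter_deriv vs (f \<circ> chart_inv c)" for vs and f :: "'a \<Rightarrow> real^'k"
  define VS where "VS = {vs :: (real^'m) list. set vs \<subseteq> Basis \<and> length vs \<le> n}"
  have nbhdD: "norm (D vs h x - D vs f x) < d"
    if "h \<in> whitney_nbhd A r f c K n d" "vs \<in> VS" "x \<in> snd c ` K" for h f vs x d r
    using that unfolding whitney_nbhd_def VS_def D_def by blast
  have comp: "compact (snd c ` K)"
    using continuous_on_subset[OF chart_continuous[OF c] K(2)] K(1) by (rule compact_continuous_image)
  show "openin ?P (?\<Phi> -` U \<inter> topspace ?P)"
  proof (subst openin_subopen, intro ballI)
    fix z assume z: "z \<in> ?\<Phi> -` U \<inter> topspace ?P"
    obtain h0 y0 where z0: "z = (h0, y0)" by fastforce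
    let ?h = "\<lambda>p. h0 p + y0"
    have h0: "h0 \<in> C_space A r" and hU: "?h \<in> U"
      using z z0 by (auto simp: topspace_weak_whitney)
    have h1: "?h \<in> C_space A 1" using hU U by (simp add: whitney_nbhd_def)
    have "\<exists>s<e. \<forall>x\<in>snd c ` K. norm (D vs ?h x - D vs f x) \<le> s" if vs: "vs \<in> VS" for vs
    proof -
      have l: "enat (length vs) \<le> 1" using vs n by (auto simp: VS_def intro: order_trans[of _ "enat n"])
      have "continuous_on (snd c ` K) (D vs g)" if "g \<in> C_space A 1" for g :: "'a \<Rightarrow> real^'k"
        unfolding D_def using vs K(2)
        by (intro continuous_on_subset[OF C_space_iter_deriv_continuous[OF that c _ l]]) (auto simp: VS_def)
      then have "continuous_on (snd c ` K) (\<lambda>x. norm (D vs ?h x - D vs f x))"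
        using h1 f by (intro continuous_intros)
      moreover have "norm (D vs ?h x - D vs f x) < e" if "x \<in> snd c ` K" for x
        using nbhdD[OF hU[unfolded U] vs that] .
      ultimately obtain s where "s < e" "\<And>x. x \<in> snd c ` K \<Longrightarrow> norm (D vs ?h x - D vs f x) \<le> s"
        using compact_strict_upper_bound[OF comp] by blast
      then show ?thesis by blast
    qed
    then have "\<forall>vs\<in>VS. \<exists>s<e. \<forall>x\<in>snd c ` K. norm (D vs ?h x - D vs f x) \<le> s" by blast
    from bchoice[OF this] obtain s where s: "\<And>vs. vs \<in> VS \<Longrightarrow> s vs < e"
      "\<And>vs x. vs \<in> VS \<Longrightarrow> x \<in> snd c ` K \<Longrightarrow> norm (D vs ?h x - D vs f x) \<le> s vs" by blast
    define S where "S = Max (s ` VS)"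
    have fin: "finite VS" using finite_lists_length_le[of "Basis :: (real^'m) set" n] by (simp add: VS_def)
    have ne: "[] \<in> VS" by (simp add: VS_def)
    have S: "S < e" "\<And>vs. vs \<in> VS \<Longrightarrow> s vs \<le> S"
    proof -
      have "S \<in> s ` VS" unfolding S_def using fin ne by (intro Max_in) auto
      then show "S < e" using s(1) by blast
    qed (use fin in \<open>simp add: S_def\<close>)
    \<comment> \<open>\<open>S\<close> bounds the deviations already present, over finitely many
      lists of directions; half of the margin \<open>e - S\<close> goes to the function and half to
      the constant.\<close>
    define e' where "e' = (e - S) / 2"
    have e': "e' > 0" "S + e' + e' = e" using S(1) by (simp_all add: e'_def field_simps)
    let ?W = "whitney_nbhd A r h0 c K n e' \<times> ball y0 e'"
    have "enat n \<le> r" using n assms by (rule order_trans)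
    then have "openin ?P ?W"
      using openin_whitney_nbhd[OF h0 c K _ e'(1), of n] by (simp add: openin_prod_Times_iff)
    moreover have "z \<in> ?W" using self_in_whitney_nbhd[OF h0 e'(1)] e'(1) by (simp add: z0)
    moreover have "?W \<subseteq> ?\<Phi> -` U \<inter> topspace ?P"
    proof
      fix w assume "w \<in> ?W"
      then obtain h y where w: "w = (h, y)" and h: "h \<in> whitney_nbhd A r h0 c K n e'" and y: "dist y0 y < e'"
        by auto
      have hr: "h \<in> C_space A r" using h by (simp add: whitney_nbhd_def)
      then have "(\<lambda>p. h p + y) \<in> C_space A 1" using C_space_add_const C_space_mono[OF assms] by blast
      moreover have "norm (D vs (\<lambda>p. h p + y) x - D vs f x) < e" if vs: "vs \<in> VS" and x: "x \<in> snd c ` K" for vs x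
      proof -
        have o: "(\<lambda>p. h p + y) \<circ> chart_inv c = (\<lambda>x. (h \<circ> chart_inv c) x + y)" for h :: "'a \<Rightarrow> real^'k" and y by auto
        have "norm (D vs (\<lambda>p. h p + y) x - D vs ?h x) \<le> norm (D vs h x - D vs h0 x) + norm (y - y0)"
          using norm_triangle_ineq[of "h (chart_inv c x) - h0 (chart_inv c x)" "y - y0"]
          unfolding D_def o iter_deriv_add_const by (auto simp: algebra_simps o_def)
        moreover have "norm (D vs h x - D vs h0 x) < e'"
          using nbhdD[OF h vs x] .
        moreover have "norm (y - y0) < e'" using y by (simp add: dist_norm norm_minus_commute)
        moreover have "norm (D vs ?h x - D vs f x) \<le> S"
          using s(2)[OF vs x] S(2)[OF vs] by (rule order_trans)
        ultimately show ?thesis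
          using norm_triangle_ineq[of "D vs (\<lambda>p. h p + y) x - D vs ?h x" "D vs ?h x - D vs f x"] e'(2)
          by simp
      qed
      ultimately have "(\<lambda>p. h p + y) \<in> U"
        unfolding U whitney_nbhd_def D_def VS_def by blast
      then show "w \<in> ?\<Phi> -` U \<inter> topspace ?P" using hr by (simp add: w topspace_weak_whitney)
    qed
    ultimately show "\<exists>T. openin ?P T \<and> z \<in> T \<and> T \<subseteq> ?\<Phi> -` U \<inter> topspace ?P" by blast
  qed
next
  have "?\<Phi> ` topspace ?P \<subseteq> topspace (weak_whitney A 1)"
    using C_space_add_const C_space_mono[OF assms] by (auto simp: topspace_weak_whitney)
  then show "?\<Phi> ` topspace ?P \<subseteq> \<Union>{whitney_nbhd A 1 f c K n e | f c K n e.
    f \<in> C_space A 1 \<and> c \<in> A \<and> compact K \<and> K \<subseteq> fst c \<and> enat n \<le> 1 \<and> 0 < e}"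
    unfolding weak_whitney_def topology_generated_by_topspace .
qed

lemma continuous_map_iter_deriv:
  assumes "c \<in> A" "p \<in> fst c" "set vs \<subseteq> Basis" "enat (length vs) \<le> r"
  shows "continuous_map (weak_whitney A r) euclidean
    (\<lambda>f :: 'a \<Rightarrow> real^'k::finite. iter_deriv vs (f \<circ> chart_inv c) (snd c p))" (is "continuous_map ?T _ ?\<phi>")
  unfolding continuous_map_def
proof (intro conjI allI impI)
  fix U :: "(real^'k) set" assume "openin euclidean U"
  then have U: "open U" by simp
  show "openin ?T {f \<in> topspace ?T. ?\<phi> f \<in> U}"
  proof (subst openin_subopen, intro ballI)
    fix f assume f: "f \<in> {f \<in> topspace ?T. ?\<phi> f \<in> U}"
    then obtain e where e: "e > 0" "ball (?\<phi> f) e \<subseteq> U"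
      using U open_contains_ball by blast
    let ?N = "whitney_nbhd A r f c {p} (length vs) e"
    have "f \<in> C_space A r" using f by (simp add: topspace_weak_whitney)
    then have "openin ?T ?N" "f \<in> ?N"
      using assms e(1) by (auto intro!: openin_whitney_nbhd self_in_whitney_nbhd)
    moreover have "?N \<subseteq> {f \<in> topspace ?T. ?\<phi> f \<in> U}"
    proof
      fix h assume h: "h \<in> ?N"
      then have "norm (?\<phi> h - ?\<phi> f) < e" using assms(3) by (auto simp: whitney_nbhd_def)
      then have "?\<phi> h \<in> U" using e(2) by (auto simp: dist_norm norm_minus_commute)
      then show "h \<in> {f \<in> topspace ?T. ?\<phi> f \<in> U}"
        using h by (simp add: topspace_weak_whitney whitney_nbhd_def)
    qed
    ultimately show "\<exists>T. openin ?T T \<and> f \<in> T \<and> T \<subseteq> {f \<in> topspace ?T. ?\<phi> f \<in> U}" by blast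
  qed
qed simp

lemma continuous_map_eval:
  "continuous_map (weak_whitney A r) euclidean (\<lambda>f :: 'a \<Rightarrow> real^'k::finite. f p)"
proof -
  obtain c where c: "c \<in> A" "p \<in> fst c" using chart_around by metis
  then show ?thesis
    using continuous_map_iter_deriv[OF c, of "[]" r] by (simp add: chart_inv_chart zero_enat_def[symmetric])
qed

lemma measurable_add_const:
  assumes "1 \<le> r" "Z \<in> measurable M (borel_of (weak_whitney A r))" "y \<in> borel_measurable M"
  shows "(\<lambda>w p. Z w p + y w :: real^'k::finite) \<in> measurable M (borel_of (weak_whitney A 1))"
  using continuous_map_add_const[OF assms(1)] assms(2,3)
  by (rule measurable_continuous_pair[where F = "\<lambda>f y p. f p + y"])

end

section \<open>The Jacobian $J_p$\<close>

lemma invertible_pos_def: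
  fixes A :: "real^'n^'n"
  assumes "\<And>v. v \<noteq> 0 \<Longrightarrow> v \<bullet> (A *v v) > 0"
  shows "invertible A"
proof -
  have "x = 0" if "A *v x = 0" for x
    using assms[of x] that by (cases "x = 0") auto
  then show ?thesis
    by (simp add: invertible_left_inverse matrix_left_invertible_ker)
qed

lemma matrix_inv_mult_vec:
  fixes A :: "real^'n^'n"
  assumes "invertible A"
  shows "A *v (matrix_inv A *v x) = x" "matrix_inv A *v (A *v x) = x"
proof -
  have "A ** matrix_inv A = mat 1 \<and> matrix_inv A ** A = mat 1"
    using assms unfolding invertible_def matrix_inv_def by (rule someI_ex)
  then show "A *v (matrix_inv A *v x) = x" "matrix_inv A *v (A *v x) = x"
    by (simp_all add: matrix_vector_mul_assoc)
qed

lemma continuous_on_det: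
  fixes A :: "'x::topological_space \<Rightarrow> real^'n^'n"
  assumes "\<And>i j. continuous_on S (\<lambda>x. A x $ i $ j)"
  shows "continuous_on S (\<lambda>x. det (A x))"
  unfolding det_def by (intro continuous_intros assms)

text \<open>Cramer's rule expresses the solution by determinants, which are polynomials in the
  entries.\<close>

lemma continuous_on_matrix_inv_mult:
  fixes A :: "'x::topological_space \<Rightarrow> real^'n^'n"
  assumes "\<And>i j. continuous_on S (\<lambda>x. A x $ i $ j)" "\<And>i. continuous_on S (\<lambda>x. b x $ i)"
    and inv: "\<And>x. x \<in> S \<Longrightarrow> invertible (A x)"
  shows "continuous_on S (\<lambda>x. (matrix_inv (A x) *v b x) $ k)"
proof -
  have "(matrix_inv (A x) *v b x) $ k = det (\<chi> i j. if j = k then b x $ i else A x $ i $ j) / det (A x)"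
    if "x \<in> S" for x
  proof -
    have "det (A x) \<noteq> 0" using inv[OF that] by (simp add: invertible_det_nz)
    from iffD1[OF cramer[OF this] matrix_inv_mult_vec(1)[OF inv[OF that]]] show ?thesis
      by (rule ssubst) simp
  qed
  moreover have "continuous_on S (\<lambda>x. if j = k then b x $ i else A x $ i $ j)" for i j
    by (cases "j = k") (simp_all add: assms)
  then have "continuous_on S (\<lambda>x. det (\<chi> i j. if j = k then b x $ i else A x $ i $ j) / det (A x))"
    using inv by (intro continuous_on_divide continuous_on_det) (simp_all add: assms invertible_det_nz)
  ultimately show ?thesis by (simp cong: continuous_on_cong)
qed

lemma det_psd_nonneg:
  fixes S :: "real^'n^'n"
  assumes "\<And>x. 0 \<le> x \<bullet> (S *v x)"
  shows "0 \<le> det S"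
proof (rule ccontr)
  assume neg: "\<not> 0 \<le> det S"
  \<comment> \<open>The matrices on the segment from the identity to \<open>S\<close> are invertible, except perhaps \<open>S\<close>.\<close>
  let ?N = "\<lambda>t :: real. (1 - t) *\<^sub>R mat 1 + t *\<^sub>R S"
  have "continuous_on {0..1} (\<lambda>t. det (?N t))"
    by (intro continuous_on_det) (auto intro!: continuous_intros)
  moreover have "det (?N 0) = 1" "det (?N 1) < 0" using neg by (simp_all add: scaleR_left.zero)
  ultimately obtain t where t: "0 \<le> t" "t \<le> 1" "det (?N t) = 0"
    using IVT2'[of "\<lambda>t. det (?N t)" 1 0 0] by auto
  then have "t \<noteq> 1" using \<open>det (?N 1) < 0\<close> by auto
  have "invertible (?N t)"
  proof (rule invertible_pos_def)
    fix v :: "real^'n" assume "v \<noteq> 0"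
    have "v \<bullet> (?N t *v v) = (1 - t) * (v \<bullet> v) + t * (v \<bullet> (S *v v))"
      by (simp add: matrix_vector_mult_add_rdistrib scaleR_matrix_vector_assoc[symmetric] inner_add_right)
    moreover have "(1 - t) * (v \<bullet> v) > 0" using \<open>v \<noteq> 0\<close> \<open>t \<noteq> 1\<close> t by simp
    moreover have "t * (v \<bullet> (S *v v)) \<ge> 0" using assms t by simp
    ultimately show "v \<bullet> (?N t *v v) > 0" by linarith
  qed
  then show False using t(3) by (simp add: invertible_det_nz)
qed

section \<open>Change of chart\<close>

context smooth_manifold
begin

lemma C_space_differentiable:
  assumes "f \<in> C_space A r" "1 \<le> r" "c \<in> A" "p \<in> fst c"
  shows "(f \<circ> chart_inv c) differentiable at (snd c p)"
proof -
  have "enat (length []) < r" using assms(2) by (cases r) (auto simp: one_enat_def)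
  then show ?thesis
    using assms unfolding C_space_def C_on_def by (auto dest!: bspec[of A _ c] spec[of _ "[]"])
qed

lemma C_space_continuous:
  assumes "f \<in> C_space A r"
  shows "continuous_on UNIV f"
proof -
  have "continuous_on (fst c) f" if c: "c \<in> A" for c
  proof -
    have "continuous_on (snd c ` fst c) (f \<circ> chart_inv c)"
      using C_space_iter_deriv_continuous[OF assms c, of "[]"] by (simp add: zero_enat_def[symmetric])
    then have "continuous_on (fst c) (\<lambda>p. (f \<circ> chart_inv c) (snd c p))"
      by (rule continuous_on_compose2) (auto intro: chart_continuous[OF c])
    then show ?thesis by (simp add: chart_inv_chart[OF c] cong: continuous_on_cong)
  qed
  then have "continuous_on (\<Union>c\<in>A. fst c) f"
    by (intro continuous_on_open_UN chart_open)
  then show ?thesis using atlas by (simp add: smooth_atlas_def)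
qed

definition transition_deriv :: "('a, 'm) chart \<Rightarrow> ('a, 'm) chart \<Rightarrow> 'a \<Rightarrow> real^'m \<Rightarrow> real^'m" where
  "transition_deriv c d p = frechet_derivative (snd d \<circ> chart_inv c) (at (snd c p))"

lemma open_chart_overlap:
  assumes "c \<in> A" "d \<in> A"
  shows "open (snd c ` (fst c \<inter> fst d))"
proof -
  have "snd c ` (fst c \<inter> fst d) = snd c ` fst c \<inter> chart_inv c -` fst d"
    using chart_inv_chart[OF assms(1)] chart_chart_inv[OF assms(1)] by force
  then show ?thesis
    using continuous_open_preimage[OF chart_inv_continuous chart_image_open chart_open] assms by simp
qed

lemma transition_has_derivative:
  assumes "c \<in> A" "d \<in> A" "p \<in> fst c" "p \<in> fst d"
  shows "((snd d \<circ> chart_inv c) has_derivative transition_deriv c d p) (at (snd c p))"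
proof -
  have "C_on \<infinity> (snd d \<circ> chart_inv c) (snd c ` (fst c \<inter> fst d))"
    using atlas assms(1,2) by (simp add: smooth_atlas_def)
  then have "(snd d \<circ> chart_inv c) differentiable at (snd c p)"
    using assms(3,4) unfolding C_on_def by (auto dest!: spec[of _ "[]"])
  then show ?thesis by (simp add: transition_deriv_def frechet_derivative_works[symmetric])
qed

lemma chart_deriv_change:
  fixes f :: "'a \<Rightarrow> 'b::real_normed_vector"
  assumes "c \<in> A" "d \<in> A" "p \<in> fst c" "p \<in> fst d"
    and f: "(f \<circ> chart_inv d) differentiable at (snd d p)"
  shows "chart_deriv c f p = (\<lambda>h. chart_deriv d f p (transition_deriv c d p h))"
proof -
  have p: "(snd d \<circ> chart_inv c) (snd c p) = snd d p" by (simp add: chart_inv_chart[OF assms(1,3)])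
  have "((f \<circ> chart_inv d) has_derivative chart_deriv d f p) (at ((snd d \<circ> chart_inv c) (snd c p)))"
    using f unfolding p chart_deriv_def by (simp add: frechet_derivative_works[symmetric])
  from has_derivative_compose[OF transition_has_derivative[OF assms(1-4)] this]
  have "((f \<circ> chart_inv c) has_derivative (\<lambda>h. chart_deriv d f p (transition_deriv c d p h))) (at (snd c p))"
    by (rule has_derivative_transform_within_open[OF _ open_chart_overlap[OF assms(1,2)]])
      (use assms(3,4) in \<open>auto simp: chart_inv_chart[OF assms(1)] chart_inv_chart[OF assms(2)]\<close>)
  then show ?thesis unfolding chart_deriv_def by (rule frechet_derivative_at[symmetric])
qed

lemma differential_coords_change:
  assumes "c \<in> A" "d \<in> A" "p \<in> fst c" "p \<in> fst d"
    and f: "(f \<circ> chart_inv d) differentiable at (snd d p)"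
  shows "differential_coords c f p =
    transpose (matrix (transition_deriv c d p)) *v differential_coords d f p"
proof -
  have "linear (chart_deriv d f p)"
    using f unfolding chart_deriv_def frechet_derivative_works by (rule has_derivative_linear)
  then have "chart_deriv c f p (axis i 1) =
      (\<Sum>k\<in>UNIV. transition_deriv c d p (axis i 1) $ k * chart_deriv d f p (axis k 1))" for i
    unfolding chart_deriv_change[OF assms] by (rule linear_axis_sum)
  then show ?thesis
    by (simp add: vec_eq_iff differential_coords_def matrix_vector_mult_def transpose_def matrix_def)
qed

lemma C_space_component_differentiable:
  fixes f :: "'a \<Rightarrow> real^'k::finite"
  assumes "f \<in> C_space A r" "1 \<le> r" "c \<in> A" "p \<in> fst c"
  shows "((\<lambda>x. f x $ l) \<circ> chart_inv c) differentiable at (snd c p)"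
  using bounded_linear.has_derivative[OF bounded_linear_vec_nth
      C_space_differentiable[OF assms, unfolded frechet_derivative_works], of l]
  by (auto simp: differentiable_def o_def)

text \<open>Ties the coordinates of the differentials to the derivatives that the Whitney topology
  controls.\<close>

lemma differential_coords_iter_deriv:
  fixes f :: "'a \<Rightarrow> real^'k::finite"
  assumes "f \<in> C_space A r" "1 \<le> r" "c \<in> A" "p \<in> fst c"
  shows "differential_coords c (\<lambda>x. f x $ l) p $ i =
    iter_deriv [axis i 1] (f \<circ> chart_inv c) (snd c p) $ l"
  using frechet_derivative_component[OF C_space_differentiable[OF assms], of l]
  by (simp add: differential_coords_def chart_deriv_def o_def)

lemma continuous_on_differential_coords:
  fixes f :: "'a \<Rightarrow> real^'k::finite"
  assumes "f \<in> C_space A r" "1 \<le> r" "c \<in> A"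
  shows "continuous_on (fst c) (\<lambda>p. differential_coords c (\<lambda>x. f x $ l) p $ i)"
proof -
  have "continuous_on (snd c ` fst c) (iter_deriv [axis i 1] (f \<circ> chart_inv c))"
    using assms by (intro C_space_iter_deriv_continuous) (auto simp: axis_in_Basis_iff one_enat_def)
  then have "continuous_on (fst c) (\<lambda>p. iter_deriv [axis i 1] (f \<circ> chart_inv c) (snd c p))"
    by (rule continuous_on_compose2) (auto intro: chart_continuous[OF assms(3)])
  then have "continuous_on (fst c) (\<lambda>p. iter_deriv [axis i 1] (f \<circ> chart_inv c) (snd c p) $ l)"
    by (rule continuous_on_component)
  then show ?thesis
    using differential_coords_iter_deriv[OF assms] by (subst continuous_on_cong[OF refl]) auto
qed

end

section \<open>The metric on covectors and the Gram determinant\<close>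

locale riemannian_manifold = smooth_manifold A
  for A :: "('a::{t2_space, second_countable_topology}, 'm::finite) chart set" +
  fixes g :: "('a, 'm) chart \<Rightarrow> 'a \<Rightarrow> real^'m^'m"
  assumes metric: "riemannian_metric A g"
begin

lemma metric_pos: "c \<in> A \<Longrightarrow> p \<in> fst c \<Longrightarrow> v \<noteq> 0 \<Longrightarrow> v \<bullet> (g c p *v v) > 0"
  using metric by (simp add: riemannian_metric_def)

lemma metric_invertible: "c \<in> A \<Longrightarrow> p \<in> fst c \<Longrightarrow> invertible (g c p)"
  by (intro invertible_pos_def metric_pos)

lemma metric_change:
  "c \<in> A \<Longrightarrow> d \<in> A \<Longrightarrow> p \<in> fst c \<Longrightarrow> p \<in> fst d \<Longrightarrow>
    g c p = transpose (matrix (transition_deriv c d p)) ** g d p ** matrix (transition_deriv c d p)"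
  using metric unfolding riemannian_metric_def transition_deriv_def Let_def by blast

lemma continuous_on_metric:
  assumes "c \<in> A"
  shows "continuous_on (fst c) (\<lambda>p. g c p $ i $ j)"
proof -
  have "C_on \<infinity> (g c \<circ> chart_inv c) (snd c ` fst c)"
    using metric assms by (simp add: riemannian_metric_def)
  then have "continuous_on (snd c ` fst c) (g c \<circ> chart_inv c)"
    unfolding C_on_def by (auto dest!: spec[of _ "[]"])
  then have "continuous_on (fst c) (\<lambda>p. (g c \<circ> chart_inv c) (snd c p))"
    by (rule continuous_on_compose2) (auto intro: chart_continuous[OF assms])
  then have "continuous_on (fst c) (g c)"
    by (simp add: chart_inv_chart[OF assms] cong: continuous_on_cong)
  then show ?thesis by (intro continuous_on_component)
qed

text \<open>The inverse of the metric transforms oppositely to the covectors, so the two changes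
  cancel: the vector dual to \<open>transpose M *v \<beta>\<close> in the chart \<open>c\<close> is
  the pullback \<open>x\<close> of the one dual to \<open>\<beta>\<close> in
  \<open>d\<close>.\<close>

lemma cotangent_inner_change:
  assumes "c \<in> A" "d \<in> A" "p \<in> fst c" "p \<in> fst d"
  defines "M \<equiv> matrix (transition_deriv c d p)"
  shows "cotangent_inner g c p (transpose M *v \<alpha>) (transpose M *v \<beta>) = cotangent_inner g d p \<alpha> \<beta>"
proof -
  have G: "g c p *v x = transpose M *v (g d p *v (M *v x))" for x
    using metric_change[OF assms(1-4)] by (simp add: M_def matrix_vector_mul_assoc matrix_mul_assoc)
  \<comment> \<open>Injectivity of \<open>M\<close> is read off from the positivity of the metric in
    the chart \<open>c\<close>.\<close>
  have "x = 0" if "M *v x = 0" for x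
    using G[of x] that metric_pos[OF assms(1,3), of x] by (cases "x = 0") auto
  then have M: "invertible M" by (simp add: invertible_left_inverse matrix_left_invertible_ker)
  define x where "x = matrix_inv M *v (matrix_inv (g d p) *v \<beta>)"
  have Mx: "M *v x = matrix_inv (g d p) *v \<beta>"
    by (simp add: x_def matrix_inv_mult_vec[OF M])
  then have "g c p *v x = transpose M *v \<beta>"
    by (simp add: G matrix_inv_mult_vec[OF metric_invertible[OF assms(2,4)]])
  then have "matrix_inv (g c p) *v (transpose M *v \<beta>) = x"
    using matrix_inv_mult_vec(2)[OF metric_invertible[OF assms(1,3)]] by metis
  then have "cotangent_inner g c p (transpose M *v \<alpha>) (transpose M *v \<beta>) = \<alpha> \<bullet> (M *v x)"
    by (simp add: cotangent_inner_def dot_lmul_matrix[symmetric])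
  then show ?thesis by (simp add: Mx cotangent_inner_def)
qed

definition gram :: "('a, 'm) chart \<Rightarrow> 'a \<Rightarrow> ('a \<Rightarrow> real^'k) \<Rightarrow> real^'k^'k::finite" where
  "gram c p f = (\<chi> i j. cotangent_inner g c p
     (differential_coords c (\<lambda>x. f x $ i) p) (differential_coords c (\<lambda>x. f x $ j) p))"

lemma gram_change:
  assumes "c \<in> A" "d \<in> A" "p \<in> fst c" "p \<in> fst d" and "f \<in> C_space A r" "1 \<le> r"
  shows "gram c p f = gram d p f"
  unfolding gram_def
    differential_coords_change[OF assms(1-4) C_space_component_differentiable[OF assms(5,6,2,4)]]
    cotangent_inner_change[OF assms(1-4)] ..

text \<open>Replaces the chart chosen by \<open>SOME\<close> by any other, in particular by one
  chart for all points near a given one, as continuity in \<open>p\<close> requires.\<close>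

lemma jac_chart:
  assumes "c \<in> A" "p \<in> fst c" "f \<in> C_space A r" "1 \<le> r"
  shows "jac A g p f = sqrt (det (gram c p f))"
proof -
  have "(SOME c. c \<in> A \<and> p \<in> fst c) \<in> A \<and> p \<in> fst (SOME c. c \<in> A \<and> p \<in> fst c)"
    using assms(1,2) by (intro someI[of "\<lambda>c. c \<in> A \<and> p \<in> fst c" c]) simp
  then show ?thesis
    using gram_change[of "SOME c. c \<in> A \<and> p \<in> fst c" c p f r] assms
    by (simp add: jac_def gram_def)
qed

text \<open>The quadratic form is the squared dual norm of the combination \<open>a\<close> of the
  differentials. Passing to the vector \<open>b\<close> dual to \<open>a\<close> reduces its sign to
  the positivity of the metric itself.\<close>

lemma gram_psd:
  assumes "c \<in> A" "p \<in> fst c"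
  shows "0 \<le> x \<bullet> (gram c p f *v x)"
proof -
  let ?\<alpha> = "\<lambda>i. differential_coords c (\<lambda>x. f x $ i) p"
  define a where "a = (\<Sum>i\<in>UNIV. x $ i *\<^sub>R ?\<alpha> i)"
  define b where "b = matrix_inv (g c p) *v a"
  have b: "b = (\<Sum>j\<in>UNIV. x $ j *\<^sub>R (matrix_inv (g c p) *v ?\<alpha> j))"
    unfolding b_def a_def by (simp add: linear_sum[OF matrix_vector_mul_linear] matrix_vector_mult_scaleR)
  have "x \<bullet> (gram c p f *v x) = (\<Sum>i\<in>UNIV. \<Sum>j\<in>UNIV. x $ i * (x $ j * (?\<alpha> i \<bullet> (matrix_inv (g c p) *v ?\<alpha> j))))"
    by (simp add: inner_vec_def matrix_vector_mult_def gram_def cotangent_inner_def sum_distrib_left mult.commute)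
  also have "\<dots> = a \<bullet> b"
    unfolding b by (subst sum.swap)
      (simp add: a_def inner_sum_left inner_sum_right sum_distrib_left mult.left_commute)
  also have "\<dots> = b \<bullet> (g c p *v b)"
    using matrix_inv_mult_vec(1)[OF metric_invertible[OF assms]] by (simp add: b_def inner_commute)
  also have "\<dots> \<ge> 0" using metric_pos[OF assms, of b] by (cases "b = 0") auto
  finally show ?thesis .
qed

text \<open>\<open>sqrt\<close> is negative at negative reals, so the sign of the Gram determinant
  matters.\<close>

lemma jac_nonneg:
  assumes "f \<in> C_space A r" "1 \<le> r"
  shows "0 \<le> jac A g p f"
proof -
  obtain c where c: "c \<in> A" "p \<in> fst c" using chart_around by metis
  then show ?thesis
    using det_psd_nonneg[OF gram_psd[OF c]] by (simp add: jac_chart[OF c assms])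
qed

lemma jac_add_const: "jac A g p (\<lambda>q. f q + y) = jac A g p f"
proof -
  have *: "differential_coords c (\<lambda>x. (f x + y) $ i) p = differential_coords c (\<lambda>x. f x $ i) p" for c i
  proof -
    have "(\<lambda>x. (f x + y) $ i) \<circ> chart_inv c = (\<lambda>x. ((\<lambda>x. f x $ i) \<circ> chart_inv c) x + y $ i)" by auto
    then show ?thesis unfolding differential_coords_def chart_deriv_def by (simp only: frechet_derivative_add_const)
  qed
  show ?thesis unfolding jac_def * ..
qed

lemma continuous_on_jac:
  assumes "f \<in> C_space A r" "1 \<le> r"
  shows "continuous_on UNIV (\<lambda>p. jac A g p f)"
proof -
  have "continuous_on (fst c) (\<lambda>p. jac A g p f)" if c: "c \<in> A" for c
  proof -
    have "gram c p f $ i $ j = (\<Sum>l\<in>UNIV. differential_coords c (\<lambda>x. f x $ i) p $ l *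
        (matrix_inv (g c p) *v differential_coords c (\<lambda>x. f x $ j) p) $ l)" for p i j
      by (simp add: gram_def cotangent_inner_def inner_vec_def)
    then have "continuous_on (fst c) (\<lambda>p. gram c p f $ i $ j)" for i j
      by (simp only:) (intro continuous_on_sum continuous_on_mult continuous_on_matrix_inv_mult
        continuous_on_metric[OF c] continuous_on_differential_coords[OF assms c] metric_invertible[OF c])
    then have "continuous_on (fst c) (\<lambda>p. sqrt (det (gram c p f)))"
      by (intro continuous_on_real_sqrt continuous_on_det)
    then show ?thesis
      using jac_chart[OF c _ assms] by (subst continuous_on_cong[OF refl]) auto
  qed
  then have "continuous_on (\<Union>c\<in>A. fst c) (\<lambda>p. jac A g p f)"
    by (intro continuous_on_open_UN chart_open)
  then show ?thesis using atlas by (simp add: smooth_atlas_def)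
qed

text \<open>In one chart the Jacobian is the root of a polynomial in finitely many first derivatives
  at \<open>p\<close>, each of which is a continuous functional of \<open>f\<close>.\<close>

lemma jac_measurable:
  assumes "1 \<le> r"
  shows "(\<lambda>f :: 'a \<Rightarrow> real^'k::finite. jac A g p f) \<in> borel_measurable (borel_of (weak_whitney A r))"
proof -
  obtain c where c: "c \<in> A" "p \<in> fst c" using chart_around by metis
  have m: "(\<lambda>f :: 'a \<Rightarrow> real^'k. iter_deriv [axis i 1] (f \<circ> chart_inv c) (snd c p) $ l)
      \<in> borel_measurable (borel_of (weak_whitney A r))" for i l
  proof -
    have "(\<lambda>f :: 'a \<Rightarrow> real^'k. iter_deriv [axis i 1] (f \<circ> chart_inv c) (snd c p))
        \<in> borel_measurable (borel_of (weak_whitney A r))"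
      using assms
      by (intro continuous_map_measurable continuous_map_iter_deriv c) (auto simp: axis_in_Basis_iff one_enat_def)
    then show ?thesis
      by (rule measurable_compose)
        (intro borel_measurable_continuous_onI continuous_on_component continuous_on_id)
  qed
  have dc: "(\<lambda>f :: 'a \<Rightarrow> real^'k. differential_coords c (\<lambda>x. f x $ l) p $ i)
      \<in> borel_measurable (borel_of (weak_whitney A r))" for i l
    using m[of i l] differential_coords_iter_deriv[OF _ assms c]
    by (subst measurable_cong) (auto simp: topspace_weak_whitney)
  have "gram c p f $ i $ j = (\<Sum>l\<in>UNIV. differential_coords c (\<lambda>x. f x $ i) p $ l *
      (\<Sum>n\<in>UNIV. matrix_inv (g c p) $ l $ n * differential_coords c (\<lambda>x. f x $ j) p $ n))"
    for f :: "'a \<Rightarrow> real^'k" and i j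
    by (simp add: gram_def cotangent_inner_def inner_vec_def matrix_vector_mult_def)
  then have "(\<lambda>f :: 'a \<Rightarrow> real^'k. gram c p f $ i $ j) \<in> borel_measurable (borel_of (weak_whitney A r))" for i j
    by (simp only:) (intro borel_measurable_sum borel_measurable_times borel_measurable_const dc)
  then have "(\<lambda>f :: 'a \<Rightarrow> real^'k. det (gram c p f)) \<in> borel_measurable (borel_of (weak_whitney A r))"
    unfolding det_def
    by (intro borel_measurable_sum borel_measurable_times borel_measurable_prod borel_measurable_const)
  then have "(\<lambda>f :: 'a \<Rightarrow> real^'k. sqrt (det (gram c p f))) \<in> borel_measurable (borel_of (weak_whitney A r))"
    by measurable
  then show ?thesis
    using jac_chart[OF c _ assms] by (subst measurable_cong) (auto simp: topspace_weak_whitney)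
qed

end

section \<open>Convergence of integrals and joint laws\<close>

text \<open>Split \<open>H n * J n\<close> into \<open>H n * (J n - j)\<close> and
  \<open>H n * j\<close>. No common integrable bound for the \<open>J n\<close> is at hand, so the
  first term rests on their convergence in mean; the second converges by domination with
  \<open>C * j\<close>.\<close>

lemma integral_tendsto_bounded_mult:
  fixes H J :: "nat \<Rightarrow> 'w \<Rightarrow> real" and h j :: "'w \<Rightarrow> real"
  assumes H: "\<And>n. H n \<in> borel_measurable M" "\<And>n w. w \<in> space M \<Longrightarrow> \<bar>H n w\<bar> \<le> C"
      "\<And>w. w \<in> space M \<Longrightarrow> (\<lambda>n. H n w) \<longlonglongrightarrow> h w"
    and J: "\<And>n. integrable M (J n)" "integrable M j" "\<And>n w. w \<in> space M \<Longrightarrow> 0 \<le> J n w"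
      "\<And>w. w \<in> space M \<Longrightarrow> (\<lambda>n. J n w) \<longlonglongrightarrow> j w"
      "(\<lambda>n. \<integral>w. J n w \<partial>M) \<longlonglongrightarrow> (\<integral>w. j w \<partial>M)"
  shows "(\<lambda>n. \<integral>w. H n w * J n w \<partial>M) \<longlonglongrightarrow> (\<integral>w. h w * j w \<partial>M)"
proof -
  have h: "h \<in> borel_measurable M"
    using H(1,3) by (rule borel_measurable_LIMSEQ_metric)
  have j0: "0 \<le> j w" if "w \<in> space M" for w
    using J(3,4) that by (intro LIMSEQ_le_const[of "\<lambda>n. J n w"]) auto
  have "(\<lambda>n. \<integral>\<^sup>+w. norm (J n w) \<partial>M) = (\<lambda>n. ennreal (\<integral>w. J n w \<partial>M))"
    using J(1,3) by (intro ext trans[OF nn_integral_cong nn_integral_eq_integral]) auto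
  moreover have "(\<integral>\<^sup>+w. norm (j w) \<partial>M) = ennreal (\<integral>w. j w \<partial>M)"
    using J(2) j0 by (intro trans[OF nn_integral_cong nn_integral_eq_integral]) auto
  moreover have "(\<lambda>n. ennreal (\<integral>w. J n w \<partial>M)) \<longlonglongrightarrow> ennreal (\<integral>w. j w \<partial>M)"
    using J(5) by (rule tendsto_ennrealI)
  ultimately have "limsup (\<lambda>n. \<integral>\<^sup>+w. norm (J n w) \<partial>M) \<le> (\<integral>\<^sup>+w. norm (j w) \<partial>M)"
    by (simp add: lim_imp_Limsup)
  then have "(\<lambda>n. \<integral>\<^sup>+w. norm (J n w - j w) \<partial>M) \<longlonglongrightarrow> 0"
    using J by (intro Scheffe_lemma1) auto
  moreover have "(\<integral>\<^sup>+w. norm (J n w - j w) \<partial>M) = ennreal (\<integral>w. \<bar>J n w - j w\<bar> \<partial>M)" for n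
    using J(1,2) by (subst nn_integral_eq_integral) auto
  ultimately have d: "(\<lambda>n. \<integral>w. \<bar>J n w - j w\<bar> \<partial>M) \<longlonglongrightarrow> 0"
    using tendsto_ennreal_iff[of "\<lambda>n. \<integral>w. \<bar>J n w - j w\<bar> \<partial>M" sequentially 0] by simp
  have HJ: "integrable M (\<lambda>w. H n w * f w)" if "integrable M f" for n f
  proof (rule Bochner_Integration.integrable_bound)
    show "integrable M (\<lambda>w. C * f w)" using that by simp
    have "\<bar>H n w * f w\<bar> \<le> \<bar>C * f w\<bar>" if "w \<in> space M" for w
      using H(2)[OF that, of n] by (simp add: abs_mult mult_right_mono)
    then show "AE w in M. norm (H n w * f w) \<le> norm (C * f w)" by (intro AE_I2) simp
  qed (use H(1) that in auto)
  have "(\<lambda>n. \<integral>w. H n w * (J n w - j w) \<partial>M) \<longlonglongrightarrow> 0"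
  proof (rule Lim_null_comparison)
    show "(\<lambda>n. C * (\<integral>w. \<bar>J n w - j w\<bar> \<partial>M)) \<longlonglongrightarrow> 0"
      using tendsto_mult_left[OF d, of C] by simp
    have "norm (\<integral>w. H n w * (J n w - j w) \<partial>M) \<le> (\<integral>w. C * \<bar>J n w - j w\<bar> \<partial>M)" for n
    proof (rule order_trans[OF integral_norm_bound integral_mono])
      show "integrable M (\<lambda>w. norm (H n w * (J n w - j w)))" using J(1,2) by (intro integrable_norm HJ) auto
      show "norm (H n w * (J n w - j w)) \<le> C * \<bar>J n w - j w\<bar>" if "w \<in> space M" for w
        using H(2)[OF that, of n] by (simp add: abs_mult mult_right_mono)
    qed (use J(1,2) in auto)
    then show "\<forall>\<^sub>F n in sequentially. norm (\<integral>w. H n w * (J n w - j w) \<partial>M) \<le> C * (\<integral>w. \<bar>J n w - j w\<bar> \<partial>M)"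
      by simp
  qed
  moreover have "(\<lambda>n. \<integral>w. H n w * j w \<partial>M) \<longlonglongrightarrow> (\<integral>w. h w * j w \<partial>M)"
  proof (rule integral_dominated_convergence)
    show "integrable M (\<lambda>w. C * j w)" using J(2) by simp
    show "AE w in M. (\<lambda>n. H n w * j w) \<longlonglongrightarrow> h w * j w"
      using H(3) by (intro AE_I2 tendsto_mult tendsto_const)
    show "AE w in M. norm (H n w * j w) \<le> C * j w" for n
      using H(2)[of _ n] j0 by (intro AE_I2) (simp add: abs_mult mult_right_mono)
  qed (use h H(1) J(2) in auto)
  ultimately have "(\<lambda>n. (\<integral>w. H n w * (J n w - j w) \<partial>M) + (\<integral>w. H n w * j w \<partial>M)) \<longlonglongrightarrow> 0 + (\<integral>w. h w * j w \<partial>M)"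
    by (rule tendsto_add)
  moreover have "(\<integral>w. H n w * (J n w - j w) \<partial>M) + (\<integral>w. H n w * j w \<partial>M) = (\<integral>w. H n w * J n w \<partial>M)" for n
    using HJ[of "\<lambda>w. J n w - j w" n] HJ[of j n] J(1,2)
    by (subst Bochner_Integration.integral_add[symmetric]) (auto simp: algebra_simps)
  ultimately show ?thesis by simp
qed

lemma nn_integral_lborel_reflect:
  fixes h :: "'b::euclidean_space \<Rightarrow> ennreal"
  assumes "h \<in> borel_measurable borel"
  shows "(\<integral>\<^sup>+y. h y \<partial>lborel) = (\<integral>\<^sup>+x. h (a - x) \<partial>lborel)"
proof -
  have "lborel = density (distr lborel borel (\<lambda>x. a + (-1) *\<^sub>R x)) (\<lambda>_. ennreal (\<bar>-1 :: real\<bar> ^ DIM('b)))"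
    by (rule lborel_affine) simp
  then have "lborel = distr lborel borel (\<lambda>x. a - x)" by (simp add: density_1)
  then have "(\<integral>\<^sup>+y. h y \<partial>lborel) = (\<integral>\<^sup>+y. h y \<partial>(distr lborel borel (\<lambda>x. a - x)))" by simp
  also have "\<dots> = (\<integral>\<^sup>+x. h (a - x) \<partial>lborel)"
    using assms by (intro nn_integral_distr) auto
  finally show ?thesis .
qed

lemma limitin_topology_generated_by:
  assumes "l \<in> \<Union>S" and S: "\<And>U. U \<in> S \<Longrightarrow> l \<in> U \<Longrightarrow> \<forall>\<^sub>F x in F. f x \<in> U"
  shows "limitin (topology_generated_by S) f l F"
  unfolding limitin_def
proof (intro conjI allI impI)
  show "l \<in> topspace (topology_generated_by S)" using assms(1) by simp
  fix U assume "openin (topology_generated_by S) U \<and> l \<in> U"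
  then have "generate_topology_on S U" "l \<in> U" by (auto intro: openin_topology_generated_by)
  then show "\<forall>\<^sub>F x in F. f x \<in> U"
  proof induction
    case (UN K)
    then obtain k where k: "k \<in> K" "l \<in> k" by blast
    from UN.IH[OF this] show ?case
      by (rule eventually_mono) (use k(1) in blast)
  qed (auto intro: S eventually_conj)
qed

text \<open>Independence makes the joint law a product, so \<open>L\<close> can be integrated out
  against its density with \<open>Y\<close> frozen. This serves both the joint law in
  \<open>field_law\<close> and the null events in \<open>AE_regular_value\<close>.\<close>

lemma (in prob_space) nn_integral_indep_density:
  fixes L :: "'a \<Rightarrow> 'c::euclidean_space" and \<rho> :: "'c \<Rightarrow> real"
  assumes indep: "indep_elements M S Y borel L"
    and L: "distributed M lborel L (\<lambda>x. ennreal (\<rho> x))"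
    and \<phi>: "\<phi> \<in> borel_measurable (S \<Otimes>\<^sub>M borel)"
  shows "(\<integral>\<^sup>+w. \<phi> (Y w, L w) \<partial>M) = (\<integral>\<^sup>+w. (\<integral>\<^sup>+y. ennreal (\<rho> y) * \<phi> (Y w, y) \<partial>lborel) \<partial>M)"
proof -
  have Y [measurable]: "Y \<in> measurable M S" and L_m [measurable]: "L \<in> borel_measurable M"
    and ind: "indep_set {Y -` B \<inter> space M | B. B \<in> sets S} {L -` B \<inter> space M | B. B \<in> sets borel}"
    using indep unfolding indep_elements_def by auto
  interpret Y: prob_space "distr M S Y" by (rule prob_space_distr) simp
  interpret L: prob_space "distr M borel L" by (rule prob_space_distr) simp
  have "distr M S Y \<Otimes>\<^sub>M distr M borel L = distr M (S \<Otimes>\<^sub>M borel) (\<lambda>w. (Y w, L w))"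
  proof (rule pair_measure_eqI)
    fix A B assume "A \<in> sets (distr M S Y)" "B \<in> sets (distr M borel L)"
    then have AB [measurable]: "A \<in> sets S" "B \<in> sets borel" by auto
    have "prob ((Y -` A \<inter> space M) \<inter> (L -` B \<inter> space M)) = prob (Y -` A \<inter> space M) * prob (L -` B \<inter> space M)"
      using AB by (intro indep_setD[OF ind]) auto
    moreover have "(\<lambda>w. (Y w, L w)) -` (A \<times> B) \<inter> space M = (Y -` A \<inter> space M) \<inter> (L -` B \<inter> space M)"
      by auto
    ultimately show "emeasure (distr M S Y) A * emeasure (distr M borel L) B =
        emeasure (distr M (S \<Otimes>\<^sub>M borel) (\<lambda>w. (Y w, L w))) (A \<times> B)"
      by (simp add: emeasure_distr emeasure_eq_measure ennreal_mult)
  qed (auto intro: Y.sigma_finite_measure_axioms L.sigma_finite_measure_axioms)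
  then have "(\<integral>\<^sup>+w. \<phi> (Y w, L w) \<partial>M) = (\<integral>\<^sup>+p. \<phi> p \<partial>(distr M S Y \<Otimes>\<^sub>M distr M borel L))"
    using \<phi> by (simp add: nn_integral_distr)
  also have "\<dots> = (\<integral>\<^sup>+s. (\<integral>\<^sup>+y. \<phi> (s, y) \<partial>(distr M borel L)) \<partial>(distr M S Y))"
    using \<phi> by (intro L.nn_integral_fst[symmetric]) simp
  also have "distr M borel L = density lborel (\<lambda>x. ennreal (\<rho> x))"
    using L by (simp add: distributed_def cong: distr_cong)
  also have "(\<integral>\<^sup>+s. (\<integral>\<^sup>+y. \<phi> (s, y) \<partial>(density lborel (\<lambda>x. ennreal (\<rho> x)))) \<partial>(distr M S Y)) =
      (\<integral>\<^sup>+s. (\<integral>\<^sup>+y. ennreal (\<rho> y) * \<phi> (s, y) \<partial>lborel) \<partial>(distr M S Y))"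
    using L \<phi> by (intro nn_integral_cong nn_integral_density) (auto simp: distributed_def)
  also have "\<dots> = (\<integral>\<^sup>+w. (\<integral>\<^sup>+y. ennreal (\<rho> y) * \<phi> (Y w, y) \<partial>lborel) \<partial>M)"
  proof -
    have "(\<lambda>x. ennreal (\<rho> x)) \<in> borel_measurable borel" using L by (simp add: distributed_def)
    moreover have "\<phi> \<in> borel_measurable (S \<Otimes>\<^sub>M lborel)" using \<phi> by simp
    ultimately have "(\<lambda>(s, y). ennreal (\<rho> y) * \<phi> (s, y)) \<in> borel_measurable (S \<Otimes>\<^sub>M lborel)"
      by measurable
    then have "(\<lambda>s. \<integral>\<^sup>+y. ennreal (\<rho> y) * \<phi> (s, y) \<partial>lborel) \<in> borel_measurable S"
      by (rule lborel.borel_measurable_nn_integral)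
    then show ?thesis by (intro nn_integral_distr) simp_all
  qed
  finally show ?thesis .
qed

section \<open>Critical values on a manifold\<close>

context smooth_manifold
begin

text \<open>A nonnegative function of a coordinate point \<open>x\<close> and a vector \<open>u\<close> that vanishes for some unit
  vector \<open>u\<close> iff \<open>x\<close> is a critical point with value \<open>y\<close>. Being continuous in \<open>(x, u)\<close>, it has a zero on
  a compact set iff its infimum over a countable dense subset is \<open>0\<close>, which makes the event
  measurable.\<close>

definition critical_at :: "('a, 'm) chart \<Rightarrow> ('a \<Rightarrow> real^'k::finite) \<Rightarrow> real^'k \<Rightarrow> (real^'m) \<times> (real^'k) \<Rightarrow> real" where
  "critical_at c f y = (\<lambda>(x, u). norm (f (chart_inv c x) - y) +
     (\<Sum>i\<in>UNIV. \<bar>u \<bullet> iter_deriv [axis i 1] (f \<circ> chart_inv c) x\<bar>))"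

lemma critical_at_nonneg: "0 \<le> critical_at c f y p"
  by (auto simp: critical_at_def split: prod.split intro!: add_nonneg_nonneg sum_nonneg)

lemma continuous_on_critical_at:
  assumes "f \<in> C_space A r" "1 \<le> r" "c \<in> A" "K \<subseteq> snd c ` fst c"
  shows "continuous_on (K \<times> T) (critical_at c f y)"
proof -
  have c: "continuous_on (K \<times> T) (\<lambda>p. iter_deriv vs (f \<circ> chart_inv c) (fst p))"
    if "set vs \<subseteq> Basis" "length vs \<le> 1" for vs
  proof -
    have "enat (length vs) \<le> r" using that(2) assms(2) by (auto intro: order_trans[of _ 1] simp: one_enat_def)
    then have "continuous_on (snd c ` fst c) (iter_deriv vs (f \<circ> chart_inv c))"
      using that by (intro C_space_iter_deriv_continuous[OF assms(1,3)])
    then show ?thesis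
      by (rule continuous_on_compose2) (use assms(4) in \<open>auto intro!: continuous_intros\<close>)
  qed
  have "continuous_on (K \<times> T) (\<lambda>p. f (chart_inv c (fst p)))" using c[of "[]"] by simp
  moreover have "continuous_on (K \<times> T) (\<lambda>p. iter_deriv [axis i 1] (f \<circ> chart_inv c) (fst p))" for i
    by (intro c) (auto simp: axis_in_Basis_iff)
  ultimately show ?thesis
    unfolding critical_at_def case_prod_beta by (intro continuous_intros)
qed

lemma critical_measurable:
  fixes Z :: "'w \<Rightarrow> 'a \<Rightarrow> real^'k::finite"
  assumes "1 \<le> r" "c \<in> A" "compact K" "K \<subseteq> snd c ` fst c"
    and Z: "Z \<in> measurable M (borel_of (weak_whitney A r))" and y: "y \<in> borel_measurable M"
  shows "{w \<in> space M. \<exists>p\<in>K \<times> sphere 0 1. critical_at c (Z w) (y w) p = 0} \<in> sets M"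
proof -
  let ?KS = "K \<times> sphere 0 1 :: ((real^'m) \<times> (real^'k)) set"
  obtain D where D: "countable D" "D \<subseteq> ?KS" "?KS \<subseteq> closure D" using separable by blast
  have KS: "compact ?KS" using assms(3) by (intro compact_Times) auto
  have m: "(\<lambda>w. critical_at c (Z w) (y w) p) \<in> borel_measurable M" if "p \<in> D" for p
  proof -
    obtain x u where p: "p = (x, u)" by fastforce
    have x: "chart_inv c x \<in> fst c" "snd c (chart_inv c x) = x"
      using that D(2) assms(4) chart_inv_in[OF assms(2)] chart_chart_inv[OF assms(2)] by (auto simp: p)
    have "(\<lambda>w. Z w (chart_inv c x)) \<in> borel_measurable M"
      using measurable_compose[OF Z continuous_map_measurable[OF continuous_map_eval]] .
    moreover have "(\<lambda>w. iter_deriv [axis i 1] (Z w \<circ> chart_inv c) (snd c (chart_inv c x))) \<in> borel_measurable M" for i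
      using assms(1) by (intro measurable_compose[OF Z continuous_map_measurable[OF continuous_map_iter_deriv]] assms x)
        (auto simp: axis_in_Basis_iff one_enat_def)
    ultimately show ?thesis
      using y unfolding p critical_at_def x(2) prod.case by measurable
  qed
  have "(\<exists>p\<in>?KS. critical_at c (Z w) (y w) p = 0) \<longleftrightarrow>
      (\<forall>n. \<exists>p\<in>D. critical_at c (Z w) (y w) p < inverse (real (Suc n)))" if "w \<in> space M" for w
  proof -
    have "Z w \<in> C_space A r" using measurable_space[OF Z that] by (simp add: topspace_weak_whitney)
    then have cont: "continuous_on ?KS (critical_at c (Z w) (y w))"
      using assms by (intro continuous_on_critical_at)
    show ?thesis
    proof
      assume "\<exists>p\<in>?KS. critical_at c (Z w) (y w) p = 0"
      then obtain p where p: "p \<in> ?KS" "critical_at c (Z w) (y w) p = 0" by blast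
      show "\<forall>n. \<exists>p\<in>D. critical_at c (Z w) (y w) p < inverse (real (Suc n))"
      proof
        fix n
        obtain d where d: "d > 0" "\<And>q. q \<in> ?KS \<Longrightarrow> dist q p < d \<Longrightarrow>
            dist (critical_at c (Z w) (y w) q) (critical_at c (Z w) (y w) p) < inverse (real (Suc n))"
          using cont p(1) unfolding continuous_on_iff by (metis inverse_positive_iff_positive of_nat_0_less_iff zero_less_Suc)
        obtain q where q: "q \<in> D" "dist q p < d"
          using D(3) p(1) d(1) closure_approachable by blast
        then have "critical_at c (Z w) (y w) q < inverse (real (Suc n))"
          using d(2)[of q] D(2) p(2) critical_at_nonneg[of c "Z w" "y w" q] by (auto simp: dist_real_def)
        then show "\<exists>p\<in>D. critical_at c (Z w) (y w) p < inverse (real (Suc n))" using q(1) by blast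
      qed
    next
      assume *: "\<forall>n. \<exists>p\<in>D. critical_at c (Z w) (y w) p < inverse (real (Suc n))"
      then have "?KS \<noteq> {}" using D(2) by blast
      then obtain p where p: "p \<in> ?KS" "\<And>q. q \<in> ?KS \<Longrightarrow> critical_at c (Z w) (y w) p \<le> critical_at c (Z w) (y w) q"
        using continuous_attains_inf[OF KS _ cont] by blast
      have "critical_at c (Z w) (y w) p \<le> inverse (real (Suc n))" for n
        using *[rule_format, of n] p(2) D(2) by (meson less_imp_le order_trans subsetD)
      then have "critical_at c (Z w) (y w) p \<le> 0"
        using LIMSEQ_le_const[OF LIMSEQ_inverse_real_of_nat] by blast
      then show "\<exists>p\<in>?KS. critical_at c (Z w) (y w) p = 0"
        using p(1) critical_at_nonneg[of c "Z w" "y w" p] by (intro bexI[of _ p]) auto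
    qed
  qed
  then have "{w \<in> space M. \<exists>p\<in>?KS. critical_at c (Z w) (y w) p = 0} =
      {w \<in> space M. \<forall>n. \<exists>p\<in>D. critical_at c (Z w) (y w) p < inverse (real (Suc n))}"
    by (rule Collect_cong[OF conj_cong[OF refl]])
  moreover have "{w \<in> space M. critical_at c (Z w) (y w) p < inverse (real (Suc n))} \<in> sets M" if "p \<in> D" for p n
    using m[OF that] by simp
  then have "{w \<in> space M. \<forall>n. \<exists>p\<in>D. critical_at c (Z w) (y w) p < inverse (real (Suc n))} \<in> sets M"
    using D(1) by (intro sets.sets_Collect_countable_All sets.sets_Collect_countable_Ex')
  ultimately show ?thesis by (simp only:)
qed

text \<open>A unit vector orthogonal to all columns of the Jacobian matrix cannot lie in the range
  of the derivative, so these values are critical in the sense of \<open>morse_sard\<close>.\<close>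

lemma negligible_critical_values:
  fixes f :: "'a \<Rightarrow> real^'k::finite"
  assumes "f \<in> C_space A q" "enat (1 + (CARD('m) - CARD('k))) \<le> q" "c \<in> A" "K \<subseteq> snd c ` fst c"
  shows "negligible {y. \<exists>p\<in>K \<times> sphere 0 1. critical_at c f y p = 0}"
proof -
  let ?f = "f \<circ> chart_inv c" and ?U = "snd c ` fst c"
  have "C_on q ?f ?U" using assms(1,3) by (simp add: C_space_def)
  \<comment> \<open>Subtraction of natural numbers stops at \<open>0\<close>, which accounts for the
    maximum in \<open>1 + max (m - k) 0\<close>.\<close>
  then have "Ck (Suc (CARD('m) - CARD('k))) ?f ?U" using assms(2) by (intro C_on_imp_Ck) auto
  then have neg: "negligible (?f ` {x \<in> ?U. \<not> surj (frechet_derivative ?f (at x))})"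
    and diff: "\<And>x. x \<in> ?U \<Longrightarrow> ?f differentiable at x"
    using chart_image_open[OF assms(3)] by (auto intro!: morse_sard simp del: o_apply)
  from neg show ?thesis
  proof (rule negligible_subset, intro subsetI)
    fix y assume "y \<in> {y. \<exists>p\<in>K \<times> sphere 0 1. critical_at c f y p = 0}"
    then obtain x u where xu: "x \<in> K" "norm u = 1" "critical_at c f y (x, u) = 0" by auto
    have s: "0 \<le> (\<Sum>i\<in>UNIV. \<bar>u \<bullet> iter_deriv [axis i 1] ?f x\<bar>)" by (intro sum_nonneg) auto
    then have y: "y = ?f x" and "(\<Sum>i\<in>UNIV. \<bar>u \<bullet> iter_deriv [axis i 1] ?f x\<bar>) = 0"
      using xu(3) norm_ge_zero[of "f (chart_inv c x) - y"] unfolding critical_at_def prod.case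
      by (smt (verit, best) eq_iff_diff_eq_0 norm_eq_zero o_apply)+
    then have u: "u \<bullet> frechet_derivative ?f (at x) (axis i 1) = 0" for i
      by (subst (asm) sum_nonneg_eq_0_iff) auto
    have lin: "linear (frechet_derivative ?f (at x))"
      using diff[of x] xu(1) assms(4) unfolding frechet_derivative_works by (auto intro: has_derivative_linear)
    have "\<not> surj (frechet_derivative ?f (at x))"
    proof
      assume "surj (frechet_derivative ?f (at x))"
      then obtain h where h: "u = frechet_derivative ?f (at x) h" unfolding surj_def by metis
      have "linear (\<lambda>h. u \<bullet> frechet_derivative ?f (at x) h)"
        using lin by (auto intro!: linearI simp: linear_add linear_scale inner_add_right)
      then have "u \<bullet> frechet_derivative ?f (at x) h = (\<Sum>i\<in>UNIV. h $ i * (u \<bullet> frechet_derivative ?f (at x) (axis i 1)))"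
        by (rule linear_axis_sum)
      then have "u \<bullet> u = 0" using u h by simp
      then show False using xu(2) by simp
    qed
    then show "y \<in> ?f ` {x \<in> ?U. \<not> surj (frechet_derivative ?f (at x))}"
      using y xu(1) assms(4) by blast
  qed
qed

text \<open>The atlas may be uncountable, whereas null events are united countably often and
  \<open>critical_measurable\<close> works on compact sets.\<close>

lemma countable_compact_chart_cover:
  obtains \<T> :: "'a set set" and C K where "countable \<T>" "\<Union>\<T> = UNIV"
    "\<And>T. T \<in> \<T> \<Longrightarrow> C T \<in> A" "\<And>T. T \<in> \<T> \<Longrightarrow> compact (K T)"
    "\<And>T. T \<in> \<T> \<Longrightarrow> K T \<subseteq> snd (C T) ` fst (C T)" "\<And>T. T \<in> \<T> \<Longrightarrow> T \<subseteq> fst (C T)"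
    "\<And>T. T \<in> \<T> \<Longrightarrow> snd (C T) ` T \<subseteq> K T"
proof -
  let ?P = "\<lambda>T c K. c \<in> A \<and> compact K \<and> K \<subseteq> snd c ` fst c \<and> T \<subseteq> fst c \<and> snd c ` T \<subseteq> K"
  have "\<exists>N. open N \<and> p \<in> N \<and> (\<exists>c K. ?P (UNIV \<inter> N) c K)" for p
  proof -
    obtain c where c: "c \<in> A" "p \<in> fst c" using chart_around by metis
    then obtain e where e: "e > 0" "cball (snd c p) e \<subseteq> snd c ` fst c"
      using chart_image_open[OF c(1)] open_contains_cball by blast
    have "open (fst c \<inter> snd c -` ball (snd c p) e)"
      by (rule continuous_open_preimage[OF chart_continuous[OF c(1)] chart_open[OF c(1)] open_ball])
    moreover have "p \<in> fst c \<inter> snd c -` ball (snd c p) e" using c e by simp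
    moreover have "?P (UNIV \<inter> (fst c \<inter> snd c -` ball (snd c p) e)) c (cball (snd c p) e)"
      using c e by auto
    ultimately show ?thesis by blast
  qed
  then obtain \<T> where \<T>: "countable \<T>" "\<And>T. T \<in> \<T> \<Longrightarrow> \<exists>c K. ?P T c K" "UNIV = \<Union>\<T>"
    using countable_local_cover[of UNIV "\<lambda>T. \<exists>c K. ?P T c K"] by metis
  then obtain C K where "\<And>T. T \<in> \<T> \<Longrightarrow> ?P T (C T) (K T)" by metis
  with \<T> show thesis by (intro that[of \<T> C K]) auto
qed

text \<open>Criticality in one chart is carried to every chart around \<open>p\<close>, because the
  piece of the countable cover that contains \<open>p\<close> comes with a chart of its own.\<close>

lemma not_regular_imp_critical:
  fixes f :: "'a \<Rightarrow> real^'k::finite"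
  assumes f: "f \<in> C_space A r" "1 \<le> r" and "\<not> regular_value A f y"
  obtains p where "f p = y" "\<And>d. d \<in> A \<Longrightarrow> p \<in> fst d \<Longrightarrow> \<exists>u\<in>sphere 0 1. critical_at d f y (snd d p, u) = 0"
proof -
  obtain p c where p: "f p = y" "c \<in> A" "p \<in> fst c" "\<not> surj (chart_deriv c f p)"
    using assms(3) unfolding regular_value_def by blast
  show thesis
  proof (rule that[OF p(1)])
    fix d assume d: "d \<in> A" "p \<in> fst d"
    let ?D = "frechet_derivative (f \<circ> chart_inv d) (at (snd d p))"
    have "chart_deriv d f p = (\<lambda>h. chart_deriv c f p (transition_deriv d c p h))"
      using chart_deriv_change[OF d(1) p(2) d(2) p(3) C_space_differentiable[OF f p(2,3)]] .
    then have ns: "\<not> surj ?D" using p(4) unfolding chart_deriv_def surj_def by metis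
    have "linear ?D"
      using C_space_differentiable[OF f d] unfolding frechet_derivative_works by (rule has_derivative_linear)
    then obtain u where u: "u \<noteq> 0" "\<And>h. u \<bullet> ?D h = 0" using not_surj_orthogonal ns by blast
    then have "critical_at d f y (snd d p, inverse (norm u) *\<^sub>R u) = 0"
      using p(1) by (simp add: critical_at_def chart_inv_chart[OF d] u(2))
    then show "\<exists>u\<in>sphere 0 1. critical_at d f y (snd d p, u) = 0"
      using u(1) by (intro bexI[of _ "inverse (norm u) *\<^sub>R u"]) auto
  qed
qed

end

lemma continuous_on_UNIV_tendsto:
  "continuous_on UNIV f \<Longrightarrow> (x \<longlongrightarrow> l) F \<Longrightarrow> ((\<lambda>i. f (x i)) \<longlongrightarrow> f l) F"
  by (rule continuous_on_tendsto_compose[where s = UNIV]) auto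

text \<open>Reduces continuity to sequences, the setting of Scheffe's lemma and of dominated
  convergence.\<close>

lemma tendsto_at_pair:
  fixes F :: "'a::first_countable_topology \<times> 'b::first_countable_topology \<Rightarrow> 'c::topological_space"
  assumes "\<And>ps xs. ps \<longlonglongrightarrow> fst z \<Longrightarrow> xs \<longlonglongrightarrow> snd z \<Longrightarrow> (\<lambda>n. F (ps n, xs n)) \<longlonglongrightarrow> l"
  shows "(F \<longlongrightarrow> l) (at z)"
  unfolding tendsto_at_iff_sequentially
proof (intro allI impI)
  fix zs assume "zs \<longlonglongrightarrow> z"
  then have "(\<lambda>n. F (fst (zs n), snd (zs n))) \<longlonglongrightarrow> l"
    by (intro assms tendsto_fst tendsto_snd)
  then show "(F \<circ> zs) \<longlonglongrightarrow> l" by (simp add: o_def)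
qed

section \<open>The translated field\<close>

locale translated_field = riemannian_manifold A g + prob_space P
  for A :: "('a::{t2_space, second_countable_topology}, 'm::finite) chart set"
    and g :: "('a, 'm) chart \<Rightarrow> 'a \<Rightarrow> real^'m^'m"
    and P :: "'w measure" +
  fixes Y :: "'w \<Rightarrow> 'a \<Rightarrow> real^'k::finite"
    and L :: "'w \<Rightarrow> real^'k"
    and \<rho> :: "real^'k \<Rightarrow> real"
    and q :: enat
  assumes q: "q \<ge> enat (1 + (CARD('m) - CARD('k)))"
    and Y: "Y \<in> measurable P (borel_of (weak_whitney A q))"
    and jac_integrable: "\<And>p. integrable P (\<lambda>\<omega>. jac A g p (Y \<omega>))"
    and jac_continuous: "continuous_on UNIV (\<lambda>p. \<integral>\<omega>. jac A g p (Y \<omega>) \<partial>P)"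
    and indep: "indep_elements P (borel_of (weak_whitney A q)) Y borel L"
    and L: "distributed P lborel L (\<lambda>x. ennreal (\<rho> x))"
    and \<rho>_continuous: "continuous_on UNIV \<rho>" and \<rho>_nonneg: "\<And>x. \<rho> x \<ge> 0" and \<rho>_nz: "\<And>x. \<rho> x \<noteq> 0"
    and \<rho>_bounded: "bounded (range \<rho>)"
begin

abbreviation C1 :: "('a \<Rightarrow> real^'k) measure" where
  "C1 \<equiv> borel_of (weak_whitney A 1)"

lemma q1: "1 \<le> q"
  using q by (rule order_trans[rotated]) (simp add: one_enat_def)

lemma Y_C_space: "w \<in> space P \<Longrightarrow> Y w \<in> C_space A q"
  using measurable_space[OF Y] by (simp add: topspace_weak_whitney)

lemma Y_C1_space: "w \<in> space P \<Longrightarrow> Y w \<in> C_space A 1"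
  using Y_C_space C_space_mono[OF q1] by blast

text \<open>Translation by \<open>0\<close> is the inclusion of \<open>C^q\<close> in
  \<open>C^1\<close>.\<close>

lemma Y_measurable [measurable]: "Y \<in> measurable P C1"
  using measurable_add_const[OF q1 Y, of "\<lambda>_. 0"] by simp

lemma L_measurable [measurable]: "L \<in> borel_measurable P"
  using indep by (simp add: indep_elements_def)

lemma \<rho>_measurable [measurable]: "\<rho> \<in> borel_measurable borel"
  using \<rho>_continuous by (rule borel_measurable_continuous_onI)

lemma eval_measurable [measurable]: "(\<lambda>w. Y w p) \<in> borel_measurable P"
  using measurable_compose[OF Y continuous_map_measurable[OF continuous_map_eval]] .

lemma jac_Y_measurable [measurable]: "(\<lambda>w. jac A g p (Y w)) \<in> borel_measurable P"
  using jac_integrable by (rule borel_measurable_integrable)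

lemma translate_measurable:
  assumes "Z \<in> measurable M C1" "y \<in> borel_measurable M"
  shows "(\<lambda>w p. Z w p + y w) \<in> measurable M C1"
  using measurable_add_const[OF order_refl assms] .

lemma shift_measurable: "(\<lambda>w a. Y w a + (x - Y w p)) \<in> measurable P C1"
  by (intro translate_measurable) auto

lemma shift_measurable_pair: "(\<lambda>z a. Y (fst z) a + (snd z - Y (fst z) p)) \<in> measurable (P \<Otimes>\<^sub>M borel) C1"
  by (intro translate_measurable) auto

lemma field_measurable: "(\<lambda>w p. Y w p - L w) \<in> measurable P C1"
  using translate_measurable[OF Y_measurable, of "\<lambda>w. - L w"] by simp

lemma \<rho>_le: obtains C where "C > 0" "\<And>x. \<bar>\<rho> x\<bar> \<le> C"
  using \<rho>_bounded unfolding bounded_pos by auto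

section \<open>The joint law of the field and its value at a point\<close>

definition dens :: "'a \<Rightarrow> real^'k \<Rightarrow> real" where
  "dens p x = (\<integral>w. \<rho> (Y w p - x) \<partial>P)"

lemma dens_integrable: "integrable P (\<lambda>w. \<rho> (Y w p - x))"
proof -
  obtain C where "\<And>x. \<bar>\<rho> x\<bar> \<le> C" using \<rho>_le by blast
  then show ?thesis by (intro integrable_const_bound[of _ C]) auto
qed

lemma dens_pos: "dens p x > 0"
proof -
  have "dens p x \<ge> 0" unfolding dens_def by (intro integral_nonneg_AE) (simp add: \<rho>_nonneg)
  moreover have "dens p x \<noteq> 0"
  proof
    assume "dens p x = 0"
    then have "AE w in P. \<rho> (Y w p - x) = 0"
      using integral_nonneg_eq_0_iff_AE[OF dens_integrable] \<rho>_nonneg by (simp add: dens_def)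
    then have "AE w in P. False" by (simp add: \<rho>_nz)
    then show False by simp
  qed
  ultimately show ?thesis by linarith
qed

lemma ennreal_dens: "ennreal (dens p x) = (\<integral>\<^sup>+w. ennreal (\<rho> (Y w p - x)) \<partial>P)"
  unfolding dens_def by (rule nn_integral_eq_integral[symmetric]) (simp_all add: dens_integrable \<rho>_nonneg)

text \<open>The density at \<open>x\<close> of the measure \<open>V \<mapsto> P {X \<in> B, X p \<in> V}\<close> for \<open>X = Y - L\<close>.\<close>

definition joint_dens :: "'a \<Rightarrow> real^'k \<Rightarrow> ('a \<Rightarrow> real^'k) set \<Rightarrow> ennreal" where
  "joint_dens p x B = (\<integral>\<^sup>+w. ennreal (\<rho> (Y w p - x)) * indicator B (\<lambda>a. Y w a + (x - Y w p)) \<partial>P)"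

lemma shift_indicator_measurable:
  assumes "B \<in> sets C1"
  shows "(\<lambda>w. ennreal (\<rho> (Y w p - x)) * indicator B (\<lambda>a. Y w a + (x - Y w p))) \<in> borel_measurable P"
proof -
  have "(\<lambda>w. indicator B (\<lambda>a. Y w a + (x - Y w p)) :: ennreal) \<in> borel_measurable P"
    by (rule measurable_compose[OF shift_measurable borel_measurable_indicator[OF assms]])
  then show ?thesis by simp
qed

lemma joint_dens_pair_measurable:
  assumes "B \<in> sets C1"
  shows "(\<lambda>(w, x). ennreal (\<rho> (Y w p - x)) * indicator B (\<lambda>a. Y w a + (x - Y w p)))
    \<in> borel_measurable (P \<Otimes>\<^sub>M borel)"
proof -
  have "(\<lambda>z. indicator B (\<lambda>a. Y (fst z) a + (snd z - Y (fst z) p)) :: ennreal) \<in> borel_measurable (P \<Otimes>\<^sub>M borel)"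
    using assms by (intro measurable_compose[OF shift_measurable_pair] borel_measurable_indicator)
  then show ?thesis by (simp add: case_prod_beta)
qed

lemma joint_dens_measurable [measurable]:
  assumes "B \<in> sets C1"
  shows "(\<lambda>x. joint_dens p x B) \<in> borel_measurable borel"
proof -
  have "(\<lambda>(x, w). ennreal (\<rho> (Y w p - x)) * indicator B (\<lambda>a. Y w a + (x - Y w p)))
      \<in> borel_measurable (borel \<Otimes>\<^sub>M P)"
    using measurable_compose[OF measurable_pair_swap' joint_dens_pair_measurable[OF assms, of p]]
    by (simp add: case_prod_beta)
  then show ?thesis unfolding joint_dens_def by (rule borel_measurable_nn_integral)
qed

text \<open>For frozen \<open>Y\<close> the reflection at \<open>Y w p\<close> turns
  \<open>Y w - y\<close> into the translate of \<open>Y w\<close> whose value at \<open>p\<close> is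
  \<open>x\<close>, so the condition on the value becomes \<open>x \<in> V\<close> and leaves the
  expectation.\<close>

lemma field_law:
  assumes B [measurable]: "B \<in> sets C1" and V [measurable]: "V \<in> sets borel"
  shows "emeasure P {w \<in> space P. (\<lambda>a. Y w a - L w) \<in> B \<and> Y w p - L w \<in> V} =
    (\<integral>\<^sup>+x\<in>V. joint_dens p x B \<partial>lborel)"
proof -
  let ?S = "borel_of (weak_whitney A q) :: ('a \<Rightarrow> real^'k) measure"
  define \<phi> :: "('a \<Rightarrow> real^'k) \<times> (real^'k) \<Rightarrow> ennreal" where
    "\<phi> = (\<lambda>z. indicator B (\<lambda>a. fst z a + (- snd z)) * indicator V (fst z p - snd z))"
  have m1: "(\<lambda>z a. fst z a + (- snd z)) \<in> measurable (?S \<Otimes>\<^sub>M borel) C1"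
    by (rule measurable_add_const[OF q1]) auto
  have m2 [measurable]: "(\<lambda>z. fst z p) \<in> borel_measurable (?S \<Otimes>\<^sub>M borel)"
    using measurable_compose[OF measurable_fst continuous_map_measurable[OF continuous_map_eval]] .
  have "(\<lambda>z. indicator B (\<lambda>a. fst z a + (- snd z)) :: ennreal) \<in> borel_measurable (?S \<Otimes>\<^sub>M borel)"
    by (intro measurable_compose[OF m1] borel_measurable_indicator B)
  moreover have "(\<lambda>z. indicator V (fst z p - snd z) :: ennreal) \<in> borel_measurable (?S \<Otimes>\<^sub>M borel)"
    by measurable
  ultimately have \<phi>: "\<phi> \<in> borel_measurable (?S \<Otimes>\<^sub>M borel)" unfolding \<phi>_def by simp
  have "{w \<in> space P. (\<lambda>a. Y w a - L w) \<in> B \<and> Y w p - L w \<in> V} =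
      ((\<lambda>w a. Y w a - L w) -` B \<inter> space P) \<inter> ((\<lambda>w. Y w p - L w) -` V \<inter> space P)" by auto
  moreover have "(\<lambda>w a. Y w a - L w) -` B \<inter> space P \<in> sets P"
    using field_measurable B by (rule measurable_sets)
  moreover have "(\<lambda>w. Y w p - L w) -` V \<inter> space P \<in> sets P" by measurable
  ultimately have "{w \<in> space P. (\<lambda>a. Y w a - L w) \<in> B \<and> Y w p - L w \<in> V} \<in> sets P" by simp
  then have "emeasure P {w \<in> space P. (\<lambda>a. Y w a - L w) \<in> B \<and> Y w p - L w \<in> V} =
      (\<integral>\<^sup>+w. indicator {w \<in> space P. (\<lambda>a. Y w a - L w) \<in> B \<and> Y w p - L w \<in> V} w \<partial>P)" by simp
  also have "\<dots> = (\<integral>\<^sup>+w. \<phi> (Y w, L w) \<partial>P)"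
    by (intro nn_integral_cong) (auto simp: \<phi>_def split: split_indicator)
  also have "\<dots> = (\<integral>\<^sup>+w. (\<integral>\<^sup>+y. ennreal (\<rho> y) * \<phi> (Y w, y) \<partial>lborel) \<partial>P)"
    by (rule nn_integral_indep_density[OF indep L \<phi>])
  also have "\<dots> = (\<integral>\<^sup>+w. (\<integral>\<^sup>+x. ennreal (\<rho> (Y w p - x)) *
      indicator B (\<lambda>a. Y w a + (x - Y w p)) * indicator V x \<partial>lborel) \<partial>P)"
  proof (rule nn_integral_cong)
    fix w assume w: "w \<in> space P"
    have "(\<lambda>y. \<phi> (Y w, y)) \<in> borel_measurable borel"
      using measurable_compose[OF measurable_Pair1' \<phi>, of "Y w"] measurable_space[OF Y w] by simp
    then have "(\<integral>\<^sup>+y. ennreal (\<rho> y) * \<phi> (Y w, y) \<partial>lborel) =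
        (\<integral>\<^sup>+x. ennreal (\<rho> (Y w p - x)) * \<phi> (Y w, Y w p - x) \<partial>lborel)"
      by (intro nn_integral_lborel_reflect) measurable
    moreover have "\<phi> (Y w, Y w p - x) = indicator B (\<lambda>a. Y w a + (x - Y w p)) * indicator V x" for x
      by (simp add: \<phi>_def algebra_simps)
    ultimately show "(\<integral>\<^sup>+y. ennreal (\<rho> y) * \<phi> (Y w, y) \<partial>lborel) =
        (\<integral>\<^sup>+x. ennreal (\<rho> (Y w p - x)) * indicator B (\<lambda>a. Y w a + (x - Y w p)) * indicator V x \<partial>lborel)"
      by (simp add: mult.assoc)
  qed
  also have "\<dots> = (\<integral>\<^sup>+x. (\<integral>\<^sup>+w. ennreal (\<rho> (Y w p - x)) *
      indicator B (\<lambda>a. Y w a + (x - Y w p)) * indicator V x \<partial>P) \<partial>lborel)"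
  proof -
    interpret PL: pair_sigma_finite P lborel ..
    have "(\<lambda>(w, x). ennreal (\<rho> (Y w p - x)) * indicator B (\<lambda>a. Y w a + (x - Y w p)) * indicator V x)
      \<in> borel_measurable (P \<Otimes>\<^sub>M borel)"
      using joint_dens_pair_measurable[OF B, of p] by (simp add: case_prod_beta)
    then show ?thesis by (intro PL.Fubini'[symmetric]) simp
  qed
  also have "\<dots> = (\<integral>\<^sup>+x\<in>V. joint_dens p x B \<partial>lborel)"
  proof (intro nn_integral_cong)
    fix x :: "real^'k"
    show "(\<integral>\<^sup>+w. ennreal (\<rho> (Y w p - x)) * indicator B (\<lambda>a. Y w a + (x - Y w p)) * indicator V x \<partial>P) =
        joint_dens p x B * indicator V x"
      unfolding joint_dens_def using shift_indicator_measurable[OF B] by (rule nn_integral_multc)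
  qed
  finally show ?thesis .
qed

lemma joint_dens_space: "joint_dens p x (topspace (weak_whitney A 1)) = ennreal (dens p x)"
  unfolding joint_dens_def ennreal_dens
  using measurable_space[OF shift_measurable] by (intro nn_integral_cong) (simp add: indicator_def)

text \<open>The density of the value is the joint density of the whole space, whose measurability is
  known.\<close>

lemma dens_measurable [measurable]: "dens p \<in> borel_measurable borel"
proof -
  have "(\<lambda>x. enn2real (joint_dens p x (space C1))) \<in> borel_measurable borel"
    using joint_dens_measurable[OF sets.top] by (intro borel_measurable_enn2real)
  moreover have "enn2real (joint_dens p x (space C1)) = dens p x" for x
    using dens_pos[of p x] by (simp add: joint_dens_space)
  ultimately show ?thesis by simp
qed

lemma field_distributed: "distributed P lborel (\<lambda>w. Y w p - L w) (\<lambda>x. ennreal (dens p x))"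
  unfolding distributed_def
proof (intro conjI measure_eqI)
  fix V :: "(real^'k) set" assume "V \<in> sets (distr P lborel (\<lambda>w. Y w p - L w))"
  then have V [measurable]: "V \<in> sets borel" by simp
  have "(\<lambda>w. Y w p - L w) -` V \<inter> space P = {w \<in> space P. (\<lambda>a. Y w a - L w) \<in> space C1 \<and> Y w p - L w \<in> V}"
    using measurable_space[OF field_measurable] by auto
  then have "emeasure (distr P lborel (\<lambda>w. Y w p - L w)) V = (\<integral>\<^sup>+x\<in>V. ennreal (dens p x) \<partial>lborel)"
    using field_law[OF sets.top V, of p] by (simp add: emeasure_distr joint_dens_space)
  then show "emeasure (distr P lborel (\<lambda>w. Y w p - L w)) V = emeasure (density lborel (\<lambda>x. ennreal (dens p x))) V"
    by (simp add: emeasure_density)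
qed auto

section \<open>The conditional law given the value at a point\<close>

definition cond_law :: "'a \<Rightarrow> real^'k \<Rightarrow> ('a \<Rightarrow> real^'k) measure" where
  "cond_law p x = distr (density P (\<lambda>w. ennreal (\<rho> (Y w p - x) / dens p x))) C1 (\<lambda>w a. Y w a + (x - Y w p))"

lemma sets_cond_law [simp]: "sets (cond_law p x) = sets C1" and space_cond_law [simp]: "space (cond_law p x) = C_space A 1"
  by (simp_all add: cond_law_def topspace_weak_whitney)

lemma emeasure_cond_law:
  assumes B: "B \<in> sets C1"
  shows "emeasure (cond_law p x) B = joint_dens p x B * ennreal (1 / dens p x)"
proof -
  let ?T = "\<lambda>w a. Y w a + (x - Y w p)"
  have m: "?T \<in> measurable (density P (\<lambda>w. ennreal (\<rho> (Y w p - x) / dens p x))) C1"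
    using shift_measurable by simp
  have "emeasure (cond_law p x) B = emeasure (density P (\<lambda>w. ennreal (\<rho> (Y w p - x) / dens p x))) (?T -` B \<inter> space P)"
    using m B by (simp add: cond_law_def emeasure_distr)
  also have "\<dots> = (\<integral>\<^sup>+w. ennreal (\<rho> (Y w p - x) / dens p x) * indicator (?T -` B \<inter> space P) w \<partial>P)"
    by (rule emeasure_density[OF _ measurable_sets[OF shift_measurable B]]) measurable
  also have "\<dots> = (\<integral>\<^sup>+w. ennreal (\<rho> (Y w p - x)) * indicator B (?T w) * ennreal (1 / dens p x) \<partial>P)"
    using dens_pos[of p x] \<rho>_nonneg
    by (intro nn_integral_cong) (auto simp: ennreal_mult[symmetric] split: split_indicator)
  also have "\<dots> = joint_dens p x B * ennreal (1 / dens p x)"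
    unfolding joint_dens_def using shift_indicator_measurable[OF B] by (rule nn_integral_multc)
  finally show ?thesis .
qed

lemma prob_space_cond_law: "prob_space (cond_law p x)"
proof
  have "emeasure (cond_law p x) (space (cond_law p x)) = ennreal (dens p x) * ennreal (1 / dens p x)"
    using emeasure_cond_law[OF sets.top] joint_dens_space by (simp add: topspace_weak_whitney)
  then show "emeasure (cond_law p x) (space (cond_law p x)) = 1"
    using dens_pos[of p x] by (simp add: ennreal_mult[symmetric])
qed

lemma regular_cond_prob_cond_law: "regular_cond_prob A P (\<lambda>w a. Y w a - L w) p (cond_law p)"
  unfolding regular_cond_prob_def
proof (intro conjI allI ballI)
  fix B assume B: "B \<in> sets C1"
  have "(\<lambda>x. joint_dens p x B * ennreal (1 / dens p x)) \<in> borel_measurable borel"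
    using joint_dens_measurable[OF B] by measurable
  then show m: "(\<lambda>x. emeasure (cond_law p x) B) \<in> borel_measurable borel"
    by (simp add: emeasure_cond_law[OF B])
  fix V :: "(real^'k) set" assume V [measurable]: "V \<in> sets borel"
  have "distr P borel (\<lambda>w. Y w p - L w) = density lborel (\<lambda>x. ennreal (dens p x))"
    using field_distributed[of p] by (simp add: distributed_def cong: distr_cong)
  then have "(\<integral>\<^sup>+x\<in>V. emeasure (cond_law p x) B \<partial>distr P borel (\<lambda>w. Y w p - L w)) =
      (\<integral>\<^sup>+x. ennreal (dens p x) * (emeasure (cond_law p x) B * indicator V x) \<partial>lborel)"
    using m by (simp add: nn_integral_density)
  also have "\<dots> = (\<integral>\<^sup>+x\<in>V. joint_dens p x B \<partial>lborel)"
  proof (intro nn_integral_cong)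
    fix x
    \<comment> \<open>Cancellation in the extended reals rests on \<open>dens p x\<close> being
      positive and finite.\<close>
    have "ennreal (dens p x) * ennreal (1 / dens p x) = 1"
      using dens_pos[of p x] by (simp add: ennreal_mult[symmetric])
    then show "ennreal (dens p x) * (emeasure (cond_law p x) B * indicator V x) = joint_dens p x B * indicator V x"
      unfolding emeasure_cond_law[OF B] by (metis (no_types, opaque_lifting) mult.assoc mult.commute mult.right_neutral)
  qed
  finally show "emeasure P {w \<in> space P. (\<lambda>a. Y w a - L w) \<in> B \<and> Y w p - L w \<in> V} =
      (\<integral>\<^sup>+x\<in>V. emeasure (cond_law p x) B \<partial>distr P borel (\<lambda>w. Y w p - L w))"
    using field_law[OF B V, of p] by simp
qed (auto simp: prob_space_cond_law)

text \<open>With \<open>Y\<close> frozen, the bad values of \<open>L\<close> on one piece of the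
  cover are negligible, and the law of \<open>L\<close> has a density; so each piece contributes a
  null event.\<close>

lemma AE_regular_value: "AE w in P. regular_value A (\<lambda>p. Y w p - L w) 0"
proof -
  obtain \<T> :: "'a set set" and C K where \<T>: "countable \<T>" "\<Union>\<T> = UNIV"
    and CK: "\<And>T. T \<in> \<T> \<Longrightarrow> C T \<in> A" "\<And>T. T \<in> \<T> \<Longrightarrow> compact (K T)"
    "\<And>T. T \<in> \<T> \<Longrightarrow> K T \<subseteq> snd (C T) ` fst (C T)" "\<And>T. T \<in> \<T> \<Longrightarrow> T \<subseteq> fst (C T)"
    "\<And>T. T \<in> \<T> \<Longrightarrow> snd (C T) ` T \<subseteq> K T"
    using countable_compact_chart_cover by blast
  let ?S = "borel_of (weak_whitney A q) :: ('a \<Rightarrow> real^'k) measure"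
  let ?crit = "\<lambda>T f y. \<exists>s\<in>K T \<times> sphere 0 1. critical_at (C T) f y s = 0"
  have null: "AE w in P. \<not> ?crit T (Y w) (L w)" if T: "T \<in> \<T>" for T
  proof -
    \<comment> \<open>The event is set up on the product of the value spaces, where
      \<open>nn_integral_indep_density\<close> can integrate out \<open>L\<close>.\<close>
    define N where "N = {z \<in> space (?S \<Otimes>\<^sub>M borel). ?crit T (fst z) (snd z)}"
    have N [measurable]: "N \<in> sets (?S \<Otimes>\<^sub>M borel)"
      unfolding N_def using CK T q1
      by (intro critical_measurable[where r = q and Z = fst and y = snd]) auto
    have "(\<integral>\<^sup>+w. indicator N (Y w, L w) \<partial>P) = (\<integral>\<^sup>+w. (\<integral>\<^sup>+y. ennreal (\<rho> y) * indicator N (Y w, y) \<partial>lborel) \<partial>P)"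
      by (rule nn_integral_indep_density[OF indep L]) (rule borel_measurable_indicator[OF N])
    also have "\<dots> = (\<integral>\<^sup>+w. 0 \<partial>P)"
    proof (intro nn_integral_cong)
      fix w assume w: "w \<in> space P"
      have "negligible {y. ?crit T (Y w) y}"
        using negligible_critical_values[OF Y_C_space[OF w] q CK(1)[OF T] CK(3)[OF T]] .
      then have "AE y in lebesgue. \<not> ?crit T (Y w) y"
        by (simp add: negligible_iff_null_sets AE_iff_null_sets null_setsD2 completion.AE_iff_null_sets)
      then have "AE y in lborel. \<not> ?crit T (Y w) y"
        by (simp add: AE_completion_iff)
      then have "AE y in lborel. ennreal (\<rho> y) * indicator N (Y w, y) = 0"
        by eventually_elim (auto simp: N_def)
      then have "(\<integral>\<^sup>+y. ennreal (\<rho> y) * indicator N (Y w, y) \<partial>lborel) = (\<integral>\<^sup>+y. 0 \<partial>(lborel :: (real^'k) measure))"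
        by (rule nn_integral_cong_AE)
      then show "(\<integral>\<^sup>+y. ennreal (\<rho> y) * indicator N (Y w, y) \<partial>lborel) = 0" by simp
    qed
    finally have "(\<integral>\<^sup>+w. indicator N (Y w, L w) \<partial>P) = 0" by simp
    moreover have "(\<lambda>w. indicator N (Y w, L w) :: ennreal) \<in> borel_measurable P"
      using Y L_measurable by (intro measurable_compose[OF measurable_Pair borel_measurable_indicator[OF N]])
    ultimately have "AE w in P. indicator N (Y w, L w) = (0 :: ennreal)"
      by (simp add: nn_integral_0_iff_AE)
    then show ?thesis
    proof (rule AE_mp, intro AE_I2 impI)
      fix w assume w: "w \<in> space P" and n: "indicator N (Y w, L w) = (0 :: ennreal)"
      have "(Y w, L w) \<in> space (?S \<Otimes>\<^sub>M borel)"
        using measurable_space[OF Y w] by (simp add: space_pair_measure)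
      then show "\<not> ?crit T (Y w) (L w)" using n by (auto simp: N_def indicator_def split: if_splits)
    qed
  qed
  then have "AE w in P. \<forall>T\<in>\<T>. \<not> ?crit T (Y w) (L w)"
    using \<T>(1) by (simp add: AE_ball_countable)
  then show ?thesis
  proof (rule AE_mp, intro AE_I2 impI)
    fix w assume w: "w \<in> space P" and n: "\<forall>T\<in>\<T>. \<not> ?crit T (Y w) (L w)"
    show "regular_value A (\<lambda>p. Y w p - L w) 0"
    proof (rule ccontr)
      \<comment> \<open>Subtracting a constant changes no derivative, so the level \<open>0\<close>
        of the field is the level \<open>L w\<close> of \<open>Y w\<close>.\<close>
      have eq: "regular_value A (\<lambda>p. Y w p - L w) 0 \<longleftrightarrow> regular_value A (Y w) (L w)"
      proof -
        have "(\<lambda>p. Y w p - L w) \<circ> chart_inv c = (\<lambda>x. (Y w \<circ> chart_inv c) x + (- L w))" for c :: "('a, 'm) chart" by auto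
        then have "chart_deriv c (\<lambda>p. Y w p - L w) p = chart_deriv c (Y w) p" for c :: "('a, 'm) chart" and p
          unfolding chart_deriv_def by (simp only: frechet_derivative_add_const)
        then show ?thesis by (simp add: regular_value_def)
      qed
      assume "\<not> regular_value A (\<lambda>p. Y w p - L w) 0"
      then obtain p where p: "\<And>d. d \<in> A \<Longrightarrow> p \<in> fst d \<Longrightarrow>
          \<exists>u\<in>sphere 0 1. critical_at d (Y w) (L w) (snd d p, u) = 0"
        unfolding eq using not_regular_imp_critical[OF Y_C_space[OF w] q1] by metis
      obtain T where T: "T \<in> \<T>" "p \<in> T" using \<T>(2) by blast
      then have "snd (C T) p \<in> K T" "p \<in> fst (C T)" using CK(4,5)[OF T(1)] by auto
      then show False using p[OF CK(1)[OF T(1)]] n T(1) by blast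
    qed
  qed
qed

section \<open>Continuity of the density and of the weighted conditional laws\<close>

lemma Y_tendsto:
  assumes "w \<in> space P" "ps \<longlonglongrightarrow> p" "xs \<longlonglongrightarrow> x"
  shows "(\<lambda>n. Y w (ps n) - xs n) \<longlonglongrightarrow> Y w p - x"
proof -
  have "(\<lambda>n. Y w (ps n)) \<longlonglongrightarrow> Y w p"
    by (rule continuous_on_UNIV_tendsto[OF C_space_continuous[OF Y_C_space[OF assms(1)]] assms(2)])
  then show ?thesis using assms(3) by (rule tendsto_diff)
qed

lemma \<rho>_tendsto: "ys \<longlonglongrightarrow> y \<Longrightarrow> (\<lambda>n. \<rho> (ys n)) \<longlonglongrightarrow> \<rho> y"
  by (rule continuous_on_UNIV_tendsto[OF \<rho>_continuous])

lemma dens_tendsto: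
  assumes "ps \<longlonglongrightarrow> p" "xs \<longlonglongrightarrow> x"
  shows "(\<lambda>n. dens (ps n) (xs n)) \<longlonglongrightarrow> dens p x"
proof -
  obtain C where C: "\<And>x. \<bar>\<rho> x\<bar> \<le> C" using \<rho>_le by blast
  \<comment> \<open>The constant \<open>1\<close> takes the place of the Jacobian, which leaves
    convergence of bounded variables.\<close>
  have "(\<lambda>n. \<integral>w. \<rho> (Y w (ps n) - xs n) * 1 \<partial>P) \<longlonglongrightarrow> (\<integral>w. \<rho> (Y w p - x) * 1 \<partial>P)"
    using C \<rho>_tendsto[OF Y_tendsto[OF _ assms]]
    by (intro integral_tendsto_bounded_mult[where C = C]) auto
  then show ?thesis by (simp add: dens_def)
qed

abbreviation weighted :: "'a \<Rightarrow> real^'k \<Rightarrow> ('a \<Rightarrow> real^'k) measure" where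
  "weighted p x \<equiv> density (cond_law p x) (\<lambda>f. ennreal (jac A g p f))"

lemma jac_C1_measurable [measurable]: "(\<lambda>f. jac A g p f) \<in> borel_measurable C1"
  by (rule jac_measurable) simp

lemma jac_cond_law_measurable: "(\<lambda>f. jac A g p f) \<in> borel_measurable (cond_law p x)"
  using jac_C1_measurable[of p] by (simp cong: measurable_cong_sets)

text \<open>Translation leaves the Jacobian alone, so the bound of \<open>\<rho>\<close> dominates
  the total mass by a multiple of the mean of the Jacobian of \<open>Y\<close>.\<close>

lemma finite_measure_weighted: "finite_measure (weighted p x)"
proof
  obtain C where C: "C > 0" "\<And>x. \<bar>\<rho> x\<bar> \<le> C" using \<rho>_le by blast
  have "emeasure (weighted p x) (space (weighted p x)) = (\<integral>\<^sup>+f. ennreal (jac A g p f) \<partial>cond_law p x)"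
  proof -
    have "emeasure (weighted p x) (space (cond_law p x)) =
        (\<integral>\<^sup>+f. ennreal (jac A g p f) * indicator (space (cond_law p x)) f \<partial>cond_law p x)"
      using jac_cond_law_measurable sets.top[of "cond_law p x"] by (intro emeasure_density) auto
    also have "\<dots> = (\<integral>\<^sup>+f. ennreal (jac A g p f) \<partial>cond_law p x)"
      by (intro nn_integral_cong) simp
    finally show ?thesis by simp
  qed
  also have "\<dots> = (\<integral>\<^sup>+w. ennreal (jac A g p (Y w)) \<partial>density P (\<lambda>w. ennreal (\<rho> (Y w p - x) / dens p x)))"
    unfolding cond_law_def using shift_measurable jac_C1_measurable[of p]
    by (subst nn_integral_distr) (auto simp: jac_add_const)
  also have "\<dots> = (\<integral>\<^sup>+w. ennreal (\<rho> (Y w p - x) / dens p x) * ennreal (jac A g p (Y w)) \<partial>P)"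
    by (intro nn_integral_density) measurable
  also have "\<dots> \<le> (\<integral>\<^sup>+w. ennreal (C / dens p x) * ennreal (jac A g p (Y w)) \<partial>P)"
    using C(2) dens_pos[of p x]
    by (intro nn_integral_mono mult_right_mono ennreal_leI divide_right_mono) (auto simp: abs_le_iff less_imp_le)
  also have "\<dots> = ennreal (C / dens p x) * (\<integral>\<^sup>+w. ennreal (jac A g p (Y w)) \<partial>P)"
    by (intro nn_integral_cmult) measurable
  also have "\<dots> < \<infinity>"
    by (simp add: ennreal_mult_less_top nn_integral_eq_integral jac_integrable jac_nonneg[OF Y_C1_space])
  finally show "emeasure (weighted p x) (space (weighted p x)) \<noteq> \<infinity>" by simp
qed

lemma integral_weighted:
  assumes h [measurable]: "h \<in> borel_measurable C1"
  shows "(\<integral>f. h f \<partial>weighted p x) =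
    (\<integral>w. h (\<lambda>a. Y w a + (x - Y w p)) * \<rho> (Y w p - x) * jac A g p (Y w) \<partial>P) / dens p x"
proof -
  let ?T = "\<lambda>w a. Y w a + (x - Y w p)"
  have hc: "h \<in> borel_measurable (cond_law p x)" using h by (simp cong: measurable_cong_sets)
  have hT: "(\<lambda>w. h (?T w)) \<in> borel_measurable P"
    using measurable_compose[OF shift_measurable h] .
  have "(\<integral>f. h f \<partial>weighted p x) = (\<integral>f. jac A g p f * h f \<partial>cond_law p x)"
    using hc jac_cond_law_measurable jac_nonneg[of _ 1 p]
    by (subst integral_density) (auto intro!: AE_I2)
  also have "\<dots> = (\<integral>w. jac A g p (Y w) * h (?T w) \<partial>density P (\<lambda>w. ennreal (\<rho> (Y w p - x) / dens p x)))"
    unfolding cond_law_def using shift_measurable h jac_C1_measurable[of p]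
    by (subst integral_distr) (auto simp: jac_add_const)
  also have "\<dots> = (\<integral>w. \<rho> (Y w p - x) / dens p x * (jac A g p (Y w) * h (?T w)) \<partial>P)"
    using hT \<rho>_nonneg dens_pos[of p x]
    by (subst integral_density) (auto intro!: AE_I2 divide_nonneg_pos)
  also have "\<dots> = (\<integral>w. (h (?T w) * \<rho> (Y w p - x) * jac A g p (Y w)) / dens p x \<partial>P)"
    by (intro Bochner_Integration.integral_cong) (auto simp: field_simps)
  finally show ?thesis by simp
qed

lemma integral_weighted_tendsto:
  assumes h: "continuous_map (weak_whitney A 1) euclideanreal h" "bounded (h ` topspace (weak_whitney A 1))"
    and ps: "ps \<longlonglongrightarrow> p" and xs: "xs \<longlonglongrightarrow> x"
  shows "(\<lambda>n. \<integral>f. h f \<partial>weighted (ps n) (xs n)) \<longlonglongrightarrow> (\<integral>f. h f \<partial>weighted p x)"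
proof -
  have hm: "h \<in> borel_measurable C1" using h(1) by (rule continuous_map_measurable)
  obtain C where C: "C > 0" "\<And>x. \<bar>\<rho> x\<bar> \<le> C" using \<rho>_le by blast
  obtain D where D: "\<And>f. f \<in> C_space A 1 \<Longrightarrow> \<bar>h f\<bar> \<le> D"
    using h(2) by (auto simp: bounded_iff topspace_weak_whitney)
  let ?H = "\<lambda>p x w. h (\<lambda>a. Y w a + (x - Y w p)) * \<rho> (Y w p - x)"
  have "(\<lambda>n. \<integral>w. ?H (ps n) (xs n) w * jac A g (ps n) (Y w) \<partial>P) \<longlonglongrightarrow> (\<integral>w. ?H p x w * jac A g p (Y w) \<partial>P)"
  proof (rule integral_tendsto_bounded_mult[where C = "D * C"])
    fix n
    have "(\<lambda>w. h (\<lambda>a. Y w a + (xs n - Y w (ps n)))) \<in> borel_measurable P"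
      using measurable_compose[OF shift_measurable hm] .
    then show "?H (ps n) (xs n) \<in> borel_measurable P" by measurable
    fix w assume w: "w \<in> space P"
    have "\<bar>h (\<lambda>a. Y w a + (xs n - Y w (ps n)))\<bar> \<le> D"
      by (intro D C_space_add_const Y_C1_space w)
    then show "\<bar>?H (ps n) (xs n) w\<bar> \<le> D * C"
      unfolding abs_mult using C(2) by (intro mult_mono) auto
    show "0 \<le> jac A g (ps n) (Y w)" by (rule jac_nonneg[OF Y_C1_space[OF w] order_refl])
  next
    fix w assume w: "w \<in> space P"
    \<comment> \<open>A fixed path is moved only by constants, so along its translates
      \<open>h\<close> becomes a continuous function of a vector.\<close>
    have "continuous_map euclidean (prod_topology (weak_whitney A 1) euclidean) (\<lambda>y :: real^'k. (Y w, y))"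
      using Y_C1_space[OF w] by (intro continuous_map_pairedI) (auto simp: topspace_weak_whitney)
    from continuous_map_compose[OF continuous_map_compose[OF this continuous_map_add_const[OF order_refl]] h(1)]
    have "continuous_on UNIV (\<lambda>y. h (\<lambda>a. Y w a + y))" by (simp add: o_def)
    moreover have "(\<lambda>n. - (Y w (ps n) - xs n)) \<longlonglongrightarrow> - (Y w p - x)"
      using Y_tendsto[OF w ps xs] by (rule tendsto_minus)
    ultimately have "(\<lambda>n. h (\<lambda>a. Y w a + - (Y w (ps n) - xs n))) \<longlonglongrightarrow> h (\<lambda>a. Y w a + - (Y w p - x))"
      by (rule continuous_on_UNIV_tendsto)
    then have "(\<lambda>n. h (\<lambda>a. Y w a + (xs n - Y w (ps n)))) \<longlonglongrightarrow> h (\<lambda>a. Y w a + (x - Y w p))"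
      by (simp only: minus_diff_eq)
    then show "(\<lambda>n. ?H (ps n) (xs n) w) \<longlonglongrightarrow> ?H p x w"
      using \<rho>_tendsto[OF Y_tendsto[OF w ps xs]] by (rule tendsto_mult)
    show "(\<lambda>n. jac A g (ps n) (Y w)) \<longlonglongrightarrow> jac A g p (Y w)"
      by (rule continuous_on_UNIV_tendsto[OF continuous_on_jac[OF Y_C1_space[OF w] order_refl] ps])
  next
    show "(\<lambda>n. \<integral>w. jac A g (ps n) (Y w) \<partial>P) \<longlonglongrightarrow> (\<integral>w. jac A g p (Y w) \<partial>P)"
      by (rule continuous_on_UNIV_tendsto[OF jac_continuous ps])
  qed (rule jac_integrable)+
  then show ?thesis
    unfolding integral_weighted[OF hm]
    using dens_tendsto[OF ps xs] dens_pos[of p x] by (intro tendsto_divide) auto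
qed

lemma limitin_weighted:
  "limitin (weak_measure_topology (weak_whitney A 1)) (\<lambda>(p, x). weighted p x) (weighted p x) (at (p, x))"
  unfolding weak_measure_topology_def
proof (rule limitin_topology_generated_by)
  have w: "sets (weighted p x) = sets C1 \<and> finite_measure (weighted p x)" for p x
    using finite_measure_weighted by simp
  let ?T = "weak_whitney A 1 :: ('a \<Rightarrow> real^'k) topology"
  let ?S = "{{\<nu>. sets \<nu> = sets C1 \<and> finite_measure \<nu> \<and> (\<integral>x. h x \<partial>\<nu>) \<in> V} | h V.
        continuous_map ?T euclideanreal h \<and> bounded (h ` topspace ?T) \<and> open V}"
  \<comment> \<open>The test function \<open>0\<close> shows that the limit belongs to the
    underlying space of the weak topology.\<close>
  have "{\<nu>. sets \<nu> = sets C1 \<and> finite_measure \<nu> \<and> (\<integral>x. (0 :: real) \<partial>\<nu>) \<in> UNIV} \<in> ?S"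
    by (rule CollectI, rule exI[of _ "\<lambda>_. 0"], rule exI[of _ UNIV]) (auto intro: bounded_subset[of "{0}"])
  then show "weighted p x \<in> \<Union>?S" using w by blast
  fix U assume "U \<in> ?S" and m: "weighted p x \<in> U"
  then obtain h V where U: "U = {\<nu>. sets \<nu> = sets C1 \<and> finite_measure \<nu> \<and> (\<integral>x. h x \<partial>\<nu>) \<in> V}"
    and h: "continuous_map ?T euclideanreal h" "bounded (h ` topspace ?T)" "open V" by blast
  have "((\<lambda>z. \<integral>f. h f \<partial>weighted (fst z) (snd z)) \<longlongrightarrow> (\<integral>f. h f \<partial>weighted p x)) (at (p, x))"
    by (rule tendsto_at_pair) (simp add: integral_weighted_tendsto[OF h(1,2)])
  moreover have "(\<integral>f. h f \<partial>weighted p x) \<in> V" using m by (simp add: U)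
  ultimately have "\<forall>\<^sub>F z in at (p, x). (\<integral>f. h f \<partial>weighted (fst z) (snd z)) \<in> V"
    by (intro topological_tendstoD[OF _ h(3)])
  then show "\<forall>\<^sub>F z in at (p, x). (case z of (p, x) \<Rightarrow> weighted p x) \<in> U"
    by eventually_elim (use w in \<open>auto simp: U case_prod_beta\<close>)
qed

theorem z_KROK_field: "z_KROK A g P (\<lambda>w p. Y w p - L w)"
  unfolding z_KROK_def
proof (intro conjI)
  show "prob_space P" by unfold_locales
  show "(\<lambda>w p. Y w p - L w) \<in> measurable P C1" by (rule field_measurable)
  show "AE w in P. regular_value A (\<lambda>p. Y w p - L w) 0" by (rule AE_regular_value)
  have "isCont (\<lambda>(p, x). dens p x) (p, 0)" for p
    unfolding isCont_def by (rule tendsto_at_pair) (simp add: dens_tendsto)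
  then show "\<exists>\<rho>. (\<forall>p. (\<forall>x. 0 \<le> \<rho> p x) \<and> distributed P lborel (\<lambda>w. Y w p - L w) (\<lambda>x. ennreal (\<rho> p x))) \<and>
      (\<forall>p. isCont (\<lambda>(p, x). \<rho> p x) (p, 0))"
    using dens_pos field_distributed by (intro exI[of _ dens]) (auto intro: less_imp_le)
  show "\<exists>\<mu>. (\<forall>p. regular_cond_prob A P (\<lambda>w p. Y w p - L w) p (\<mu> p)) \<and>
      (\<forall>p x. finite_measure (density (\<mu> p x) (\<lambda>f. ennreal (jac A g p f)))) \<and>
      (\<forall>p. limitin (weak_measure_topology (weak_whitney A 1))
        (\<lambda>(p, x). density (\<mu> p x) (\<lambda>f. ennreal (jac A g p f)))
        (density (\<mu> p 0) (\<lambda>f. ennreal (jac A g p f))) (at (p, 0)))"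
    using regular_cond_prob_cond_law finite_measure_weighted limitin_weighted by (intro exI[of _ cond_law]) blast
qed

end

theorem theorem10p1:
  fixes A :: "('a::{t2_space, second_countable_topology}, 'm::finite) chart set"
    and g :: "('a, 'm) chart \<Rightarrow> 'a \<Rightarrow> real^'m^'m"
    and P :: "'w measure"
    and Y :: "'w \<Rightarrow> 'a \<Rightarrow> real^'k::finite"
    and L :: "'w \<Rightarrow> real^'k"
    and \<rho> :: "real^'k \<Rightarrow> real"
    and q :: enat
  assumes "smooth_atlas A" and "riemannian_metric A g"
    and "prob_space P"
    and "q \<ge> enat (1 + (CARD('m) - CARD('k)))"
    and "Y \<in> measurable P (borel_of (weak_whitney A q))"
    and "\<And>p. integrable P (\<lambda>\<omega>. jac A g p (Y \<omega>))"
    and "continuous_on UNIV (\<lambda>p. \<integral>\<omega>. jac A g p (Y \<omega>) \<partial>P)"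
    and "L \<in> borel_measurable P"
    and "indep_elements P (borel_of (weak_whitney A q)) Y borel L"
    and "distributed P lborel L (\<lambda>x. ennreal (\<rho> x))"
    and "continuous_on UNIV \<rho>" and "\<And>x. \<rho> x \<ge> 0" and "\<And>x. \<rho> x \<noteq> 0"
    and "bounded (range \<rho>)"
  shows "z_KROK A g P (\<lambda>\<omega> p. Y \<omega> p - L \<omega>)"
proof -
  interpret prob_space P by fact
  interpret translated_field A g P Y L \<rho> q
    using assms by unfold_locales
  show ?thesis by (rule z_KROK_field)
qed

end
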